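(* Let $G$ be a connected claw-free graph of order $n$. If $\sigma_{7}(G)\geq n-2$, then $G$ has a spanning tree with at most two branch vertices.
   Context: All graphs are finite and simple (no loops, no multiple edges). The order of a graph $G$ is $|G| = |V(G)|$. A graph is claw-free if it contains no induced subgraph isomorphic to $K_{1,3}$. For a vertex $v$ of $G$, $\deg_G(v)$ denotes the degree of $v$ in $G$. For an integer $k\geq 2$, $$\sigma_k(G)=\min\left\{ \sum_{x\in S}\deg_{G}(x) : S\subseteq V(G) \text{ is an independent set of } G,\ |S|=k\right\},$$ with the usual convention that $\sigma_k(G)=+\infty$ if $G$ has no independent set of $k$ vertices. A branch vertex of a tree is a vertex whose degree in the tree is at least three. *)

theory Defs
  imports "Graph_Theory.Graph_Theory" "HOL-Library.Extended_Nat"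
begin

text \<open>
  As in Graph_Theory, an undirected simple graph is a symmetric digraph: every edge
  is represented by its two opposite arcs.  Hence the degree of a vertex is its
  \<^const>\<open>out_degree\<close>.
\<close>

definition claw_free :: "('a,'b) pre_digraph \<Rightarrow> bool" where
  "claw_free G \<longleftrightarrow> \<not> (\<exists>H. induced_subgraph H G \<and> complete_bipartite_digraph 1 3 H)"

definition independent_set :: "('a,'b) pre_digraph \<Rightarrow> 'a set \<Rightarrow> bool" where
  "independent_set G S \<longleftrightarrow> S \<subseteq> verts G \<and> (\<forall>u\<in>S. \<forall>v\<in>S. (u, v) \<notin> arcs_ends G)"

text \<open>The infimum of the empty set in \<^typ>\<open>enat\<close> is \<open>\<infinity>\<close>.\<close>

definition sigma :: "nat \<Rightarrow> ('a,'b) pre_digraph \<Rightarrow> enat" where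
  "sigma k G = (INF S \<in> {S. independent_set G S \<and> card S = k}. enat (\<Sum>x\<in>S. out_degree G x))"

text \<open>
  The constants \<^const>\<open>tree\<close> and \<^const>\<open>spanning_tree\<close> only exclude directed
  cycles, so in a symmetric digraph the two arcs of a single edge already violate them.
  The cycles of an undirected simple graph are the directed cycles of length at least three.
\<close>

definition undirected_tree :: "('a,'b) pre_digraph \<Rightarrow> bool" where
  "undirected_tree T \<longleftrightarrow>
     graph T \<and> connected T \<and> \<not> (\<exists>p. pre_digraph.cycle T p \<and> length p \<ge> 3)"

definition undirected_spanning_tree :: "('a,'b) pre_digraph \<Rightarrow> ('a,'b) pre_digraph \<Rightarrow> bool" where
  "undirected_spanning_tree T G \<longleftrightarrow> undirected_tree T \<and> spanning T G"

definition branch_vertices :: "('a,'b) pre_digraph \<Rightarrow> 'a set" where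
  "branch_vertices T = {v \<in> verts T. out_degree T v \<ge> 3}"

end

theory Submission
  imports Defs
begin

text \<open>
  Among all spanning trees choose one with the fewest branch vertices, then with the fewest leaves,
  and then with the smallest subtree spanned by its branch vertices.  Suppose that it still has at
  least three branch vertices.  Claw-freeness and the absence of improving edge exchanges make its
  leaves, together with one or two suitable branch vertices when there are fewer than seven leaves,
  an independent set \<open>S\<close> of at least seven vertices with another branch vertex \<open>c\<close> outside.  Moreover,
  charging an adjacency \<open>s v\<close> with \<open>s \<in> S\<close> to the tree edge that leaves \<open>v\<close> towards \<open>s\<close> is injective, and of
  the three or more tree edges at \<open>c\<close> at most one is charged.  As a tree of order \<open>n\<close> has \<open>n - 1\<close>
  edges, seven vertices of \<open>S\<close> have degree sum at most \<open>n - 3\<close>.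
\<close>

section \<open>Connectivity by a set of edges\<close>

text \<open>A tree has 2 plus the sum of (degree - 2) over its branch vertices many leaves. Three
  branch vertices thus give at least five leaves, and fewer than seven occur in three cases only:
  three branch vertices of degree three (five leaves), four of degree three, or three of which one
  has degree four (six leaves each). This decides how many branch vertices must join the leaves in
  \<open>S\<close>, and leaves one over to play \<open>c\<close>.

  The obstacle is a leaf \<open>y\<close> and a branch vertex \<open>t\<close> with a common
  neighbour \<open>v\<close>, both adjacencies being charged to the same tree edge. The exchanges
  available there often merely relocate a branch vertex and keep both the number of branch vertices
  and the number of leaves; the third criterion exists to break these ties. It is stated through any
  vertex set that contains the branch vertices and is connected in the tree, so that a comparison
  needs just one suitable set for the new tree and not its exact subtree.\<close>

definition conn :: "'a set set \<Rightarrow> 'a \<Rightarrow> 'a \<Rightarrow> bool" where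
  "conn F = (\<lambda>x y. {x, y} \<in> F)\<^sup>*\<^sup>*"

definition deg :: "'a set set \<Rightarrow> 'a \<Rightarrow> nat" where
  "deg F z = card {w. {z, w} \<in> F}"

lemma conn_refl [simp]: "conn F x x"
  by (simp add: conn_def)

lemma conn_edge: "{x, y} \<in> F \<Longrightarrow> conn F x y"
  by (auto simp: conn_def)

lemma conn_trans: "conn F x y \<Longrightarrow> conn F y z \<Longrightarrow> conn F x z"
  by (auto simp: conn_def)

lemma conn_sym: "conn F x y \<Longrightarrow> conn F y x"
proof -
  have "symp (\<lambda>x y. {x, y} \<in> F)" by (auto simp: symp_def insert_commute)
  thus "conn F x y \<Longrightarrow> conn F y x"
    unfolding conn_def by (rule symp_rtranclp[THEN sympD])
qed

lemma conn_mono: "conn F x y \<Longrightarrow> F \<subseteq> F' \<Longrightarrow> conn F' x y"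
  unfolding conn_def by (erule rtranclp_mono[THEN predicate2D, rotated]) auto

lemma conn_step: "conn F x y \<Longrightarrow> {y, z} \<in> F \<Longrightarrow> conn F x z"
  using conn_trans conn_edge by metis

lemma conn_induct [consumes 1, case_names refl step]:
  assumes "conn F x y" "P x" "\<And>y z. conn F x y \<Longrightarrow> {y, z} \<in> F \<Longrightarrow> P y \<Longrightarrow> P z"
  shows "P y"
  using assms unfolding conn_def by (induct rule: rtranclp_induct) auto

lemma conn_subst_edges:
  assumes "conn F x y" "\<And>a b. {a, b} \<in> F \<Longrightarrow> conn F' a b"
  shows "conn F' x y"
  using assms(1) by (induct rule: conn_induct) (auto intro: conn_trans assms(2))

lemma conn_avoid_star:
  assumes "conn F x y" "\<not> conn F x a"
  shows "conn {e \<in> F. a \<notin> e} x y"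
  using assms(1)
proof (induct rule: conn_induct)
  case (step y z)
  have "y \<noteq> a" "z \<noteq> a" using step assms(2) conn_step by metis+
  thus ?case using step by (auto intro: conn_step)
qed simp

text \<open>The walk is cut at its first arrival at \<open>t\<close>; up to there it uses no edge at
  \<open>t\<close>.\<close>

lemma conn_last_exit:
  assumes "conn F x t" "x \<noteq> t"
  obtains p where "{p, t} \<in> F" "conn {e \<in> F. t \<notin> e} x p"
proof -
  have "conn F x t \<Longrightarrow> conn {e \<in> F. t \<notin> e} x y \<and> y \<noteq> t \<or> (\<exists>p. {p, t} \<in> F \<and> conn {e \<in> F. t \<notin> e} x p)"
    if "conn F x y" for y
    using that
  proof (induct rule: conn_induct)
    case (step y z)
    thus ?case by (cases "z = t") (auto intro: conn_step)
  qed (use assms in auto)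
  from this[OF assms(1)] assms(1) show ?thesis using that by blast
qed

lemma conn_edge_split:
  assumes "conn F x y" "\<not> conn (F - {{a, b}}) x y"
  shows "conn (F - {{a, b}}) x a \<and> conn (F - {{a, b}}) b y \<or>
         conn (F - {{a, b}}) x b \<and> conn (F - {{a, b}}) a y"
proof -
  have "conn (F - {{a, b}}) x y \<or> conn (F - {{a, b}}) x a \<and> conn (F - {{a, b}}) b y \<or>
         conn (F - {{a, b}}) x b \<and> conn (F - {{a, b}}) a y" using assms(1)
  proof (induct rule: conn_induct)
    case (step y z)
    show ?case
    proof (cases "{y, z} = {a, b}")
      case True
      thus ?thesis using step(3) by (auto simp: doubleton_eq_iff)
    next
      case False
      hence "{y, z} \<in> F - {{a, b}}" using step by auto
      thus ?thesis using step(3) conn_step by metis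
    qed
  qed simp
  thus ?thesis using assms(2) by blast
qed

text \<open>Map every vertex other than \<open>x\<close> to the edge towards its predecessor on a shortest walk from \<open>x\<close>.\<close>

lemma card_component_le:
  assumes "finite F"
  shows "card {y. conn F x y} \<le> Suc (card F)"
proof -
  define R where "R = {(x, y). {x, y} \<in> F}"
  define d where "d y = (LEAST n. (x, y) \<in> R ^^ n)" for y
  have Rc: "conn F a b \<longleftrightarrow> (a, b) \<in> R\<^sup>*" for a b
    unfolding conn_def R_def by (simp add: Enum.rtranclp_rtrancl_eq)
  have dR: "(x, y) \<in> R ^^ d y" if "conn F x y" for y
    using that unfolding Rc d_def rtrancl_power by (metis (mono_tags, lifting) LeastI)
  have dmin: "d y \<le> n" if "(x, y) \<in> R ^^ n" for y n
    using that unfolding d_def by (rule Least_le)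
  have "\<exists>p. conn F x p \<and> {p, y} \<in> F \<and> d y = Suc (d p)" if y: "conn F x y" "y \<noteq> x" for y
  proof -
    obtain m where m: "d y = Suc m"
      using dR[OF y(1)] y(2) by (cases "d y") auto
    then obtain p where p: "(x, p) \<in> R ^^ m" "(p, y) \<in> R" using dR[OF y(1)] by auto
    have "d p \<le> m" using p dmin by auto
    moreover have "d y \<le> Suc (d p)"
      using p relpow_Suc_I[OF dR p(2)] dmin relpow_imp_rtrancl[OF p(1)] Rc by metis
    ultimately have "d y = Suc (d p)" using m by simp
    moreover have "conn F x p" using relpow_imp_rtrancl[OF p(1)] Rc by metis
    ultimately show ?thesis using p(2) by (auto simp: R_def)
  qed
  then obtain p where p: "\<And>y. conn F x y \<Longrightarrow> y \<noteq> x \<Longrightarrow> conn F x (p y) \<and> {p y, y} \<in> F \<and> d y = Suc (d (p y))"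
    by metis
  have inj: "inj_on (\<lambda>y. {p y, y}) ({y. conn F x y} - {x})"
  proof (rule inj_onI)
    fix y z assume a: "y \<in> {y. conn F x y} - {x}" "z \<in> {y. conn F x y} - {x}" "{p y, y} = {p z, z}"
    show "y = z"
    proof (rule ccontr)
      assume "y \<noteq> z"
      hence "y = p z" "z = p y" using a(3) by (auto simp: doubleton_eq_iff)
      thus False using p[of y] p[of z] a by auto
    qed
  qed
  have im: "(\<lambda>y. {p y, y}) ` ({y. conn F x y} - {x}) \<subseteq> F" using p by auto
  have "finite ({y. conn F x y} - {x})" using inj im assms by (meson finite_imageD finite_subset)
  moreover have "card ({y. conn F x y} - {x}) \<le> card F"
    using inj im assms by (metis card_image card_mono)
  ultimately show ?thesis by (simp add: card_Diff_singleton)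
qed

section \<open>Trees and their directions\<close>

locale ugraph =
  fixes V :: "'a set" and adj :: "'a \<Rightarrow> 'a \<Rightarrow> bool"
  assumes finV: "finite V"
    and adj_sym: "adj u v \<Longrightarrow> adj v u"
    and adj_irrefl: "\<not> adj u u"
    and adj_V: "adj u v \<Longrightarrow> u \<in> V"
begin

text \<open>Acyclicity is encoded by the edge count, so that after an exchange only connectivity has
  to be verified; \<open>bridge\<close> recovers acyclicity.\<close>

definition is_tree :: "'a set set \<Rightarrow> bool" where
  "is_tree T \<longleftrightarrow> T \<subseteq> {{u, v} | u v. adj u v} \<and> V \<noteq> {} \<and> (\<forall>x\<in>V. \<forall>y\<in>V. conn T x y) \<and>
     Suc (card T) = card V"

lemma adj_V2: "adj u v \<Longrightarrow> v \<in> V"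
  using adj_V adj_sym by blast

lemma adj_neq: "adj u v \<Longrightarrow> u \<noteq> v"
  using adj_irrefl by blast

lemma edges_adj: "F \<subseteq> {{u, v} | u v. adj u v} \<Longrightarrow> {a, b} \<in> F \<Longrightarrow> adj a b"
proof -
  assume "F \<subseteq> {{u, v} | u v. adj u v}" "{a, b} \<in> F"
  then obtain u v where "{a, b} = {u, v}" "adj u v" by blast
  thus "adj a b" using adj_sym by (auto simp: doubleton_eq_iff)
qed

lemma finite_edges: "F \<subseteq> {{u, v} | u v. adj u v} \<Longrightarrow> finite F"
  by (rule finite_subset[of _ "Pow V"]) (auto simp: finV adj_V adj_V2)

lemma tree_adj: "is_tree T \<Longrightarrow> {a, b} \<in> T \<Longrightarrow> adj a b"
  unfolding is_tree_def using edges_adj by blast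

lemma tree_neq: "is_tree T \<Longrightarrow> {a, b} \<in> T \<Longrightarrow> a \<noteq> b"
  using tree_adj adj_neq by blast

lemma tree_finite: "is_tree T \<Longrightarrow> finite T"
  unfolding is_tree_def using finite_edges by blast

lemma tree_V: "is_tree T \<Longrightarrow> {a, b} \<in> T \<Longrightarrow> a \<in> V \<and> b \<in> V"
  using tree_adj adj_V adj_V2 by blast

lemma conn_V:
  assumes "conn F x y" "F \<subseteq> {{u, v} | u v. adj u v}"
  shows "x \<in> V \<longleftrightarrow> y \<in> V"
  using assms(1)
proof (induct rule: conn_induct)
  case refl
  show ?case by (rule refl)
next
  case (step y z)
  have "adj y z" using edges_adj[OF assms(2) step(2)] .
  hence "y \<in> V" "z \<in> V" using adj_V[of y z] adj_V2[of y z] by auto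
  thus ?case using step(3) by simp
qed

lemma card_connected_ge:
  assumes "F \<subseteq> {{u, v} | u v. adj u v}" "\<And>x y. x \<in> V \<Longrightarrow> y \<in> V \<Longrightarrow> conn F x y"
  shows "card V \<le> Suc (card F)"
proof (cases "V = {}")
  case False
  then obtain x where x: "x \<in> V" by auto
  have "{y. conn F x y} = V" using assms(2)[OF x] conn_V[OF _ assms(1)] x by blast
  thus ?thesis using card_component_le[OF finite_edges[OF assms(1)], of x] by simp
qed simp

text \<open>If the ends stayed connected, the remaining edges would still connect \<open>V\<close>,
  with fewer than \<open>card V - 1\<close> of them.\<close>

lemma bridge:
  assumes "is_tree T" "{a, b} \<in> T"
  shows "\<not> conn (T - {{a, b}}) a b"
proof
  assume c: "conn (T - {{a, b}}) a b"
  have "conn (T - {{a, b}}) x y" if "x \<in> V" "y \<in> V" for x y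
  proof (rule conn_subst_edges[of T])
    show "conn T x y" using assms that by (auto simp: is_tree_def)
    fix u v assume "{u, v} \<in> T"
    thus "conn (T - {{a, b}}) u v" using c conn_sym[OF c]
      by (cases "{u, v} = {a, b}") (auto simp: doubleton_eq_iff intro: conn_edge)
  qed
  hence "card V \<le> Suc (card (T - {{a, b}}))"
    using assms(1) by (intro card_connected_ge) (auto simp: is_tree_def)
  moreover have "card (T - {{a, b}}) < card T"
    using assms tree_finite by (metis card_Diff1_less)
  ultimately show False using assms(1) by (auto simp: is_tree_def)
qed

lemma side_total:
  assumes "is_tree T" "{a, b} \<in> T" "z \<in> V"
  shows "conn (T - {{a, b}}) a z \<or> conn (T - {{a, b}}) b z"
proof -
  have "conn T a z" using assms(1,3) tree_V[OF assms(1,2)] by (simp add: is_tree_def)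
  thus ?thesis using conn_edge_split[of T a z a b] by auto
qed

lemma side_excl:
  assumes "is_tree T" "{a, b} \<in> T" "conn (T - {{a, b}}) a z" "conn (T - {{a, b}}) b z"
  shows False
  using bridge[OF assms(1,2)] conn_trans[OF assms(3) conn_sym[OF assms(4)]] by blast

text \<open>In a tree, a walk that can avoid each single edge of \<open>D\<close> can avoid all of them,
  because every edge of a minimal connecting edge set separates its two ends.\<close>

lemma conn_diff:
  assumes T: "is_tree T" and F: "F \<subseteq> T" "conn F p q" and D: "\<And>e. e \<in> D \<Longrightarrow> conn (T - {e}) p q"
  shows "conn (F - D) p q"
proof -
  have "finite F" using F(1) tree_finite[OF T] finite_subset by blast
  hence "\<exists>P. P \<subseteq> F \<and> conn P p q \<and> (\<forall>P'. P' \<subset> P \<longrightarrow> \<not> conn P' p q)"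
    using F(2)
  proof (induct F rule: finite_psubset_induct)
    case (psubset A)
    show ?case
    proof (cases "\<exists>P'. P' \<subset> A \<and> conn P' p q")
      case True
      then obtain P' where "P' \<subset> A" "conn P' p q" by blast
      then obtain P where "P \<subseteq> P'" "conn P p q" "\<forall>P'. P' \<subset> P \<longrightarrow> \<not> conn P' p q"
        using psubset(2)[of P'] by blast
      thus ?thesis using \<open>P' \<subset> A\<close> by blast
    qed (use psubset in blast)
  qed
  then obtain P where P: "P \<subseteq> F" "conn P p q" "\<And>P'. P' \<subset> P \<Longrightarrow> \<not> conn P' p q" by blast
  have "P \<inter> D = {}"
  proof (rule ccontr)
    assume "P \<inter> D \<noteq> {}"
    then obtain e where e: "e \<in> P" "e \<in> D" by blast
    then obtain a b where ab: "e = {a, b}" using P(1) F(1) T unfolding is_tree_def by blast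
    have sub: "P - {e} \<subseteq> T - {{a, b}}" using P(1) F(1) ab by blast
    have "\<not> conn (P - {e}) p q" using P(3)[of "P - {e}"] e by blast
    hence "conn (P - {e}) p a \<and> conn (P - {e}) b q \<or> conn (P - {e}) p b \<and> conn (P - {e}) a q"
      using conn_edge_split[OF P(2), of a b] ab by simp
    hence 1: "conn (T - {{a, b}}) p a \<and> conn (T - {{a, b}}) b q \<or>
        conn (T - {{a, b}}) p b \<and> conn (T - {{a, b}}) a q"
      using conn_mono[OF _ sub] by blast
    have 2: "conn (T - {{a, b}}) p q" using D e ab by auto
    from 1 have "conn (T - {{a, b}}) a b"
    proof (elim disjE conjE)
      assume "conn (T - {{a, b}}) p a" "conn (T - {{a, b}}) b q"
      thus ?thesis by (rule conn_trans[OF conn_trans[OF conn_sym 2] conn_sym])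
    next
      assume "conn (T - {{a, b}}) p b" "conn (T - {{a, b}}) a q"
      thus ?thesis using conn_trans[OF conn_trans[OF _ conn_sym[OF 2]]] by blast
    qed
    moreover have "{a, b} \<in> T" using e(1) ab P(1) F(1) by auto
    ultimately show False using bridge T by blast
  qed
  hence "P \<subseteq> F - D" using P(1) by blast
  thus ?thesis by (rule conn_mono[OF P(2)])
qed

text \<open>\<open>dir T c p z\<close>: the tree path from \<open>c\<close> to \<open>z\<close> starts with the edge to \<open>p\<close>.\<close>

definition side :: "'a set set \<Rightarrow> 'a \<Rightarrow> 'a \<Rightarrow> 'a \<Rightarrow> bool" where
  "side T a b z \<longleftrightarrow> conn (T - {{a, b}}) a z"

definition dir :: "'a set set \<Rightarrow> 'a \<Rightarrow> 'a \<Rightarrow> 'a \<Rightarrow> bool" where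
  "dir T c p z \<longleftrightarrow> {c, p} \<in> T \<and> side T p c z"

text \<open>This says that \<open>c\<close> is an inner vertex of the tree path from
  \<open>x\<close> to \<open>y\<close>; the ends are excluded because in a tree no direction leads
  from \<open>c\<close> to \<open>c\<close>.\<close>

definition btw :: "'a set set \<Rightarrow> 'a \<Rightarrow> 'a \<Rightarrow> 'a \<Rightarrow> bool" where
  "btw T c x y \<longleftrightarrow> (\<exists>p p'. dir T c p x \<and> dir T c p' y \<and> p \<noteq> p')"

end

section \<open>Edge exchanges\<close>

definition eset :: "('a \<times> 'a) list \<Rightarrow> 'a set set" where
  "eset L = set (map (\<lambda>(a, b). {a, b}) L)"

text \<open>As a sum over an explicit list, the incidences at \<open>z\<close> simplify to indicator
  terms, so the degree changes of a concrete exchange become linear arithmetic.\<close>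

definition cnt :: "('a \<times> 'a) list \<Rightarrow> 'a \<Rightarrow> nat" where
  "cnt L z = (\<Sum>(a, b)\<leftarrow>L. of_bool (z = a) + of_bool (z = b))"

lemma cnt_simps [simp]:
  "cnt [] z = 0"
  "cnt ((a, b) # L) z = of_bool (z = a) + of_bool (z = b) + cnt L z"
  by (simp_all add: cnt_def)

lemma eset_simps [simp]:
  "eset [] = {}"
  "eset ((a, b) # L) = insert {a, b} (eset L)"
  by (simp_all add: eset_def)

lemma finite_eset [simp]: "finite (eset L)"
  by (simp add: eset_def)

lemma finite_nbrs: "finite F \<Longrightarrow> finite {w. {z, w} \<in> F}"
proof -
  assume "finite F"
  hence "finite ((\<lambda>w. {z, w}) -` F)"
    by (rule finite_vimageI) (auto simp: inj_def doubleton_eq_iff)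
  thus ?thesis by (simp add: vimage_def)
qed

lemma deg_insert:
  assumes "finite F" "{a, b} \<notin> F" "a \<noteq> b"
  shows "deg (insert {a, b} F) z = deg F z + (of_bool (z = a) + of_bool (z = b))"
proof -
  have "{w. {z, w} \<in> insert {a, b} F} =
      (if z = a then insert b {w. {z, w} \<in> F} else if z = b then insert a {w. {z, w} \<in> F}
       else {w. {z, w} \<in> F})"
    by (auto simp: doubleton_eq_iff)
  moreover have "b \<notin> {w. {a, w} \<in> F}" "a \<notin> {w. {b, w} \<in> F}"
    using assms(2) by (auto simp: insert_commute)
  ultimately show ?thesis
    using assms finite_nbrs[OF assms(1)] by (auto simp: deg_def)
qed

lemma deg_eset:
  assumes "finite F" "distinct (map (\<lambda>(a, b). {a, b}) L)" "F \<inter> eset L = {}"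
    "\<And>a b. (a, b) \<in> set L \<Longrightarrow> a \<noteq> b"
  shows "deg (F \<union> eset L) z = deg F z + cnt L z"
  using assms
proof (induct L)
  case (Cons e L)
  obtain a b where e: "e = (a, b)" by fastforce
  have 1: "deg (F \<union> eset L) z = deg F z + cnt L z" using Cons e by auto
  have "{a, b} \<notin> F \<union> eset L" using Cons(3,4) e by (auto simp: eset_def)
  moreover have "a \<noteq> b" using Cons(5) e by auto
  ultimately have "deg (insert {a, b} (F \<union> eset L)) z = deg (F \<union> eset L) z + (of_bool (z = a) + of_bool (z = b))"
    using assms(1) by (intro deg_insert) auto
  thus ?case using 1 e by simp
qed simp

context ugraph begin

definition xch :: "'a set set \<Rightarrow> ('a \<times> 'a) list \<Rightarrow> ('a \<times> 'a) list \<Rightarrow> 'a set set" where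
  "xch T D N = (T - eset D) \<union> eset N"

text \<open>Connecting \<open>V\<close> takes at least \<open>card V - 1\<close> edges. Hence
  connectivity together with \<open>length N\<close> \<le> \<open>length D\<close> already forces
  the new edges to be distinct, absent from the rest of \<open>T\<close>, and as many as the deleted
  ones; none of this has to be assumed. The degree balance is additive because subtraction on
  naturals truncates.\<close>

lemma exchange:
  assumes T: "is_tree T"
    and D: "\<And>a b. (a, b) \<in> set D \<Longrightarrow> {a, b} \<in> T" "distinct (map (\<lambda>(a, b). {a, b}) D)"
    and N: "\<And>a b. (a, b) \<in> set N \<Longrightarrow> adj a b" "length N \<le> length D"
    and C: "\<And>a b. (a, b) \<in> set D \<Longrightarrow> conn (xch T D N) a b"
  shows "is_tree (xch T D N)" "deg (xch T D N) z + cnt D z = deg T z + cnt N z"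
proof -
  let ?T = "xch T D N"
  have fT: "finite T" using tree_finite[OF T] .
  have DT: "eset D \<subseteq> T" using D(1) by (auto simp: eset_def)
  have TE: "T \<subseteq> {{u, v} | u v. adj u v}" using T by (simp add: is_tree_def)
  have NE: "eset N \<subseteq> {{u, v} | u v. adj u v}" using N(1) by (auto simp: eset_def)
  have sub: "?T \<subseteq> {{u, v} | u v. adj u v}"
    using TE NE by (auto simp: xch_def)
  have con: "conn ?T x y" if "x \<in> V" "y \<in> V" for x y
  proof (rule conn_subst_edges[of T])
    show "conn T x y" using T that by (auto simp: is_tree_def)
    fix a b assume ab: "{a, b} \<in> T"
    show "conn ?T a b"
    proof (cases "{a, b} \<in> eset D")
      case True
      then obtain a' b' where ab': "(a', b') \<in> set D" "{a, b} = {a', b'}" by (auto simp: eset_def)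
      thus ?thesis using C[OF ab'(1)] conn_sym[OF C[OF ab'(1)]] by (auto simp: doubleton_eq_iff)
    next
      case False
      thus ?thesis using ab by (intro conn_edge) (auto simp: xch_def)
    qed
  qed
  have cD: "card (eset D) = length D" using distinct_card[OF D(2)] by (simp add: eset_def)
  have cN: "card (eset N) \<le> length N" unfolding eset_def by (metis card_length length_map)
  have c1: "card (T - eset D) + length D = card T"
    using cD card_Diff_subset[OF finite_eset DT] card_mono[OF fT DT] by simp
  have c2: "card ?T + card ((T - eset D) \<inter> eset N) = card (T - eset D) + card (eset N)"
    unfolding xch_def using card_Un_Int[of "T - eset D" "eset N"] fT by simp
  have c3: "card V \<le> Suc (card ?T)" using card_connected_ge[OF sub con] .
  have c4: "Suc (card T) = card V" using T by (simp add: is_tree_def)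
  have eq: "card ?T = card T" "card ((T - eset D) \<inter> eset N) = 0" "card (eset N) = length N"
    using c1 c2 c3 c4 cN N(2) by linarith+
  show "is_tree ?T" unfolding is_tree_def
    using sub con eq(1) c4 T by (simp add: is_tree_def)
  have dN: "distinct (map (\<lambda>(a, b). {a, b}) N)"
    using eq(3) by (intro card_distinct) (simp add: eset_def)
  have disj: "(T - eset D) \<inter> eset N = {}" using eq(2) fT by simp
  have "deg ((T - eset D) \<union> eset N) z = deg (T - eset D) z + cnt N z"
    using fT dN disj N(1) adj_neq by (intro deg_eset) auto
  moreover have "deg ((T - eset D) \<union> eset D) z = deg (T - eset D) z + cnt D z"
    using fT D tree_neq[OF T] by (intro deg_eset) auto
  moreover have "(T - eset D) \<union> eset D = T" using DT by blast
  ultimately show "deg ?T z + cnt D z = deg T z + cnt N z" by (simp add: xch_def)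
qed

section \<open>Sides, directions and betweenness in a tree\<close>

lemma side_self [simp]: "side T a b a"
  by (simp add: side_def)

lemma side_iff:
  assumes "is_tree T" "{a, b} \<in> T" "z \<in> V"
  shows "side T b a z \<longleftrightarrow> \<not> side T a b z"
  using side_total[OF assms] side_excl[OF assms(1,2)] by (auto simp: side_def insert_commute)

text \<open>By \<open>conn_diff\<close> it is enough that no single deleted edge separates
  \<open>p\<close> from \<open>q\<close>. This reduces connectivity after any exchange to statements
  about sides in \<open>T\<close>, one deleted edge at a time.\<close>

lemma conn_same_side:
  assumes T: "is_tree T" and "p \<in> V" "q \<in> V"
    and D: "\<And>a b. (a, b) \<in> set D \<Longrightarrow> side T a b p \<and> side T a b q \<or> side T b a p \<and> side T b a q"
  shows "conn (T - eset D) p q"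
proof (rule conn_diff[OF T order_refl])
  show "conn T p q" using assms by (simp add: is_tree_def)
  fix e assume "e \<in> eset D"
  then obtain a b where ab: "(a, b) \<in> set D" "e = {a, b}" by (auto simp: eset_def)
  have "conn (T - {{a, b}}) a p \<and> conn (T - {{a, b}}) a q \<or> conn (T - {{a, b}}) b p \<and> conn (T - {{a, b}}) b q"
    using D[OF ab(1)] by (simp add: side_def insert_commute)
  thus "conn (T - {e}) p q" unfolding ab(2) by (blast intro: conn_trans[OF conn_sym])
qed

lemma conn_xch_same_side:
  assumes T: "is_tree T" and "p \<in> V" "q \<in> V"
    and D: "\<And>a b. (a, b) \<in> set D \<Longrightarrow> side T a b p \<and> side T a b q \<or> side T b a p \<and> side T b a q"
  shows "conn (xch T D N) p q"
  by (rule conn_mono[OF conn_same_side[OF assms]]) (auto simp: xch_def)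

lemma dirD:
  assumes "dir T c p z"
  shows "{c, p} \<in> T" "side T p c z"
  using assms by (auto simp: dir_def)

lemma dir_V:
  assumes T: "is_tree T" and d: "dir T c p z"
  shows "c \<in> V" "p \<in> V" "z \<in> V"
proof -
  show "c \<in> V" "p \<in> V" using tree_V[OF T dirD(1)[OF d]] by auto
  moreover have "conn T p z"
    using dirD(2)[OF d] unfolding side_def by (rule conn_mono) auto
  ultimately show "z \<in> V" using conn_V[of T p z] T by (simp add: is_tree_def)
qed

lemma dir_neq: "is_tree T \<Longrightarrow> dir T c p z \<Longrightarrow> z \<noteq> c"
  using bridge[of T p c] by (auto simp: dir_def side_def insert_commute)

lemma dir_nbr_neq: "is_tree T \<Longrightarrow> dir T c p z \<Longrightarrow> p \<noteq> c"
  using tree_neq[of T c p] by (auto simp: dir_def)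

lemma dir_self: "{c, p} \<in> T \<Longrightarrow> dir T c p p"
  by (simp add: dir_def)

lemma dir_conn:
  assumes "dir T c p x" "conn {e \<in> T. c \<notin> e} x y"
  shows "dir T c p y"
proof -
  have "conn (T - {{p, c}}) x y" using assms(2) by (rule conn_mono) auto
  thus ?thesis using assms(1) by (auto simp: dir_def side_def intro: conn_trans)
qed

lemma dir_ex:
  assumes T: "is_tree T" and z: "c \<in> V" "z \<in> V" "c \<noteq> z"
  obtains p where "dir T c p z"
proof -
  have "conn T z c" using T z unfolding is_tree_def by blast
  then obtain p where p: "{p, c} \<in> T" "conn {e \<in> T. c \<notin> e} z p"
    using z(3) by (metis conn_last_exit)
  have "dir T c p p" using p(1) by (simp add: dir_self insert_commute)
  hence "dir T c p z" using dir_conn conn_sym[OF p(2)] by blast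
  thus ?thesis using that by blast
qed

lemma dir_conn2:
  assumes T: "is_tree T" and d: "dir T c p x"
  shows "conn {e \<in> T. c \<notin> e} p x"
proof -
  have "conn (T - {{p, c}}) p x" using d by (simp add: dir_def side_def)
  moreover have "\<not> conn (T - {{p, c}}) p c"
    using bridge[OF T, of p c] d by (simp add: dir_def insert_commute)
  ultimately have "conn {e \<in> T - {{p, c}}. c \<notin> e} p x" by (rule conn_avoid_star)
  thus ?thesis by (rule conn_mono) auto
qed

lemma dir_unique:
  assumes T: "is_tree T" and d: "dir T c p x" "dir T c p' x"
  shows "p = p'"
proof (rule ccontr)
  assume "p \<noteq> p'"
  have "conn {e \<in> T. c \<notin> e} p p'"
    using conn_trans[OF dir_conn2[OF T d(1)] conn_sym[OF dir_conn2[OF T d(2)]]] .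
  hence "conn (T - {{p, c}}) p p'" by (rule conn_mono) auto
  moreover have "{p', c} \<in> T - {{p, c}}"
    using d(2) \<open>p \<noteq> p'\<close> tree_neq[OF T dirD(1)[OF d(1)]] by (auto simp: dir_def insert_commute doubleton_eq_iff)
  ultimately have "conn (T - {{p, c}}) p c" by (rule conn_step)
  thus False using bridge[OF T, of p c] d(1) by (simp add: dir_def insert_commute)
qed

lemma dir_step:
  assumes T: "is_tree T" and "dir T c p x" "{x, y} \<in> T" "y \<noteq> c"
  shows "dir T c p y"
proof -
  have "x \<noteq> c" using dir_neq assms by blast
  thus ?thesis using assms by (intro dir_conn[OF assms(2)] conn_edge) auto
qed

lemma dir_other_side:
  assumes T: "is_tree T" and "dir T c p z" "{c, p'} \<in> T" "p' \<noteq> p"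
  shows "side T c p' z"
  using side_iff[OF T assms(3) dir_V(3)[OF T assms(2)]] dir_unique[OF T assms(2), of p'] assms(3,4)
  by (auto simp: dir_def)

lemma not_dir_side:
  assumes T: "is_tree T" and "{c, p} \<in> T" "z \<in> V" "\<not> dir T c p z"
  shows "side T c p z"
  using side_iff[OF T assms(2,3)] assms(2,4) by (auto simp: dir_def)

text \<open>The tree path from \<open>t\<close> to \<open>z\<close> stays on the side of
  \<open>t\<close> of the edge \<open>t x\<close> and so misses \<open>v\<close>. Seen from
  \<open>v\<close>, \<open>z\<close> therefore lies where \<open>t\<close> lies.\<close>

lemma dir_far:
  assumes T: "is_tree T" and d: "dir T t x v" "dir T v u t" "z \<in> V" "\<not> dir T t x z"
  shows "dir T v u z"
proof -
  have tx: "{t, x} \<in> T" using d dirD by blast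
  have "conn (T - {{t, x}}) t z" using not_dir_side[OF T tx d(3,4)] by (simp add: side_def)
  moreover have "\<not> conn (T - {{t, x}}) t v"
    using d(1) side_iff[OF T tx dir_V(3)[OF T d(1)]] by (simp add: dir_def side_def)
  ultimately have "conn {e \<in> T - {{t, x}}. v \<notin> e} t z" by (rule conn_avoid_star)
  hence "conn {e \<in> T. v \<notin> e} t z" by (rule conn_mono) auto
  thus ?thesis using dir_conn d(2) by blast
qed

lemma dir_beyond:
  assumes T: "is_tree T" and d: "dir T t x v" "dir T v u t" "dir T v d z" "d \<noteq> u"
  shows "dir T t x z"
  using dir_far[OF T d(1,2) dir_V(3)[OF T d(3)]] dir_unique[OF T d(3), of u] d(4) by blast

lemma btw_sym: "btw T c x y \<Longrightarrow> btw T c y x"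
  unfolding btw_def by metis

lemma btw_V:
  assumes "is_tree T" "btw T c x y"
  shows "c \<in> V" "x \<in> V" "y \<in> V"
  using assms dir_V unfolding btw_def by blast+

lemma btw_neq:
  assumes "is_tree T" "btw T c x y"
  shows "x \<noteq> c" "y \<noteq> c" "x \<noteq> y"
  using assms dir_neq dir_unique unfolding btw_def by blast+

lemma btw_dir:
  assumes T: "is_tree T" and b: "btw T j t y" and d: "dir T t a j"
  shows "dir T t a y"
proof -
  obtain p p' where p: "dir T j p t" "dir T j p' y" "p \<noteq> p'" using b by (auto simp: btw_def)
  show ?thesis using dir_beyond[OF T d p(1,2)] p(3) by blast
qed

lemma btw_move:
  assumes T: "is_tree T" and b: "btw T c t v" and d: "dir T v u t" and "u \<noteq> c"
  shows "btw T c t u"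
proof -
  obtain p p' where p: "dir T c p t" "dir T c p' v" "p \<noteq> p'" using b by (auto simp: btw_def)
  have "{v, u} \<in> T" using d dirD by blast
  hence "dir T c p' u" using dir_step[OF T p(2)] assms(4) by blast
  thus ?thesis using p by (auto simp: btw_def)
qed

lemma btw_trans:
  assumes T: "is_tree T" and b: "btw T j u t" "btw T t u y"
  shows "btw T j u y"
proof -
  obtain p p' where p: "dir T j p u" "dir T j p' t" "p \<noteq> p'" using b by (auto simp: btw_def)
  obtain a where a: "dir T t a j" using btw_V[OF T b(1)] btw_neq[OF T b(1)] by (metis dir_ex[OF T])
  have "dir T t a u" using btw_dir[OF T btw_sym[OF b(1)] a] .
  hence "\<not> dir T t a y" using b(2) dir_unique[OF T] by (metis btw_def)
  hence "dir T j p' y" using dir_far[OF T a p(2) btw_V(3)[OF T b(2)]] by blast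
  thus ?thesis using p by (auto simp: btw_def)
qed

lemma deg_ge:
  assumes T: "is_tree T" and "finite A" "\<And>a. a \<in> A \<Longrightarrow> {c, a} \<in> T"
  shows "card A \<le> deg T c"
  unfolding deg_def using assms finite_nbrs[OF tree_finite[OF T], of c] by (intro card_mono) auto

lemma btw_deg:
  assumes T: "is_tree T" and "btw T c x y"
  shows "2 \<le> deg T c"
proof -
  obtain p p' where p: "{c, p} \<in> T" "{c, p'} \<in> T" "p \<noteq> p'" using assms dirD unfolding btw_def by metis
  have "card {p, p'} \<le> deg T c" by (rule deg_ge[OF T]) (use p in auto)
  thus ?thesis using p(3) by simp
qed

lemma btw3_deg:
  assumes T: "is_tree T" and "btw T c x y" "btw T c x z" "btw T c y z"
  shows "3 \<le> deg T c"
proof -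
  obtain p p' where p: "dir T c p x" "dir T c p' y" "p \<noteq> p'" using assms unfolding btw_def by blast
  obtain p'' where p'': "dir T c p'' z" using assms unfolding btw_def by blast
  have "p \<noteq> p''" "p' \<noteq> p''"
    using assms(3,4) p(1,2) p'' dir_unique[OF T] unfolding btw_def by metis+
  moreover have "card {p, p', p''} \<le> deg T c"
    by (rule deg_ge[OF T]) (use p p'' dirD(1) in auto)
  ultimately show ?thesis using p(3) by simp
qed

text \<open>The vertex sought is the one where the paths from \<open>r\<close> to \<open>x\<close>
  and to \<open>z\<close> part. \<open>C\<close> collects the vertices common to both paths, each
  with its neighbour towards \<open>r\<close>. A pair with the fewest vertices beyond it is the last
  common one, since a common next vertex would have strictly fewer.\<close>

lemma median:
  assumes T: "is_tree T" and V: "r \<in> V" "x \<in> V" "z \<in> V" and ne: "r \<noteq> x" "r \<noteq> z" "x \<noteq> z"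
  shows "btw T r x z \<or> btw T x r z \<or> btw T z r x \<or> (\<exists>g. btw T g r x \<and> btw T g r z \<and> btw T g x z)"
proof (cases "btw T r x z")
  case False
  obtain m m' where m: "dir T r m x" "dir T r m' z" using V ne by (metis dir_ex[OF T])
  have mm: "m' = m" using False m unfolding btw_def by blast
  define C where "C = {(g, p). dir T g p r \<and> (g = x \<or> btw T g r x) \<and> (g = z \<or> btw T g r z)}"
  have rm: "{m, r} \<in> T" "{r, m} \<in> T" "m \<noteq> r"
    using dirD(1)[OF m(1)] tree_neq[OF T dirD(1)[OF m(1)]] by (auto simp: insert_commute)
  have aux: "btw T p r w" if w: "dir T g p w" "dir T p g r" "p \<noteq> w" for g p w
  proof -
    obtain p'' where p'': "dir T p p'' w"
      using dir_ex[OF T _ _ w(3)] dir_V[OF T w(1)] by blast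
    have "p'' \<noteq> g"
    proof
      assume "p'' = g"
      thus False using side_excl[OF T, of g p w] dirD[OF w(1)] dirD[OF p'']
        by (auto simp: side_def insert_commute)
    qed
    thus ?thesis using w(2) p'' by (auto simp: btw_def)
  qed
  have "dir T m r r" using rm by (simp add: dir_self)
  hence "(m, r) \<in> C" using aux[OF m(1)] aux[OF m(2)[unfolded mm]] by (auto simp: C_def)
  then obtain gp where gp: "gp \<in> C" "\<And>gp'. gp' \<in> C \<Longrightarrow>
      card {w. side T (fst gp) (snd gp) w} \<le> card {w. side T (fst gp') (snd gp') w}"
    using ex_has_least_nat[of "\<lambda>x. x \<in> C" "(m, r)" "\<lambda>gp. card {w. side T (fst gp) (snd gp) w}"] by blast
  obtain g p where g: "gp = (g, p)" by fastforce
  have gC: "dir T g p r" "g = x \<or> btw T g r x" "g = z \<or> btw T g r z" using gp(1) g by (auto simp: C_def)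
  consider "g = x" | "g = z" | "g \<noteq> x" "g \<noteq> z" by blast
  thus ?thesis
  proof cases
    case 3
    obtain px pz where px: "dir T g px x" "dir T g pz z"
      using 3 gC dir_V[OF T gC(1)] V by (metis dir_ex[OF T])
    have pp: "px \<noteq> p" "pz \<noteq> p"
      using 3 gC px dir_unique[OF T] unfolding btw_def by metis+
    show ?thesis
    proof (cases "px = pz")
      case True
      have gpx: "{g, px} \<in> T" "{px, g} \<in> T" using dirD(1)[OF px(1)] by (auto simp: insert_commute)
      have "side T g px r" using dir_other_side[OF T gC(1) gpx(1)] pp by blast
      hence 1: "dir T px g r" using gpx by (simp add: dir_def)
      have "(px, g) \<in> C" using 1 aux[OF px(1) 1] aux[OF px(2)] True by (auto simp: C_def)
      hence le: "card {w. side T g p w} \<le> card {w. side T px g w}" using gp(2) g by fastforce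
      have gp': "{g, p} \<in> T" "{p, g} \<in> T" using dirD(1)[OF gC(1)] by (auto simp: insert_commute)
      have V': "w \<in> V" if "side T px g w" for w
        using that gpx dir_V(3)[OF T, of g px w] by (simp add: dir_def)
      have Vg: "w \<in> V" if "side T g p w" for w
        using that gp' dir_V(3)[OF T, of p g w] by (simp add: dir_def)
      have "side T g p w" if "side T px g w" for w
        using dir_other_side[OF T _ gp'(1), of px w] that gpx pp by (simp add: dir_def)
      moreover have "\<not> side T px g g" using side_iff[OF T gpx(1)] tree_V[OF T gpx(1)] by simp
      ultimately have "{w. side T px g w} \<subset> {w. side T g p w}" by auto
      moreover have "finite {w. side T g p w}" by (rule finite_subset[OF _ finV]) (use Vg in blast)
      ultimately show ?thesis using le by (meson psubset_card_mono not_le)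
    next
      case False
      thus ?thesis using px 3 gC unfolding btw_def by blast
    qed
  qed (use gC ne btw_sym in \<open>blast+\<close>)
qed simp

lemma leaf_not_btw: "is_tree T \<Longrightarrow> deg T y \<le> 1 \<Longrightarrow> \<not> btw T y a b"
  using btw_deg by fastforce

text \<open>\<open>net T t y\<close>: some spanning tree has the degrees of \<open>T\<close>, except that one unit has
  moved from \<open>t\<close> to \<open>y\<close>.  For \<open>jnet T j t y\<close> one unit has moved from \<open>j\<close> and one from some further vertex,
  so a vertex \<open>j\<close> of degree three stops branching.\<close>

definition net :: "'a set set \<Rightarrow> 'a \<Rightarrow> 'a \<Rightarrow> bool" where
  "net T t y \<longleftrightarrow> (\<exists>T'. is_tree T' \<and>
     (\<forall>z. deg T' z + of_bool (z = t) = deg T z + of_bool (z = y)))"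

definition jnet :: "'a set set \<Rightarrow> 'a \<Rightarrow> 'a \<Rightarrow> 'a \<Rightarrow> bool" where
  "jnet T j t y \<longleftrightarrow> (\<exists>T' p. is_tree T' \<and> p \<noteq> j \<and>
     (\<forall>z. deg T' z + (of_bool (z = j) + of_bool (z = p)) = deg T z + (of_bool (z = t) + of_bool (z = y))))"

lemma jnet_sym: "jnet T j t y \<Longrightarrow> jnet T j y t"
  unfolding jnet_def by (simp add: add.commute)

lemma tree_edgeD:
  assumes "is_tree T" "{a, b} \<in> T"
  shows "a \<in> V" "b \<in> V" "a \<noteq> b"
  using tree_V[OF assms] tree_neq[OF assms] by auto

section \<open>A catalogue of exchanges that move one or two units of degree\<close>

lemma net_intro:
  assumes "is_tree (xch T D N)" "\<And>z. deg (xch T D N) z + cnt D z = deg T z + cnt N z"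
    and "\<And>z. cnt D z + of_bool (z = y) = cnt N z + of_bool (z = t)"
  shows "net T t y"
  unfolding net_def
proof (intro exI[of _ "xch T D N"] conjI allI assms(1))
  show "deg (xch T D N) z + of_bool (z = t) = deg T z + of_bool (z = y)" for z
    using assms(2,3)[of z] by linarith
qed

lemma jnet_intro:
  assumes "is_tree (xch T D N)" "\<And>z. deg (xch T D N) z + cnt D z = deg T z + cnt N z"
    and "\<And>z. cnt D z + of_bool (z = t) + of_bool (z = y) = cnt N z + of_bool (z = j) + of_bool (z = p)" "p \<noteq> j"
  shows "jnet T j t y"
  unfolding jnet_def
proof (intro exI[of _ "xch T D N"] exI[of _ p] conjI allI assms(1,4))
  show "deg (xch T D N) z + (of_bool (z = j) + of_bool (z = p)) = deg T z + (of_bool (z = t) + of_bool (z = y))" for z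
    using assms(2,3)[of z] by linarith
qed

lemma conn_new: "(a, b) \<in> set N \<Longrightarrow> conn (xch T D N) a b"
  by (intro conn_edge) (auto simp: xch_def eset_def)

text \<open>The edge \<open>s v\<close> closes a cycle through \<open>u v\<close>, which is deleted;
  \<open>v\<close> keeps its degree.\<close>

lemma net_rotate:
  assumes T: "is_tree T" and d: "dir T v u s" and a: "adj s v"
  shows "net T u s"
proof -
  let ?D = "[(u, v)]" and ?N = "[(s, v)]"
  have uv: "{u, v} \<in> T" using dirD(1)[OF d] by (simp add: insert_commute)
  have 1: "conn (xch T ?D ?N) u s"
    by (rule conn_xch_same_side[OF T]) (use dir_V[OF T d] dirD(2)[OF d] in auto)
  have c: "conn (xch T ?D ?N) u v"
    by (rule conn_trans[OF 1 conn_new]) simp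
  show ?thesis
    by (rule net_intro[OF exchange[OF T, of ?D ?N]]) (use uv a c in auto)
qed

lemma jnet_direct:
  assumes T: "is_tree T" and b: "btw T j t y" and a: "adj t y"
  shows "jnet T j t y"
proof -
  obtain p p' where p: "dir T j p t" "dir T j p' y" "p \<noteq> p'" using b by (auto simp: btw_def)
  let ?D = "[(j, p)]" and ?N = "[(t, y)]"
  note V = dir_V[OF T p(1)] dir_V[OF T p(2)]
  have "side T j p y" using dir_other_side[OF T p(2) dirD(1)[OF p(1)]] p(3) by blast
  hence 1: "conn (xch T ?D ?N) j y" by (intro conn_xch_same_side[OF T]) (use V in auto)
  have 2: "conn (xch T ?D ?N) p t" by (intro conn_xch_same_side[OF T]) (use V dirD(2)[OF p(1)] in auto)
  have "conn (xch T ?D ?N) t y" by (rule conn_new) simp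
  hence c: "conn (xch T ?D ?N) j p" by (rule conn_trans[OF 1 conn_sym[OF conn_trans[OF 2]]])
  show ?thesis
    by (rule jnet_intro[OF exchange[OF T, of ?D ?N], where p = p])
      (use dirD(1)[OF p(1)] a c dir_nbr_neq[OF T p(1)] in auto)
qed

text \<open>The edge \<open>x w\<close> cuts off the corner at \<open>t\<close>, which frees two
  units there; \<open>t y\<close> costs one of them and reattaches \<open>t\<close>, because
  \<open>y\<close> lies beyond \<open>x\<close>.\<close>

lemma net_corner:
  assumes T: "is_tree T" and e: "{t, x} \<in> T" "{t, w} \<in> T" "x \<noteq> w" and a: "adj x w" "adj t y"
    and d: "dir T t x y"
  shows "net T t y"
proof -
  let ?D = "[(t, x), (t, w)]" and ?N = "[(x, w), (t, y)]"
  note V = tree_edgeD[OF T e(1)] tree_edgeD[OF T e(2)] dir_V[OF T d]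
  have s: "side T x t y" "side T t w x" "side T t w y"
    using dirD(2)[OF d] dir_other_side[OF T dir_self[OF e(1)] e(2)] dir_other_side[OF T d e(2)] e(3) by auto
  have 1: "conn (xch T ?D ?N) x y" by (intro conn_xch_same_side[OF T]) (use V s in auto)
  have 2: "conn (xch T ?D ?N) x w" "conn (xch T ?D ?N) t y"
    using conn_new[of x w ?N T ?D] conn_new[of t y ?N T ?D] by auto
  have c: "conn (xch T ?D ?N) t x" using conn_trans[OF 2(2) conn_sym[OF 1]] .
  hence c': "conn (xch T ?D ?N) t w" using 2(1) by (rule conn_trans)
  show ?thesis
    by (rule net_intro[OF exchange[OF T, of ?D ?N]]) (use V e a c c' in \<open>auto simp: doubleton_eq_iff\<close>)
qed

text \<open>Replacing \<open>u v\<close> by \<open>t v\<close> and \<open>y u\<close> turns the tree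
  path from \<open>t\<close> to \<open>y\<close> into the cycle \<open>t ... u y ... v t\<close>.
  One more edge can therefore be spared, at any inner vertex \<open>j\<close> of the path. Here
  \<open>j\<close> lies on the side of \<open>u\<close>; the other side is the mirror image.\<close>

lemma jnet_cross_aux:
  assumes T: "is_tree T" and d: "dir T v u t" "dir T u v y" and a: "adj t v" "adj y u"
    and b: "btw T j t y" and j: "side T u v j"
  shows "jnet T j t y"
proof -
  obtain p p' where p: "dir T j p t" "dir T j p' y" "p \<noteq> p'" using b by (auto simp: btw_def)
  let ?D = "[(u, v), (j, p)]" and ?N = "[(t, v), (y, u)]"
  have uv: "{u, v} \<in> T" "{v, u} \<in> T" using dirD(1) d by auto
  note jp = dirD(1)[OF p(1)]
  note V = tree_edgeD[OF T uv(1)] tree_edgeD[OF T jp] dir_V[OF T d(1)] dir_V[OF T d(2)]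
  have jv: "j \<noteq> v" using j side_iff[OF T uv(1), of v] V by auto
  have dvj: "dir T v u j" using j uv by (simp add: dir_def)
  have nuj: "\<not> dir T u v j" using j side_iff[OF T uv(1), of j] V by (auto simp: dir_def)
  \<comment> \<open>The path from \<open>j\<close> to \<open>y\<close> leaves through
    \<open>u v\<close>, so \<open>p'\<close> leads to \<open>u\<close>, or equals \<open>v\<close>
    if \<open>j = u\<close>. Hence the edge \<open>j p\<close> is not \<open>u v\<close> and does
    not separate \<open>u\<close> from \<open>v\<close>.\<close>
  have p'uv: "(j = u \<and> p' = v) \<or> (j \<noteq> u \<and> dir T j p' u)"
  proof (cases "j = u")
    case True
    thus ?thesis using dir_unique[OF T d(2)] p(2) by blast
  next
    case False
    obtain a where a: "dir T j a u" using dir_ex[OF T _ _ False] V by blast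
    obtain c where c: "dir T u c j" using dir_ex[OF T _ _ False[symmetric]] V by blast
    have "btw T u j y" using c d(2) nuj unfolding btw_def by blast
    hence "dir T j a y" using btw_dir[OF T _ a] by blast
    thus ?thesis using a False dir_unique[OF T p(2)] by blast
  qed
  hence "dir T j p' v" using dir_step[OF T _ uv(1) jv[symmetric]] dir_self[OF uv(1)] by blast
  hence sv: "side T j p v" using dir_other_side[OF T _ jp] p(3) by blast
  have su: "side T j p u" using p'uv dir_other_side[OF T _ jp] p(3) by auto
  have sy: "side T j p y" using dir_other_side[OF T p(2) jp] p(3) by auto
  have ne: "{u, v} \<noteq> {j, p}" using jv p'uv p(3) by (auto simp: doubleton_eq_iff)
  have "p \<noteq> v" using p'uv ne uv \<open>dir T j p' v\<close> dir_unique[OF T \<open>dir T j p' v\<close> dir_self] jp p(3) by blast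
  hence sp: "side T u v p" using dir_step[OF T dvj jp] dirD(2) by blast
  note S = sv su sy sp j dirD(2)[OF p(1)] dirD(2)[OF d(1)] dirD(2)[OF d(2)]
  have "conn (xch T ?D ?N) t p" by (intro conn_xch_same_side[OF T]) (use V S in auto)
  moreover have "conn (xch T ?D ?N) v y" by (intro conn_xch_same_side[OF T]) (use V S in auto)
  moreover have uj: "conn (xch T ?D ?N) u j" by (intro conn_xch_same_side[OF T]) (use V S in auto)
  moreover have "conn (xch T ?D ?N) t v" "conn (xch T ?D ?N) y u"
    using conn_new[of t v ?N T ?D] conn_new[of y u ?N T ?D] by auto
  ultimately have c: "conn (xch T ?D ?N) v u" "conn (xch T ?D ?N) v p"
    using conn_trans[of "xch T ?D ?N" v y u] conn_trans[of "xch T ?D ?N" v t p] conn_sym[of "xch T ?D ?N" t v] by auto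
  have c1: "conn (xch T ?D ?N) u v" using c(1) by (rule conn_sym)
  have c2: "conn (xch T ?D ?N) j p" using conn_trans[OF conn_sym[OF uj] conn_trans[OF c1 c(2)]] .
  show ?thesis
    by (rule jnet_intro[OF exchange[OF T, of ?D ?N], where p = p])
      (use uv jp a c1 c2 ne V dir_nbr_neq[OF T p(1)] in auto)
qed

lemma jnet_cross:
  assumes T: "is_tree T" and d: "dir T v u t" "dir T u v y" and a: "adj t v" "adj y u"
    and b: "btw T j t y"
  shows "jnet T j t y"
proof (cases "side T u v j")
  case False
  have "{u, v} \<in> T" using dirD(1)[OF d(2)] .
  hence "side T v u j" using side_iff[OF T _ btw_V(1)[OF T b]] False by blast
  thus ?thesis using jnet_sym[OF jnet_cross_aux[OF T d(2,1) a(2,1) btw_sym[OF b]]] by blast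
qed (rule jnet_cross_aux[OF assms])

text \<open>The edge \<open>t v\<close> takes the place of \<open>u v\<close>, while
  \<open>y u\<close> closes a cycle with the tree path from \<open>y\<close> to \<open>u\<close>, on
  which an edge at the inner vertex \<open>j\<close> is dropped.\<close>

lemma jnet_same:
  assumes T: "is_tree T" and d: "dir T v u t" "dir T v u y" and a: "adj t v" "adj y u"
    and b: "btw T j y u"
  shows "jnet T j t y"
proof -
  obtain p p' where p: "dir T j p y" "dir T j p' u" "p \<noteq> p'" using b by (auto simp: btw_def)
  let ?D = "[(u, v), (j, p)]" and ?N = "[(t, v), (y, u)]"
  have uv: "{u, v} \<in> T" "{v, u} \<in> T" using dirD(1)[OF d(1)] by (auto simp: insert_commute)
  note jp = dirD(1)[OF p(1)]
  note V = tree_edgeD[OF T uv(1)] tree_edgeD[OF T jp] dir_V[OF T d(1)] dir_V[OF T d(2)]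
  have ju: "j \<noteq> u" using btw_neq[OF T b] by simp
  have jv: "j \<noteq> v"
  proof
    assume "j = v"
    hence "p = u" "p' = u" using dir_unique[OF T] p d(2) dir_self[OF uv(2)] by blast+
    thus False using p(3) by simp
  qed
  have dvj: "dir T v u j"
  proof (rule ccontr)
    assume n: "\<not> dir T v u j"
    obtain c where c: "dir T v c j" using dir_ex[OF T _ _ jv[symmetric]] V by blast
    obtain b where b: "dir T j b v" using dir_ex[OF T _ _ jv] V by blast
    have "btw T v j u" "btw T v j y" using c n d(2) dir_self[OF uv(2)] unfolding btw_def by blast+
    hence "dir T j b u" "dir T j b y" using btw_dir[OF T _ b] by blast+
    thus False using p dir_unique[OF T] by blast
  qed
  have pv: "p \<noteq> v"
  proof
    assume "p = v"
    hence "dir T v j j" using jp dir_self[of v j T] by (simp add: insert_commute)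
    hence "j = u" using dvj dir_unique[OF T] by blast
    thus False using ju by simp
  qed
  have sp: "side T u v p" using dir_step[OF T dvj jp pv] dirD(2) by blast
  have su: "side T j p u" using dir_other_side[OF T p(2) jp] p(3) by blast
  have ne: "{u, v} \<noteq> {j, p}" using ju jv by (auto simp: doubleton_eq_iff)
  note S = sp su dirD(2)[OF p(1)] dirD(2)[OF d(1)] dirD(2)[OF d(2)] dirD(2)[OF dvj]
  have 1: "conn (xch T ?D ?N) y p" by (intro conn_xch_same_side[OF T]) (use V S in auto)
  have 2: "conn (xch T ?D ?N) u j" by (intro conn_xch_same_side[OF T]) (use V S in auto)
  have 3: "conn (xch T ?D ?N) t v" "conn (xch T ?D ?N) y u"
    using conn_new[of t v ?N T ?D] conn_new[of y u ?N T ?D] by auto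
  have 4: "conn (xch T ?D ?N) j p"
    using conn_trans[OF conn_trans[OF conn_sym[OF 2] conn_sym[OF 3(2)]] 1] .
  have "conn (xch T ?D ?N) u t"
  proof (cases "side T j p t")
    case True
    have "conn (xch T ?D ?N) j t" by (intro conn_xch_same_side[OF T]) (use V S True in auto)
    thus ?thesis by (rule conn_trans[OF 2])
  next
    case False
    hence "side T p j t" using side_iff[OF T jp] V by blast
    hence "conn (xch T ?D ?N) p t" by (intro conn_xch_same_side[OF T]) (use V S in auto)
    thus ?thesis by (rule conn_trans[OF conn_trans[OF conn_sym[OF 3(2)] 1]])
  qed
  hence 5: "conn (xch T ?D ?N) u v" using 3(1) by (rule conn_trans)
  show ?thesis
    by (rule jnet_intro[OF exchange[OF T, of ?D ?N], where p = p])
      (use uv jp a 4 5 ne V dir_nbr_neq[OF T p(1)] in auto)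
qed

text \<open>The common configuration of the exchanges that follow: an arm \<open>t x ... u v\<close>
  of \<open>t\<close> with \<open>u\<close> different from \<open>t\<close>, and a second neighbour
  \<open>w\<close>. It collects the sides of the edges that these exchanges delete.\<close>

lemma arm:
  assumes T: "is_tree T" and e: "{t, x} \<in> T" "{t, w} \<in> T" "x \<noteq> w"
    and d: "dir T t x v" "dir T v u t" and ut: "u \<noteq> t"
  shows "t \<in> V" "x \<in> V" "w \<in> V" "v \<in> V" "u \<in> V" "t \<noteq> x" "t \<noteq> w" "v \<noteq> t" "u \<noteq> v" "x \<noteq> v" "w \<noteq> v"
    and "{u, v} \<in> T" "{v, u} \<in> T" "dir T t x u"
    and "side T x t u" "side T x t v" "side T t x w" "side T t w x" "side T t w u" "side T t w v"
    and "side T u v t" "side T u v x" "side T u v w" "dir T v u x" "dir T v u w" "u \<noteq> w"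
proof -
  show V: "t \<in> V" "x \<in> V" "w \<in> V" "v \<in> V" "u \<in> V"
    using dir_V[OF T d(1)] dir_V[OF T d(2)] tree_edgeD[OF T e(2)] by auto
  show ne: "t \<noteq> x" "t \<noteq> w" "v \<noteq> t" "u \<noteq> v"
    using tree_edgeD[OF T e(1)] tree_edgeD[OF T e(2)] dir_neq[OF T d(1)] dir_nbr_neq[OF T d(2)] by auto
  show vu: "{v, u} \<in> T" "{u, v} \<in> T" using dirD(1)[OF d(2)] by (auto simp: insert_commute)
  show du: "dir T t x u" using dir_step[OF T d(1) vu(1) ut] .
  show xv: "x \<noteq> v"
  proof
    assume "x = v"
    hence "dir T v t t" using e(1) by (simp add: dir_self insert_commute)
    thus False using dir_unique[OF T d(2)] ut by blast
  qed
  have ww: "dir T t w w" using dir_self[OF e(2)] .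
  show wv: "w \<noteq> v" using dir_unique[OF T d(1)] ww e(3) by blast
  show "u \<noteq> w" using dir_unique[OF T du] ww e(3) by blast
  show "dir T v u x" "dir T v u w"
    using dir_step[OF T d(2) e(1)] dir_step[OF T d(2) e(2)] xv wv by auto
  thus "side T u v t" "side T u v x" "side T u v w" using dirD(2) d(2) by blast+
  show "side T x t u" "side T x t v" using dirD(2) du d(1) by blast+
  show "side T t x w" using dir_other_side[OF T ww e(1)] e(3) by blast
  show "side T t w x" "side T t w u" "side T t w v"
    using dir_other_side[OF T _ e(2)] dir_self[OF e(1)] du d(1) e(3) by blast+
qed

lemma arm_next:
  assumes T: "is_tree T" and e: "{t, x} \<in> T" "{t, w} \<in> T" "x \<noteq> w"
    and d: "dir T t x v" "dir T v u t" and ut: "u \<noteq> t" and vd: "{v, d} \<in> T" "d \<noteq> u"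
  shows "d \<in> V" "d \<noteq> v" "d \<noteq> t" "d \<noteq> w" "dir T t x d" "side T x t d" "side T t w d" "side T v u d"
    and "side T v d t" "side T v d x" "side T v d w" "side T v d u"
proof -
  note a = arm[OF T e d ut]
  show "d \<in> V" "d \<noteq> v" using tree_edgeD[OF T vd(1)] by auto
  show dt: "d \<noteq> t" using dir_unique[OF T d(2)] dir_self[OF vd(1)] vd(2) by blast
  show dd: "dir T t x d" using dir_step[OF T d(1) vd(1) dt] .
  show "side T x t d" using dirD(2)[OF dd] .
  show "side T t w d" using dir_other_side[OF T dd e(2)] e(3) by blast
  show "d \<noteq> w" using dir_unique[OF T dd] dir_self[OF e(2)] e(3) by blast
  show "side T v u d" using dir_other_side[OF T dir_self[OF vd(1)] a(13)] vd(2) by blast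
  show "side T v d t" "side T v d x" "side T v d w" "side T v d u"
    using dir_other_side[OF T _ vd(1)] d(2) a(24,25) dir_self[OF a(13)] vd(2) by blast+
qed

text \<open>The edge \<open>x w\<close> bypasses \<open>t\<close>, and what remains at
  \<open>t\<close>, including \<open>y\<close>, is inserted into the arm: \<open>u y ... t v\<close>
  replaces \<open>u v\<close>. In the balance \<open>t\<close> gives up two edges for one.\<close>

lemma net_insert_far:
  assumes T: "is_tree T" and e: "{t, x} \<in> T" "{t, w} \<in> T" "x \<noteq> w"
    and d: "dir T t x v" "dir T v u t" and ut: "u \<noteq> t"
    and a: "adj x w" "adj t v" "adj y u"
    and y: "\<not> dir T t x y" "\<not> dir T t w y"
  shows "net T t y"
proof -
  let ?D = "[(u, v), (t, x), (t, w)]" and ?N = "[(t, v), (y, u), (x, w)]"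
  note A = arm[OF T e d ut]
  have yV: "y \<in> V" using adj_V[OF a(3)] .
  have sy: "side T t x y" "side T t w y" "side T u v y"
    using not_dir_side[OF T e(1) yV y(1)] not_dir_side[OF T e(2) yV y(2)]
      dirD(2)[OF dir_far[OF T d yV y(1)]] by auto
  have 1: "conn (xch T ?D ?N) t y" by (intro conn_xch_same_side[OF T]) (use A yV sy in auto)
  have 2: "conn (xch T ?D ?N) u x" by (intro conn_xch_same_side[OF T]) (use A in auto)
  have 3: "conn (xch T ?D ?N) t v" "conn (xch T ?D ?N) y u" "conn (xch T ?D ?N) x w"
    by (rule conn_new, simp)+
  have 4: "conn (xch T ?D ?N) t u" using conn_trans[OF 1 3(2)] .
  have 5: "conn (xch T ?D ?N) t x" using conn_trans[OF 4 2] .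
  have 6: "conn (xch T ?D ?N) t w" using conn_trans[OF 5 3(3)] .
  have 7: "conn (xch T ?D ?N) u v" using conn_trans[OF conn_sym[OF 4] 3(1)] .
  show ?thesis
    by (rule net_intro[OF exchange[OF T, of ?D ?N]])
      (use A e a 5 6 7 in \<open>auto simp: doubleton_eq_iff\<close>)
qed

text \<open>The same edges as in \<open>net_insert_far\<close>, but with \<open>y\<close> beyond
  \<open>v\<close> the new tree is held together by \<open>t v ... y u ... x w\<close>.\<close>

lemma net_cross_arm:
  assumes T: "is_tree T" and e: "{t, x} \<in> T" "{t, w} \<in> T" "x \<noteq> w"
    and d: "dir T t x v" "dir T v u t" and ut: "u \<noteq> t"
    and a: "adj x w" "adj t v" "adj y u"
    and y: "dir T u v y"
  shows "net T t y"
proof -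
  let ?D = "[(u, v), (t, x), (t, w)]" and ?N = "[(t, v), (y, u), (x, w)]"
  note A = arm[OF T e d ut]
  have yV: "y \<in> V" using adj_V[OF a(3)] .
  obtain c where c: "dir T u c t" using dir_ex[OF T A(5,1) ut] by blast
  have cv: "c \<noteq> v"
  proof
    assume "c = v"
    thus False using side_iff[OF T A(12), of t] A(1) A(21) dirD(2)[OF c] by auto
  qed
  have dy: "dir T t x y" using dir_beyond[OF T A(14) c y] cv by blast
  have sy: "side T x t y" "side T t w y" "side T v u y"
    using dirD(2)[OF dy] dir_other_side[OF T dy e(2)] e(3) dirD(2)[OF y] by auto
  have 1: "conn (xch T ?D ?N) v y" by (intro conn_xch_same_side[OF T]) (use A yV sy in auto)
  have 2: "conn (xch T ?D ?N) u x" by (intro conn_xch_same_side[OF T]) (use A in auto)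
  have 3: "conn (xch T ?D ?N) t v" "conn (xch T ?D ?N) y u" "conn (xch T ?D ?N) x w"
    by (rule conn_new, simp)+
  have 4: "conn (xch T ?D ?N) v u" using conn_trans[OF 1 3(2)] .
  have 5: "conn (xch T ?D ?N) t x" using conn_trans[OF 3(1) conn_trans[OF 4 2]] .
  have 6: "conn (xch T ?D ?N) t w" using conn_trans[OF 5 3(3)] .
  show ?thesis
    by (rule net_intro[OF exchange[OF T, of ?D ?N]])
      (use A e a 5 6 conn_sym[OF 4] in \<open>auto simp: doubleton_eq_iff\<close>)
qed

text \<open>The mirror image of \<open>net_insert_far\<close>, with \<open>u t ... y v\<close> in
  place of \<open>u v\<close>. Here \<open>y\<close> may also lie in direction \<open>w\<close>,
  which stays linked to \<open>t\<close> along \<open>t u ... x w\<close>.\<close>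

lemma net_insert_near:
  assumes T: "is_tree T" and e: "{t, x} \<in> T" "{t, w} \<in> T" "x \<noteq> w"
    and d: "dir T t x v" "dir T v u t" and ut: "u \<noteq> t"
    and a: "adj x w" "adj t u" "adj y v"
    and y: "\<not> dir T t x y"
  shows "net T t y"
proof -
  let ?D = "[(u, v), (t, x), (t, w)]" and ?N = "[(y, v), (x, w), (t, u)]"
  note A = arm[OF T e d ut]
  have yV: "y \<in> V" using adj_V[OF a(3)] .
  have sy: "side T t x y" "side T u v y"
    using not_dir_side[OF T e(1) yV y(1)] dirD(2)[OF dir_far[OF T d yV y(1)]] by auto
  have 2: "conn (xch T ?D ?N) u x" by (intro conn_xch_same_side[OF T]) (use A in auto)
  have 3: "conn (xch T ?D ?N) y v" "conn (xch T ?D ?N) x w" "conn (xch T ?D ?N) t u"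
    by (rule conn_new, simp)+
  have 5: "conn (xch T ?D ?N) t x" using conn_trans[OF 3(3) 2] .
  have 6: "conn (xch T ?D ?N) t w" using conn_trans[OF 5 3(2)] .
  have 1: "conn (xch T ?D ?N) t y"
  proof (cases "side T t w y")
    case True
    show ?thesis by (intro conn_xch_same_side[OF T]) (use A yV sy True in auto)
  next
    case False
    hence "side T w t y" using side_iff[OF T e(2) yV] by blast
    hence "conn (xch T ?D ?N) w y" by (intro conn_xch_same_side[OF T]) (use A yV sy in auto)
    thus ?thesis by (rule conn_trans[OF 6])
  qed
  have 7: "conn (xch T ?D ?N) u v" using conn_trans[OF conn_sym[OF 3(3)] conn_trans[OF 1 3(1)]] .
  show ?thesis
    by (rule net_intro[OF exchange[OF T, of ?D ?N]])
      (use A e a 5 6 7 in \<open>auto simp: doubleton_eq_iff\<close>)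
qed

text \<open>The new connection is \<open>t v ... x w ... y d\<close>: the arm from \<open>x\<close>
  to \<open>v\<close> is run through backwards, and \<open>y\<close> takes \<open>d\<close> over
  from \<open>v\<close>.\<close>

lemma net_next:
  assumes T: "is_tree T" and e: "{t, x} \<in> T" "{t, w} \<in> T" "x \<noteq> w"
    and d: "dir T t x v" "dir T v u t" and ut: "u \<noteq> t" and vd: "{v, d} \<in> T" "d \<noteq> u"
    and a: "adj x w" "adj t v" "adj y d"
    and y: "dir T t w y"
  shows "net T t y"
proof -
  let ?D = "[(t, x), (t, w), (v, d)]" and ?N = "[(t, v), (x, w), (y, d)]"
  note A = arm[OF T e d ut] arm_next[OF T e d ut vd]
  have yV: "y \<in> V" using adj_V[OF a(3)] .
  have nx: "\<not> dir T t x y" using dir_unique[OF T y] e(3) by blast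
  have dvy: "dir T v u y" using dir_far[OF T d yV nx] .
  have sy: "side T t x y" "side T w t y" "side T v d y"
    using not_dir_side[OF T e(1) yV nx] dirD(2)[OF y] dir_other_side[OF T dvy vd(1)] vd(2) by auto
  have 1: "conn (xch T ?D ?N) v x" by (intro conn_xch_same_side[OF T]) (use A in auto)
  have 2: "conn (xch T ?D ?N) w y" by (intro conn_xch_same_side[OF T]) (use A yV sy in auto)
  have 3: "conn (xch T ?D ?N) t v" "conn (xch T ?D ?N) x w" "conn (xch T ?D ?N) y d"
    by (rule conn_new, simp)+
  have 5: "conn (xch T ?D ?N) t x" using conn_trans[OF 3(1) 1] .
  have 6: "conn (xch T ?D ?N) t w" using conn_trans[OF 5 3(2)] .
  have 7: "conn (xch T ?D ?N) t d" using conn_trans[OF 6 conn_trans[OF 2 3(3)]] .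
  have 8: "conn (xch T ?D ?N) v d" using conn_trans[OF conn_sym[OF 3(1)] 7] .
  show ?thesis
    by (rule net_intro[OF exchange[OF T, of ?D ?N]])
      (use A e vd a 5 6 8 in \<open>auto simp: doubleton_eq_iff\<close>)
qed

text \<open>The new connection is \<open>t w ... y v ... x d\<close>; only the edge
  \<open>t x\<close> is lost at \<open>t\<close>.\<close>

lemma net_next_top:
  assumes T: "is_tree T" and e: "{t, x} \<in> T" "{t, w} \<in> T" "x \<noteq> w"
    and d: "dir T t x v" "dir T v u t" and ut: "u \<noteq> t" and vd: "{v, d} \<in> T" "d \<noteq> u"
    and a: "adj y v" "adj x d"
    and y: "dir T t w y"
  shows "net T t y"
proof -
  let ?D = "[(t, x), (v, d)]" and ?N = "[(y, v), (x, d)]"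
  note A = arm[OF T e d ut] arm_next[OF T e d ut vd]
  have yV: "y \<in> V" using adj_V[OF a(1)] .
  have nx: "\<not> dir T t x y" using dir_unique[OF T y] e(3) by blast
  have dvy: "dir T v u y" using dir_far[OF T d yV nx] .
  have sy: "side T t x y" "side T v d y"
    using not_dir_side[OF T e(1) yV nx] dir_other_side[OF T dvy vd(1)] vd(2) by auto
  have 1: "conn (xch T ?D ?N) v x" by (intro conn_xch_same_side[OF T]) (use A in auto)
  have 2: "conn (xch T ?D ?N) t y" by (intro conn_xch_same_side[OF T]) (use A yV sy in auto)
  have 3: "conn (xch T ?D ?N) y v" "conn (xch T ?D ?N) x d"
    by (rule conn_new, simp)+
  have 5: "conn (xch T ?D ?N) t x" using conn_trans[OF 2 conn_trans[OF 3(1) 1]] .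
  have 8: "conn (xch T ?D ?N) v d" using conn_trans[OF 1 3(2)] .
  show ?thesis
    by (rule net_intro[OF exchange[OF T, of ?D ?N]])
      (use A e vd a 5 8 in \<open>auto simp: doubleton_eq_iff\<close>)
qed

text \<open>The two arms are joined to \<open>t p ... u y ... x v\<close>, so that \<open>t\<close>
  no longer needs its edge to \<open>x\<close>.\<close>

lemma net_two_arms:
  assumes T: "is_tree T" and e: "{t, p} \<in> T" "{t, x} \<in> T" "p \<noteq> x"
    and d: "dir T t p v" "dir T v u t" and ut: "u \<noteq> t"
    and a: "adj y u" "adj x v" and y: "dir T t x y"
  shows "net T t y"
proof -
  let ?D = "[(u, v), (t, x)]" and ?N = "[(y, u), (x, v)]"
  note A = arm[OF T e d ut]
  have yV: "y \<in> V" using adj_V[OF a(1)] .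
  have np: "\<not> dir T t p y" using dir_unique[OF T y] e(3) by blast
  have sy: "side T x t y" "side T u v y"
    using dirD(2)[OF y] dirD(2)[OF dir_far[OF T d yV np]] by auto
  have 1: "conn (xch T ?D ?N) t u" by (intro conn_xch_same_side[OF T]) (use A in auto)
  have 2: "conn (xch T ?D ?N) x y" by (intro conn_xch_same_side[OF T]) (use A yV sy in auto)
  have 3: "conn (xch T ?D ?N) y u" "conn (xch T ?D ?N) x v"
    by (rule conn_new, simp)+
  have 4: "conn (xch T ?D ?N) x u" using conn_trans[OF 2 3(1)] .
  have 5: "conn (xch T ?D ?N) t x" using conn_trans[OF 1 conn_sym[OF 4]] .
  have 6: "conn (xch T ?D ?N) u v" using conn_trans[OF conn_sym[OF 4] 3(2)] .
  show ?thesis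
    by (rule net_intro[OF exchange[OF T, of ?D ?N]])
      (use A e a 5 6 in \<open>auto simp: doubleton_eq_iff\<close>)
qed

text \<open>Here \<open>t\<close> gives up two units, one to \<open>y\<close> and one to
  \<open>v\<close>. A vertex \<open>t\<close> of degree three or four stops branching, and
  \<open>v\<close> may start to: the exchange relocates a branch vertex.\<close>

lemma reroute_arms:
  assumes T: "is_tree T" and e: "{t, x} \<in> T" "{t, w} \<in> T" "x \<noteq> w"
    and a: "adj x w" "adj y v" and y: "dir T t x y" and v: "\<not> dir T t x v" "\<not> dir T t w v"
  defines "T' \<equiv> xch T [(t, x), (t, w)] [(x, w), (y, v)]"
  shows "is_tree T'" "deg T' z + 2 * of_bool (z = t) = deg T z + of_bool (z = y) + of_bool (z = v)"
proof -
  let ?D = "[(t, x), (t, w)]" and ?N = "[(x, w), (y, v)]"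
  note V = tree_edgeD[OF T e(1)] tree_edgeD[OF T e(2)] dir_V[OF T y] adj_V2[OF a(2)]
  have s: "side T x t y" "side T t w x" "side T t w y" "side T t x v" "side T t w v"
    using dirD(2)[OF y] dir_other_side[OF T dir_self[OF e(1)] e(2)] dir_other_side[OF T y e(2)] e(3)
      not_dir_side[OF T e(1) V(10) v(1)] not_dir_side[OF T e(2) V(10) v(2)] by auto
  have 1: "conn (xch T ?D ?N) x y" by (intro conn_xch_same_side[OF T]) (use V s in auto)
  have 2: "conn (xch T ?D ?N) t v" by (intro conn_xch_same_side[OF T]) (use V s in auto)
  have 3: "conn (xch T ?D ?N) x w" "conn (xch T ?D ?N) y v" by (rule conn_new, simp)+
  have c: "conn (xch T ?D ?N) t x" using conn_trans[OF 2 conn_sym[OF conn_trans[OF 1 3(2)]]] .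
  have c': "conn (xch T ?D ?N) t w" using c 3(1) by (rule conn_trans)
  have *: "is_tree (xch T ?D ?N)" "deg (xch T ?D ?N) z + cnt ?D z = deg T z + cnt ?N z"
    by (rule exchange[OF T, of ?D ?N]; use V e a c c' in \<open>auto simp: doubleton_eq_iff\<close>)+
  show "is_tree T'" using *(1) by (simp add: T'_def)
  show "deg T' z + 2 * of_bool (z = t) = deg T z + of_bool (z = y) + of_bool (z = v)"
    using *(2) by (simp add: T'_def)
qed

text \<open>A rearrangement that touches the degrees of \<open>w\<close> and \<open>y\<close> only:
  \<open>t\<close> receives the arm through \<open>d\<close> instead of the one through
  \<open>w\<close>, and the latter is hung on \<open>v\<close> by its vertex
  \<open>y\<close>.\<close>

lemma swap_arms:
  assumes T: "is_tree T" and e: "{t, x} \<in> T" "{t, w} \<in> T" "x \<noteq> w"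
    and d: "dir T t x v" "dir T v u t" and ut: "u \<noteq> t" and vd: "{v, d} \<in> T" "d \<noteq> u"
    and a: "adj t d" "adj y v"
    and y: "dir T t w y"
  defines "T' \<equiv> xch T [(v, d), (t, w)] [(t, d), (v, y)]"
  shows "is_tree T'" "deg T' z + of_bool (z = w) = deg T z + of_bool (z = y)"
proof -
  let ?D = "[(v, d), (t, w)]" and ?N = "[(t, d), (v, y)]"
  note A = arm[OF T e d ut] arm_next[OF T e d ut vd]
  have yV: "y \<in> V" using adj_V[OF a(2)] .
  have nx: "\<not> dir T t x y" using dir_unique[OF T y] e(3) by blast
  have dvy: "dir T v u y" using dir_far[OF T d yV nx] .
  have sy: "side T w t y" "side T v d y"
    using dirD(2)[OF y] dir_other_side[OF T dvy vd(1)] vd(2) by auto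
  have 1: "conn (xch T ?D ?N) t v" by (intro conn_xch_same_side[OF T]) (use A in auto)
  have 2: "conn (xch T ?D ?N) y w" by (intro conn_xch_same_side[OF T]) (use A yV sy in auto)
  have 3: "conn (xch T ?D ?N) t d" "conn (xch T ?D ?N) v y" by (rule conn_new, simp)+
  have c: "conn (xch T ?D ?N) v d" using conn_trans[OF conn_sym[OF 1] 3(1)] .
  have c': "conn (xch T ?D ?N) t w" using conn_trans[OF 1 conn_trans[OF 3(2) 2]] .
  have *: "is_tree (xch T ?D ?N)" "deg (xch T ?D ?N) z + cnt ?D z = deg T z + cnt ?N z"
    by (rule exchange[OF T, of ?D ?N]; use A e vd a adj_sym[OF a(2)] c c' in \<open>auto simp: doubleton_eq_iff\<close>)+
  show "is_tree T'" using *(1) by (simp add: T'_def)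
  show "deg T' z + of_bool (z = w) = deg T z + of_bool (z = y)"
    using *(2) by (simp add: T'_def)
qed

lemma move_arms:
  assumes T: "is_tree T" and k: "k \<in> V" "k \<noteq> t"
    and L: "distinct L" "\<And>a. a \<in> set L \<Longrightarrow> {t, a} \<in> T \<and> adj k a \<and> \<not> dir T t a k"
  defines "T' \<equiv> xch T (map (\<lambda>a. (t, a)) L) (map (\<lambda>a. (k, a)) L)"
  shows "is_tree T'" "deg T' z + length L * of_bool (z = t) = deg T z + length L * of_bool (z = k)"
proof -
  let ?D = "map (\<lambda>a. (t, a)) L" and ?N = "map (\<lambda>a. (k, a)) L"
  have cn: "cnt (map (\<lambda>a. (b, a)) L) z = length L * of_bool (z = b) + (\<Sum>a\<leftarrow>L. of_bool (z = a))" for b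
    by (induct L) simp_all
  have "inj (\<lambda>a. {t, a})" by (auto simp: inj_def doubleton_eq_iff)
  hence dist: "distinct (map (\<lambda>(a, b). {a, b}) ?D)"
    using L(1) by (simp add: distinct_map inj_on_def inj_def)
  have c: "conn (xch T ?D ?N) t a" if a: "a \<in> set L" for a
  proof -
    have tV: "t \<in> V" using tree_V[OF T] L(2)[OF a] by blast
    have "conn (xch T ?D ?N) t k"
      by (intro conn_xch_same_side[OF T]) (use tV k L(2) not_dir_side[OF T _ k(1)] in auto)
    moreover have "conn (xch T ?D ?N) k a" by (rule conn_new) (use a in auto)
    ultimately show ?thesis by (rule conn_trans)
  qed
  have *: "is_tree (xch T ?D ?N)" "deg (xch T ?D ?N) z + cnt ?D z = deg T z + cnt ?N z"
    by (rule exchange[OF T, of ?D ?N]; use dist L(2) c in auto)+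
  show "is_tree T'" using *(1) by (simp add: T'_def)
  show "deg T' z + length L * of_bool (z = t) = deg T z + length L * of_bool (z = k)"
    using *(2) cn[of t] cn[of k] by (simp add: T'_def)
qed

end

section \<open>Optimal spanning trees of a claw-free graph\<close>

locale claw_free_ugraph = ugraph +
  assumes claw: "adj c x \<Longrightarrow> adj c y \<Longrightarrow> adj c z \<Longrightarrow> x \<noteq> y \<Longrightarrow> x \<noteq> z \<Longrightarrow> y \<noteq> z \<Longrightarrow>
    adj x y \<or> adj x z \<or> adj y z"
begin

definition br :: "'a set set \<Rightarrow> 'a set" where
  "br T = {z \<in> V. 3 \<le> deg T z}"

definition lf :: "'a set set \<Rightarrow> 'a set" where
  "lf T = {z \<in> V. deg T z \<le> 1}"

definition opt :: "'a set set \<Rightarrow> bool" where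
  "opt T \<longleftrightarrow> is_tree T \<and> (\<forall>T'. is_tree T' \<longrightarrow> card (br T) \<le> card (br T') \<and>
     (card (br T') = card (br T) \<longrightarrow> card (lf T) \<le> card (lf T')))"

lemma finite_br [simp]: "finite (br T)" and finite_lf [simp]: "finite (lf T)"
  using finV by (auto simp: br_def lf_def)

lemma opt_tree: "opt T \<Longrightarrow> is_tree T"
  by (simp add: opt_def)

lemma opt_br:
  assumes "opt T" "is_tree T'" "br T' \<subseteq> br T" "z \<in> br T" "z \<notin> br T'"
  shows False
proof -
  have "br T' \<subset> br T" using assms by blast
  hence "card (br T') < card (br T)" by (rule psubset_card_mono[OF finite_br])
  thus False using assms(1,2) unfolding opt_def by (meson leD)
qed

lemma opt_lf:
  assumes "opt T" "is_tree T'" "card (br T') \<le> card (br T)" "card (lf T') < card (lf T)"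
  shows False
  using assms unfolding opt_def by (metis leD le_antisym)

lemma opt_eq:
  assumes "opt T" "is_tree T'" "card (br T') \<le> card (br T)" "card (lf T') \<le> card (lf T)"
  shows "opt T'"
proof -
  have 1: "card (br T) \<le> card (br T'')" "card (br T'') = card (br T) \<Longrightarrow> card (lf T) \<le> card (lf T'')"
    if "is_tree T''" for T''
    using assms(1) that unfolding opt_def by blast+
  have "card (br T') = card (br T)" using 1(1)[OF assms(2)] assms(3) by simp
  moreover have "card (lf T') = card (lf T)" using 1(2)[OF assms(2)] calculation assms(4) by simp
  ultimately show ?thesis unfolding opt_def using 1 assms(2) by simp
qed

section \<open>What optimality forbids, and the leaves of an optimal tree\<close>

lemma deg_pos:
  assumes T: "is_tree T" and "a \<in> V" "b \<in> V" "a \<noteq> b"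
  shows "1 \<le> deg T a"
proof -
  obtain p where "dir T a p b" using dir_ex[OF assms] by blast
  hence "card {p} \<le> deg T a" using dirD(1) by (intro deg_ge[OF T]) auto
  thus ?thesis by simp
qed

text \<open>\<open>y\<close> reaches degree two, so a leaf disappears and no branch vertex arises;
  \<open>t\<close> keeps degree at least two and is no new leaf.\<close>

lemma net_leaf:
  assumes o: "opt T" and n: "net T t y" and t: "t \<in> br T" and y: "y \<in> lf T"
  shows False
proof -
  note T = opt_tree[OF o]
  obtain T' where T': "is_tree T'" "\<And>z. deg T' z + of_bool (z = t) = deg T z + of_bool (z = y)"
    using n unfolding net_def by blast
  have ty: "t \<noteq> y" "t \<in> V" "y \<in> V" "3 \<le> deg T t" "deg T y \<le> 1" using t y by (auto simp: br_def lf_def)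
  have y1: "1 \<le> deg T y" using deg_pos[OF T ty(3,2)] ty(1) by blast
  have "br T' \<subseteq> br T"
  proof
    fix z assume z: "z \<in> br T'"
    thus "z \<in> br T" using T'(2)[of z] ty by (cases "z = y") (auto simp: br_def)
  qed
  hence 1: "card (br T') \<le> card (br T)" by (rule card_mono[OF finite_br])
  have "lf T' \<subseteq> lf T - {y}"
  proof
    fix z assume z: "z \<in> lf T'"
    thus "z \<in> lf T - {y}" using T'(2)[of z] ty y1 by (cases "z = y"; cases "z = t") (auto simp: lf_def)
  qed
  hence "card (lf T') \<le> card (lf T - {y})" by (intro card_mono) auto
  also have "\<dots> < card (lf T)" using y by (intro card_Diff1_less) auto
  finally show False using opt_lf[OF o T'(1) 1] by blast
qed

lemma net_br:
  assumes o: "opt T" and n: "net T t y" and t: "deg T t = 3" and y: "y \<in> br T" "t \<noteq> y" "t \<in> V"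
  shows False
proof -
  obtain T' where T': "is_tree T'" "\<And>z. deg T' z + of_bool (z = t) = deg T z + of_bool (z = y)"
    using n unfolding net_def by blast
  have "br T' \<subseteq> br T"
  proof
    fix z assume z: "z \<in> br T'"
    thus "z \<in> br T" using T'(2)[of z] y by (cases "z = y") (auto simp: br_def)
  qed
  moreover have "t \<in> br T" "t \<notin> br T'" using T'(2)[of t] t y by (auto simp: br_def)
  ultimately show False using opt_br[OF o T'(1)] by blast
qed

text \<open>\<open>j\<close> stops branching, while the gaining vertices branch already or are
  leaves that reach degree two. The second losing vertex \<open>p\<close> may become a leaf, which
  is harmless because the number of branch vertices drops.\<close>

lemma jnet_opt:
  assumes o: "opt T" and n: "jnet T j t y" and j: "deg T j = 3" "j \<noteq> t" "j \<noteq> y" "j \<in> V"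
    and t: "t \<in> br T" and y: "y \<in> lf T \<union> br T" "t \<noteq> y"
  shows False
proof -
  obtain T' p where T': "is_tree T'" "p \<noteq> j"
    "\<And>z. deg T' z + (of_bool (z = j) + of_bool (z = p)) = deg T z + (of_bool (z = t) + of_bool (z = y))"
    using n unfolding jnet_def by blast
  have "br T' \<subseteq> br T"
  proof
    fix z assume z: "z \<in> br T'"
    thus "z \<in> br T" using T'(3)[of z] y t by (cases "z = y"; cases "z = t") (auto simp: br_def lf_def)
  qed
  moreover have "j \<in> br T" "j \<notin> br T'" using T'(3)[of j] j by (auto simp: br_def)
  ultimately show False using opt_br[OF o T'(1)] by blast
qed

lemma toward_deg:
  assumes T: "is_tree T" and d: "dir T v u y" and "u \<noteq> y"
  shows "2 \<le> deg T u"
proof -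
  have uV: "u \<in> V" "y \<in> V" "{v, u} \<in> T" using dir_V[OF T d] dirD(1)[OF d] by auto
  obtain c where c: "dir T u c y" using dir_ex[OF T uV(1,2) assms(3)] by blast
  have "c \<noteq> v"
  proof
    assume "c = v"
    thus False using c side_excl[OF T uV(3), of y] dirD(2)[OF d] dirD(2)[OF c]
      by (auto simp: side_def insert_commute)
  qed
  moreover have "card {c, v} \<le> deg T u"
    by (rule deg_ge[OF T]) (use dirD(1)[OF c] uV(3) in \<open>auto simp: insert_commute\<close>)
  ultimately show ?thesis by simp
qed

lemma leaf_nbr_deg:
  assumes o: "opt T" and y: "y \<in> lf T" "adj y v" and d: "dir T v u y"
  shows "deg T u \<le> 2"
proof (rule ccontr)
  assume "\<not> ?thesis"
  hence "u \<in> br T" using dir_V[OF opt_tree[OF o] d] by (auto simp: br_def)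
  thus False using net_leaf[OF o net_rotate[OF opt_tree[OF o] d y(2)]] y by blast
qed

text \<open>\<open>u\<close> has degree exactly two, so the rotation makes it a leaf in place of
  \<open>y\<close>, and whatever holds for leaves of optimal trees applies to
  \<open>u\<close>.\<close>

lemma leaf_rotate:
  assumes o: "opt T" and y: "y \<in> lf T" "adj y v" and d: "dir T v u y" and uy: "u \<noteq> y"
  obtains T' where "opt T'" "br T' = br T" "lf T' = insert u (lf T - {y})"
proof -
  note T = opt_tree[OF o]
  obtain T' where T': "is_tree T'" "\<And>z. deg T' z + of_bool (z = u) = deg T z + of_bool (z = y)"
    using net_rotate[OF T d y(2)] unfolding net_def by blast
  have u2: "deg T u = 2" using leaf_nbr_deg[OF o y d] toward_deg[OF T d uy] by simp
  note V = dir_V[OF T d]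
  have y1: "deg T y = 1" using deg_pos[OF T V(3,2)] uy y by (simp add: lf_def)
  have b: "br T' = br T"
  proof -
    have "z \<in> br T' \<longleftrightarrow> z \<in> br T" for z
      using T'(2)[of z] u2 y1 uy by (cases "z = y"; cases "z = u") (auto simp: br_def)
    thus ?thesis by blast
  qed
  have l: "lf T' = insert u (lf T - {y})"
  proof -
    have "z \<in> lf T' \<longleftrightarrow> z \<in> insert u (lf T - {y})" for z
      using T'(2)[of z] u2 y1 uy V by (cases "z = y"; cases "z = u") (auto simp: lf_def)
    thus ?thesis by blast
  qed
  have "card (lf T') \<le> card (lf T)"
    using l y(1) card_Suc_Diff1[OF finite_lf y(1)] by (simp add: card_insert_if)
  thus ?thesis using that opt_eq[OF o T'(1)] b l by simp
qed

lemma branch_between_leaves: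
  assumes T: "is_tree T" and c: "c \<in> br T" and y: "y \<in> lf T" "y' \<in> lf T" "y \<noteq> y'"
  obtains j where "j \<in> br T" "btw T j y y'"
proof -
  have V: "c \<in> V" "y \<in> V" "y' \<in> V" and dg: "3 \<le> deg T c" "deg T y \<le> 1" "deg T y' \<le> 1"
    using c y by (auto simp: br_def lf_def)
  hence ne: "y \<noteq> c" "y' \<noteq> c" by auto
  have "btw T c y y' \<or> (\<exists>g. btw T g y y' \<and> btw T g y c \<and> btw T g y' c)"
    using median[OF T V(2,3,1) y(3) ne] leaf_not_btw[OF T] dg by blast
  thus ?thesis
  proof
    assume "btw T c y y'" thus ?thesis using that c by blast
  next
    assume "\<exists>g. btw T g y y' \<and> btw T g y c \<and> btw T g y' c"
    then obtain g where g: "btw T g y y'" "btw T g y c" "btw T g y' c" by blast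
    hence "g \<in> br T" using btw3_deg[OF T g] btw_V[OF T g(1)] by (auto simp: br_def)
    thus ?thesis using that g by blast
  qed
qed

text \<open>The edge \<open>y y'\<close> closes a cycle through a branch vertex \<open>j\<close>.
  Dropping an edge at \<open>j\<close> then leaves fewer leaves: \<open>y\<close> and
  \<open>y'\<close> are lost, and at most its other end \<open>p\<close> is gained.\<close>

lemma leaves_nonadj:
  assumes o: "opt T" and c: "c \<in> br T" and y: "y \<in> lf T" "y' \<in> lf T" "y \<noteq> y'"
  shows "\<not> adj y y'"
proof
  assume a: "adj y y'"
  note T = opt_tree[OF o]
  obtain j where j: "j \<in> br T" "btw T j y y'" using branch_between_leaves[OF T c y] by blast
  obtain T' p where T': "is_tree T'" "p \<noteq> j"
    "\<And>z. deg T' z + (of_bool (z = j) + of_bool (z = p)) = deg T z + (of_bool (z = y) + of_bool (z = y'))"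
    using jnet_direct[OF T j(2) a] unfolding jnet_def by blast
  have jd: "3 \<le> deg T j" "j \<noteq> y" "j \<noteq> y'" "j \<in> V" using j y by (auto simp: br_def lf_def)
  have yd: "deg T y \<le> 1" "deg T y' \<le> 1" "y \<in> V" "y' \<in> V" using y by (auto simp: lf_def)
  have y1: "1 \<le> deg T y" "1 \<le> deg T y'"
    using deg_pos[OF T yd(3,4) y(3)] deg_pos[OF T yd(4,3)] y(3) by auto
  have "br T' \<subseteq> br T"
  proof
    fix z assume z: "z \<in> br T'"
    thus "z \<in> br T" using T'(3)[of z] yd y(3) by (cases "z = y"; cases "z = y'") (auto simp: br_def)
  qed
  hence 1: "card (br T') \<le> card (br T)" by (rule card_mono[OF finite_br])
  have sub: "lf T' \<subseteq> insert p (lf T - {y, y'})"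
  proof
    fix z assume z: "z \<in> lf T'"
    thus "z \<in> insert p (lf T - {y, y'})"
      using T'(3)[of z] yd y1 jd y(3) by (cases "z = p"; cases "z = y"; cases "z = y'"; cases "z = j") (auto simp: lf_def)
  qed
  have "card (lf T') \<le> card (insert p (lf T - {y, y'}))" using sub by (intro card_mono) auto
  also have "\<dots> \<le> Suc (card (lf T - {y, y'}))" by (simp add: card_insert_le_m1 card_insert_if)
  also have "card (lf T - {y, y'}) = card (lf T) - 2" using y by (simp add: card_Diff_subset)
  also have "Suc (card (lf T) - 2) < card (lf T)"
  proof -
    have "card {y, y'} \<le> card (lf T)" using y by (intro card_mono) auto
    thus ?thesis using y(3) by simp
  qed
  finally show False using opt_lf[OF o T'(1) 1] by blast
qed

lemma leaf_toward_neq: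
  assumes T: "is_tree T" and y: "y \<in> lf T" and d: "dir T v y z"
  shows "z = y"
proof (rule ccontr)
  assume "z \<noteq> y"
  thus False using toward_deg[OF T d] y by (auto simp: lf_def)
qed

text \<open>Rotating \<open>y\<close> makes \<open>u\<close> a leaf beside \<open>y'\<close>, and
  rotating \<open>y'\<close> makes it a leaf beside \<open>y\<close>. So \<open>u\<close> is
  adjacent to neither, and \<open>v\<close> would be the centre of a claw.\<close>

lemma leaves_same:
  assumes o: "opt T" and c: "c \<in> br T" and y: "y \<in> lf T" "y' \<in> lf T" "y \<noteq> y'"
    and a: "adj y v" "adj y' v" and d: "dir T v u y" "dir T v u y'"
  shows False
proof -
  note T = opt_tree[OF o]
  have u: "u \<noteq> y" "u \<noteq> y'" using leaf_toward_neq[OF T] y d by blast+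
  obtain T1 where T1: "opt T1" "br T1 = br T" "lf T1 = insert u (lf T - {y})"
    using leaf_rotate[OF o y(1) a(1) d(1) u(1)] by blast
  obtain T2 where T2: "opt T2" "br T2 = br T" "lf T2 = insert u (lf T - {y'})"
    using leaf_rotate[OF o y(2) a(2) d(2) u(2)] by blast
  have "\<not> adj u y'" using leaves_nonadj[OF T1(1), of c u y'] T1 c y u by auto
  moreover have "\<not> adj u y" using leaves_nonadj[OF T2(1), of c u y] T2 c y u by auto
  moreover have "\<not> adj y y'" using leaves_nonadj[OF o c y] .
  moreover have "adj v u" using tree_adj[OF T dirD(1)[OF d(1)]] .
  ultimately show False using claw[of v u y y'] a u y(3) adj_sym by blast
qed

text \<open>Rotating \<open>y\<close> turns \<open>u\<close> into a leaf that is adjacent to the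
  leaf \<open>y'\<close>.\<close>

lemma leaves_opp:
  assumes o: "opt T" and c: "c \<in> br T" and y: "y \<in> lf T" "y' \<in> lf T" "y \<noteq> y'"
    and a: "adj y v" "adj y' u" and d: "dir T v u y" "dir T u v y'"
  shows False
proof (cases "u = y")
  case True
  thus False using leaves_nonadj[OF o c y(2,1)] a(2) y(3) by blast
next
  case False
  note T = opt_tree[OF o]
  obtain T1 where T1: "opt T1" "br T1 = br T" "lf T1 = insert u (lf T - {y})"
    using leaf_rotate[OF o y(1) a(1) d(1) False] by blast
  have "u \<noteq> y'" using a(2) adj_irrefl by blast
  thus False using leaves_nonadj[OF T1(1), of c y' u] T1 c y a(2) by auto
qed

end

context ugraph begin

lemma dir_past:
  assumes T: "is_tree T" and d: "dir T t x v" "dir T v u t" "u \<noteq> t" and y: "dir T u v y"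
  shows "dir T t x y"
proof -
  have V: "u \<in> V" "t \<in> V" using dir_V[OF T d(2)] by auto
  have du: "dir T t x u" using dir_step[OF T d(1) dirD(1)[OF d(2)] d(3)] .
  obtain c where c: "dir T u c t" using dir_ex[OF T V d(3)] by blast
  have "c \<noteq> v"
  proof
    assume "c = v"
    thus False using side_excl[OF T, of u v t] dirD(1)[OF y] dirD(2)[OF c] dirD(2)[OF d(2)]
      by (auto simp: side_def insert_commute)
  qed
  thus ?thesis using dir_beyond[OF T du c y] by blast
qed

lemma other_nbr:
  assumes "2 \<le> deg T v" "is_tree T"
  obtains d where "{v, d} \<in> T" "d \<noteq> u"
proof -
  have "\<not> {w. {v, w} \<in> T} \<subseteq> {u}"
  proof
    assume "{w. {v, w} \<in> T} \<subseteq> {u}"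
    hence "card {w. {v, w} \<in> T} \<le> card {u}" by (intro card_mono) auto
    thus False using assms(1) by (simp add: deg_def)
  qed
  thus ?thesis using that by blast
qed

end

context claw_free_ugraph begin

section \<open>Optimal trees with a smallest core\<close>

text \<open>The minimal \<open>A\<close> is the union of all tree paths between branch vertices.\<close>

definition core :: "'a set set \<Rightarrow> 'a set \<Rightarrow> bool" where
  "core T A \<longleftrightarrow> A \<subseteq> V \<and> br T \<subseteq> A \<and> (\<forall>x\<in>A. \<forall>y\<in>A. conn {e \<in> T. e \<subseteq> A} x y)"

definition hopt :: "'a set set \<Rightarrow> 'a set \<Rightarrow> bool" where
  "hopt T A \<longleftrightarrow> opt T \<and> core T A \<and> (\<forall>T' A'. opt T' \<longrightarrow> core T' A' \<longrightarrow> card A \<le> card A')"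

text \<open>At a branch vertex \<open>t\<close> of a tree this is an arm that is a bare path ending
  in a leaf.\<close>

definition leg :: "'a set set \<Rightarrow> 'a \<Rightarrow> 'a \<Rightarrow> bool" where
  "leg T t p \<longleftrightarrow> {t, p} \<in> T \<and> (\<forall>z. dir T t p z \<longrightarrow> deg T z \<le> 2)"

lemma coreI:
  assumes "A \<subseteq> V" "br T \<subseteq> A" "\<And>x. x \<in> A \<Longrightarrow> conn {e \<in> T. e \<subseteq> A} r x"
  shows "core T A"
  unfolding core_def
proof (intro conjI ballI)
  fix x y assume "x \<in> A" "y \<in> A"
  thus "conn {e \<in> T. e \<subseteq> A} x y" using conn_trans[OF conn_sym[OF assms(3)] assms(3)] by blast
qed (use assms in auto)

lemma core_dir:
  assumes T: "is_tree T" and h: "core T A" and t: "t \<in> A" and x: "x \<in> A" and d: "dir T t p x"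
  shows "p \<in> A" "conn {e \<in> T. e \<subseteq> {z \<in> A. dir T t p z}} p x"
proof -
  let ?F = "{e \<in> T. e \<subseteq> A}" let ?G = "{e \<in> T. e \<subseteq> {z \<in> A. dir T t p z}}"
  have xt: "conn ?F x t" using h t x by (auto simp: core_def)
  obtain q where q: "{q, t} \<in> ?F" "conn {e \<in> ?F. t \<notin> e} x q"
    by (rule conn_last_exit[OF xt dir_neq[OF T d]])
  have "conn {e \<in> T. t \<notin> e} q x" by (rule conn_mono[OF conn_sym[OF q(2)]]) auto
  hence "dir T t q x" using q(1) dir_conn[OF dir_self] by (auto simp: insert_commute)
  hence qp: "q = p" using dir_unique[OF T d] by blast
  show "p \<in> A" using q(1) qp by auto
  have tp: "{t, p} \<in> T" using dirD(1)[OF d] .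
  have "conn {e \<in> ?F. t \<notin> e} p x" using conn_sym[OF q(2)] qp by simp
  hence "conn ?G p x \<and> dir T t p x"
  proof (induct rule: conn_induct)
    case refl
    thus ?case using tp by (simp add: dir_self)
  next
    case (step y z)
    have "dir T t p z" using dir_step[OF T, of t p y z] step by auto
    moreover have "{y, z} \<in> ?G" using step calculation by auto
    ultimately show ?case using step conn_step[of ?G p y z] by blast
  qed
  thus "conn ?G p x" by blast
qed

lemma core_btw:
  assumes T: "is_tree T" and h: "core T A" and a: "a \<in> A" "b \<in> A" and v: "btw T v a b"
  shows "v \<in> A"
proof (rule ccontr)
  assume n: "v \<notin> A"
  obtain p p' where p: "dir T v p a" "dir T v p' b" "p \<noteq> p'" using v by (auto simp: btw_def)
  have "conn {e \<in> T. e \<subseteq> A} a b" using h a by (auto simp: core_def)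
  hence "conn {e \<in> T. v \<notin> e} a b" by (rule conn_mono) (use n in auto)
  hence "dir T v p b" using dir_conn[OF p(1)] by blast
  thus False using p dir_unique[OF T] by blast
qed

lemma hopt_less:
  assumes "hopt T A" "opt T'" "core T' A'" "A' \<subseteq> A" "z \<in> A" "z \<notin> A'"
  shows False
proof -
  have "finite A" using assms(1) finV finite_subset by (auto simp: hopt_def core_def)
  hence "card A' < card A" using assms(4-6) by (metis psubsetI psubset_card_mono)
  thus False using assms(1-3) by (auto simp: hopt_def leD)
qed

lemma leg_no_branch: "leg T t p \<Longrightarrow> z \<in> br T \<Longrightarrow> \<not> dir T t p z"
  by (auto simp: leg_def br_def)

text \<open>Hanging all arms of \<open>t\<close> except those through \<open>e\<close> and
  \<open>k\<close> on \<open>k\<close> leaves \<open>t\<close> with degree two. If \<open>k\<close>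
  branches already, a branch vertex is saved. Otherwise \<open>k\<close> takes over from
  \<open>t\<close> without a new leaf, and the tie is broken by the core, which can now do without
  \<open>t\<close> and the leg \<open>e\<close>.\<close>

lemma no_move:
  assumes ho: "hopt T A" and t: "t \<in> br T" and k: "b \<in> br T" "dir T t k b"
    and e: "leg T t e" and other: "\<And>a. {t, a} \<in> T \<Longrightarrow> a \<noteq> e \<Longrightarrow> a \<noteq> k \<Longrightarrow> adj a k"
  shows False
proof -
  have o: "opt T" and h: "core T A" using ho by (auto simp: hopt_def)
  note T = opt_tree[OF o]
  have ek: "e \<noteq> k" using leg_no_branch[OF e k(1)] k(2) by blast
  have te: "{t, e} \<in> T" and tk: "{t, k} \<in> T" using e dirD(1)[OF k(2)] by (auto simp: leg_def)
  have V: "t \<in> V" "k \<in> V" "k \<noteq> t" "e \<noteq> t" using tree_edgeD[OF T tk] tree_edgeD[OF T te] by auto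
  let ?N = "{a. {t, a} \<in> T}"
  have fN: "finite ?N" using finite_nbrs[OF tree_finite[OF T]] .
  obtain L where L: "set L = ?N - {e, k}" "distinct L"
    using finite_distinct_list[of "?N - {e, k}"] fN by blast
  have len: "length L = deg T t - 2"
    using distinct_card[OF L(2)] L(1) te tk ek fN by (simp add: deg_def card_Diff_subset)
  define T' where "T' = xch T (map (\<lambda>a. (t, a)) L) (map (\<lambda>a. (k, a)) L)"
  have La: "{t, a} \<in> T \<and> adj k a \<and> \<not> dir T t a k" if "a \<in> set L" for a
    using that L(1) other[of a] adj_sym dir_unique[OF T dir_self[OF tk]] by auto
  have T': "is_tree T'" "\<And>z. deg T' z + length L * of_bool (z = t) = deg T z + length L * of_bool (z = k)"
    unfolding T'_def using move_arms[OF T V(2,3) L(2) La] by auto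
  have t3: "3 \<le> deg T t" using t by (simp add: br_def)
  have dt: "deg T' t = 2" using T'(2)[of t] len t3 V by simp
  have dz: "deg T' z = deg T z" if "z \<noteq> t" "z \<noteq> k" for z using T'(2)[of z] that by simp
  show False
  proof (cases "k \<in> br T")
    case True
    have "br T' \<subseteq> br T"
    proof
      fix z assume "z \<in> br T'"
      thus "z \<in> br T" using dz[of z] dt True by (cases "z = t"; cases "z = k") (auto simp: br_def)
    qed
    moreover have "t \<notin> br T'" using dt by (simp add: br_def)
    ultimately show False using opt_br[OF o T'(1) _ t] by blast
  next
    case False
    have brs: "br T' \<subseteq> insert k (br T - {t})"
    proof
      fix z assume "z \<in> br T'"
      thus "z \<in> insert k (br T - {t})" using dz[of z] dt by (cases "z = t"; cases "z = k") (auto simp: br_def)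
    qed
    have "card (br T') \<le> card (insert k (br T - {t}))" using brs by (intro card_mono) auto
    also have "\<dots> = card (br T)" using False t card_Suc_Diff1[OF finite_br t] by simp
    finally have c1: "card (br T') \<le> card (br T)" .
    have "lf T' \<subseteq> lf T"
    proof
      fix z assume z: "z \<in> lf T'"
      have "1 \<le> deg T k" using deg_pos[OF T V(2,1,3)] .
      hence "2 \<le> deg T' k" using T'(2)[of k] len t3 V by simp
      thus "z \<in> lf T" using z dz[of z] dt by (cases "z = t"; cases "z = k") (auto simp: lf_def)
    qed
    hence "card (lf T') \<le> card (lf T)" by (rule card_mono[OF finite_lf])
    hence o': "opt T'" using opt_eq[OF o T'(1) c1] by blast
    define A' where "A' = {z \<in> A. z \<noteq> t \<and> \<not> dir T t e z}"
    have tA: "t \<in> A" using h t by (auto simp: core_def)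
    have bA: "b \<in> A" using h k by (auto simp: core_def)
    have kA: "k \<in> A'" using core_dir(1)[OF T h tA bA k(2)] V(3) dir_unique[OF T dir_self[OF tk]] ek
      by (auto simp: A'_def)
    have "core T' A'"
    proof (rule coreI[where r = k])
      show "A' \<subseteq> V" using h by (auto simp: core_def A'_def)
      show "br T' \<subseteq> A'"
      proof
        fix z assume "z \<in> br T'"
        hence "z = k \<or> z \<in> br T \<and> z \<noteq> t" using brs by blast
        thus "z \<in> A'" using kA leg_no_branch[OF e] h by (auto simp: core_def A'_def)
      qed
      fix x assume x: "x \<in> A'"
      hence xA: "x \<in> A" "x \<noteq> t" "\<not> dir T t e x" by (auto simp: A'_def)
      obtain p where p: "dir T t p x" using dir_ex[OF T V(1)] xA h by (metis core_def subsetD)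
      have pe: "p \<noteq> e" using p xA by blast
      note hd = core_dir[OF T h tA xA(1) p]
      have pt: "{t, p} \<in> T" "p \<noteq> t" using dirD(1)[OF p] dir_nbr_neq[OF T p] by auto
      have pA: "p \<in> A'" using hd(1) pt dir_unique[OF T dir_self[OF pt(1)]] pe by (auto simp: A'_def)
      have "conn {e \<in> T'. e \<subseteq> A'} p x"
      proof (rule conn_mono[OF hd(2)])
        show "{e \<in> T. e \<subseteq> {z \<in> A. dir T t p z}} \<subseteq> {e \<in> T'. e \<subseteq> A'}"
        proof
          fix f assume f: "f \<in> {e \<in> T. e \<subseteq> {z \<in> A. dir T t p z}}"
          hence "t \<notin> f" using dir_neq[OF T] by blast
          hence "f \<in> T'" using f by (auto simp: T'_def xch_def eset_def)
          moreover have "f \<subseteq> A'"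
          proof
            fix z assume "z \<in> f"
            hence z: "z \<in> A" "dir T t p z" using f by auto
            show "z \<in> A'" using z(1) dir_neq[OF T z(2)] dir_unique[OF T z(2), of e] pe by (auto simp: A'_def)
          qed
          ultimately show "f \<in> {e \<in> T'. e \<subseteq> A'}" by blast
        qed
      qed
      moreover have "conn {e \<in> T'. e \<subseteq> A'} k p"
      proof (cases "p = k")
        case False
        hence "p \<in> set L" using L(1) pt pe by blast
        hence "{k, p} \<in> T'" by (auto simp: T'_def xch_def eset_def)
        thus ?thesis using kA pA by (intro conn_edge) auto
      qed simp
      ultimately show "conn {e \<in> T'. e \<subseteq> A'} k x" by (rule conn_trans[rotated])
    qed
    thus False using hopt_less[OF ho o' _ _ tA] by (auto simp: A'_def)
  qed
qed

text \<open>If \<open>x\<close> had no neighbour among the other tree neighbours of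
  \<open>t\<close>, the absence of a claw on \<open>x\<close>, \<open>a\<close>, \<open>k\<close>
  would make each further neighbour \<open>a\<close> adjacent to \<open>k\<close>, where
  \<open>k\<close> leads to another branch vertex. This is the situation of
  \<open>no_move\<close>.\<close>

lemma leg_top_nbr:
  assumes ho: "hopt T A" and t: "t \<in> br T" and b: "b \<in> br T" "b \<noteq> t" and x: "leg T t x"
  obtains w where "{t, w} \<in> T" "w \<noteq> x" "adj x w"
proof -
  have T: "is_tree T" using ho opt_tree by (auto simp: hopt_def)
  obtain k where k: "dir T t k b" using dir_ex[OF T _ _ b(2)[symmetric]] b t by (auto simp: br_def)
  have xk: "x \<noteq> k" using leg_no_branch[OF x b(1)] k by blast
  have tx: "{t, x} \<in> T" using x by (simp add: leg_def)
  have "\<exists>w. {t, w} \<in> T \<and> w \<noteq> x \<and> adj x w"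
  proof (rule ccontr)
    assume n: "\<not> ?thesis"
    have "adj a k" if a: "{t, a} \<in> T" "a \<noteq> x" "a \<noteq> k" for a
      using claw[of t x a k] tree_adj[OF T tx] tree_adj[OF T a(1)] tree_adj[OF T dirD(1)[OF k]] n a xk
        dirD(1)[OF k] by blast
    thus False using no_move[OF ho t b(1) k x] by blast
  qed
  thus ?thesis using that by blast
qed

text \<open>The only other neighbour \<open>k\<close> of \<open>t\<close> leads to \<open>b\<close>.
  Applying \<open>no_move\<close> with either leg kept forbids the edge from the top of the other
  leg to \<open>k\<close>, so the absence of a claw at \<open>t\<close> leaves \<open>x w\<close>
  only.\<close>

lemma leg_tops_adj:
  assumes ho: "hopt T A" and t: "t \<in> br T" "deg T t = 3" and b: "b \<in> br T" "b \<noteq> t"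
    and x: "leg T t x" and w: "leg T t w" "x \<noteq> w"
  shows "adj x w"
proof -
  have T: "is_tree T" using ho opt_tree by (auto simp: hopt_def)
  obtain k where k: "dir T t k b" using dir_ex[OF T _ _ b(2)[symmetric]] b t by (auto simp: br_def)
  have ne: "x \<noteq> k" "w \<noteq> k" using leg_no_branch[OF x b(1)] leg_no_branch[OF w(1) b(1)] k by blast+
  have e: "{t, x} \<in> T" "{t, w} \<in> T" "{t, k} \<in> T" using x w dirD(1)[OF k] by (auto simp: leg_def)
  have fin: "finite {a. {t, a} \<in> T}" using finite_nbrs[OF tree_finite[OF T]] .
  have nb: "{a. {t, a} \<in> T} = {x, w, k}"
  proof (rule card_subset_eq[symmetric, OF fin])
    show "{x, w, k} \<subseteq> {a. {t, a} \<in> T}" using e by auto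
    show "card {x, w, k} = card {a. {t, a} \<in> T}" using t(2) ne w(2) by (simp add: deg_def)
  qed
  have nbD: "a = x \<or> a = w \<or> a = k" if "{t, a} \<in> T" for a
    using nb that by blast
  have "\<not> adj x k"
  proof
    assume "adj x k"
    thus False using no_move[OF ho t(1) b(1) k w(1)] nbD by blast
  qed
  moreover have "\<not> adj w k"
  proof
    assume "adj w k"
    thus False using no_move[OF ho t(1) b(1) k x] nbD by blast
  qed
  ultimately show ?thesis using claw[of t x w k] tree_adj[OF T] e ne w(2) by blast
qed

end

section \<open>Exchanges around one branch vertex\<close>

text \<open>\<open>t\<close> is a candidate for joining the leaves in the independent set. The
  remaining branch vertices have degree three, so that every \<open>jnet\<close> at one of them
  makes it stop branching.\<close>

locale centre = claw_free_ugraph +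
  fixes T A t
  assumes ho: "hopt T A" and tb: "t \<in> br T"
    and deg3: "\<And>z. z \<in> br T \<Longrightarrow> z \<noteq> t \<Longrightarrow> deg T z = 3"
    and ex2: "\<exists>b\<in>br T. b \<noteq> t"
begin

lemma opt_T: "opt T" and core_A: "core T A" and tree_T: "is_tree T" and tV: "t \<in> V" and tA: "t \<in> A" and t3: "3 \<le> deg T t"
  using ho tb opt_tree by (auto simp: hopt_def core_def br_def)

lemma brV: "z \<in> br T \<Longrightarrow> z \<in> V" and lfV: "z \<in> lf T \<Longrightarrow> z \<in> V"
  by (auto simp: br_def lf_def)

lemma lf_neq_t: "y \<in> lf T \<Longrightarrow> y \<noteq> t"
  using t3 by (auto simp: lf_def)

lemma no_net: "net T t y \<Longrightarrow> y \<in> lf T \<Longrightarrow> False"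
  using net_leaf[OF opt_T _ tb] by blast

lemma no_jnet: "jnet T j t y \<Longrightarrow> j \<in> br T \<Longrightarrow> j \<noteq> t \<Longrightarrow> y \<in> lf T \<Longrightarrow> False"
proof -
  assume a: "jnet T j t y" "j \<in> br T" "j \<noteq> t" "y \<in> lf T"
  have "deg T j = 3" "j \<noteq> y" "j \<in> V" using deg3 a by (auto simp: br_def lf_def)
  thus False using jnet_opt[OF opt_T a(1) _ a(3) _ _ tb] a(4) lf_neq_t[OF a(4)] by blast
qed

lemma leg_top: 
  assumes "leg T t x"
  obtains w where "{t, w} \<in> T" "w \<noteq> x" "adj x w"
  using leg_top_nbr[OF ho tb _ _ assms] ex2 by blast

text \<open>\<open>g\<close> is the median of \<open>t\<close>, \<open>v\<close> and
  \<open>y\<close>. The directions rule out \<open>t\<close> and \<open>v\<close> as inner vertices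
  of the other two, and a leaf is never inner.\<close>

lemma junction:
  assumes d: "dir T t p v" "dir T t p y" "dir T v u t" "dir T v u y" and y: "y \<in> lf T"
  obtains g where "g \<in> br T" "g \<noteq> t" "btw T g t v" "btw T g t y" "btw T g v y" "dir T t p g"
proof -
  have V: "v \<in> V" "y \<in> V" using dir_V[OF tree_T d(1)] dir_V[OF tree_T d(2)] by auto
  have ne: "t \<noteq> v" "t \<noteq> y" "v \<noteq> y" using dir_neq[OF tree_T] d by blast+
  have "\<not> btw T t v y" "\<not> btw T v t y" using d dir_unique[OF tree_T] unfolding btw_def by metis+
  moreover have "\<not> btw T y t v" using leaf_not_btw[OF tree_T] y by (auto simp: lf_def)
  ultimately obtain g where g: "btw T g t v" "btw T g t y" "btw T g v y"
    using median[OF tree_T tV V ne] by blast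
  have gb: "g \<in> br T" using btw3_deg[OF tree_T g] btw_V[OF tree_T g(1)] by (auto simp: br_def)
  have gt: "g \<noteq> t" using btw_neq[OF tree_T g(1)] by auto
  obtain a where a: "dir T t a g" using dir_ex[OF tree_T tV brV[OF gb] gt[symmetric]] by blast
  have "a = p" using btw_dir[OF tree_T g(1) a] dir_unique[OF tree_T d(1)] by blast
  thus ?thesis using that[OF gb gt g] a by blast
qed

text \<open>This is the dichotomy behind the exchanges at \<open>t\<close>: either a leg supplies a
  corner \<open>x t w\<close> to cut off, which yields \<open>net\<close>, or a branch vertex of
  degree three lies on the way to \<open>y\<close>, which yields \<open>jnet\<close>.\<close>

lemma leg_or_branch:
  assumes y: "y \<in> lf T" and d: "dir T t p y" and l: "\<not> leg T t p"
  obtains j where "j \<in> br T" "j \<noteq> t" "btw T j t y" "dir T t p j"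
proof -
  obtain z where z: "dir T t p z" "3 \<le> deg T z" using l dirD(1)[OF d] by (fastforce simp: leg_def)
  have V: "y \<in> V" "z \<in> V" using dir_V[OF tree_T d] dir_V[OF tree_T z(1)] by auto
  have ne: "t \<noteq> y" "t \<noteq> z" "y \<noteq> z" using dir_neq[OF tree_T] d z y by (auto simp: lf_def)
  have "\<not> btw T t y z" using d z dir_unique[OF tree_T] unfolding btw_def by metis
  moreover have "\<not> btw T y t z" using leaf_not_btw[OF tree_T] y by (auto simp: lf_def)
  ultimately have "btw T z t y \<or> (\<exists>g. btw T g t y \<and> btw T g t z \<and> btw T g y z)"
    using median[OF tree_T tV V ne] by blast
  then obtain g where g: "btw T g t y" "g \<in> br T"
  proof
    assume "btw T z t y" thus ?thesis using that z V by (auto simp: br_def)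
  next
    assume "\<exists>g. btw T g t y \<and> btw T g t z \<and> btw T g y z"
    then obtain g where g: "btw T g t y" "btw T g t z" "btw T g y z" by blast
    thus ?thesis using that btw3_deg[OF tree_T g] btw_V[OF tree_T g(1)] by (auto simp: br_def)
  qed
  have gt: "g \<noteq> t" using btw_neq[OF tree_T g(1)] by auto
  obtain a where a: "dir T t a g" using dir_ex[OF tree_T tV brV[OF g(2)] gt[symmetric]] by blast
  have "a = p" using btw_dir[OF tree_T g(1) a] dir_unique[OF tree_T d(1)] by blast
  thus ?thesis using that g gt a by blast
qed

lemma leaf_nonadj:
  assumes y: "y \<in> lf T"
  shows "\<not> adj t y"
proof
  assume a: "adj t y"
  obtain p where p: "dir T t p y" using dir_ex[OF tree_T tV lfV[OF y]] lf_neq_t[OF y] by metis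
  show False
  proof (cases "leg T t p")
    case True
    then obtain w where w: "{t, w} \<in> T" "w \<noteq> p" "adj p w" using leg_top by blast
    show False using no_net[OF net_corner[OF tree_T dirD(1)[OF p] w(1) _ w(3) a p] y] w(2) by blast
  next
    case False
    then obtain j where "j \<in> br T" "j \<noteq> t" "btw T j t y" using leg_or_branch[OF y p] by blast
    thus False using no_jnet[OF jnet_direct[OF tree_T _ a]] y by blast
  qed
qed

lemma leaf_opp:
  assumes y: "y \<in> lf T" and a: "adj t v" "adj y u" and d: "dir T v u t" "dir T u v y"
  shows False
proof -
  have ut: "u \<noteq> t" using leaf_nonadj[OF y] a(2) adj_sym by blast
  have vt: "t \<noteq> v" using dir_neq[OF tree_T d(1)] .
  obtain p where p: "dir T t p v" using dir_ex[OF tree_T tV _ vt] dir_V[OF tree_T d(1)] by blast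
  have py: "dir T t p y" using dir_past[OF tree_T p d(1) ut d(2)] .
  show False
  proof (cases "leg T t p")
    case True
    then obtain w where w: "{t, w} \<in> T" "w \<noteq> p" "adj p w" using leg_top by blast
    show False using no_net[OF net_cross_arm[OF tree_T dirD(1)[OF p] w(1) _ p d(1) ut w(3) a d(2)] y] w(2) by blast
  next
    case False
    then obtain j where "j \<in> br T" "j \<noteq> t" "btw T j t y" using leg_or_branch[OF y py] by blast
    thus False using no_jnet[OF jnet_cross[OF tree_T d a]] y by blast
  qed
qed

end

section \<open>A leaf and the centre charged to the same edge: the arm is a leg\<close>

context claw_free_ugraph begin

text \<open>The core vertices in direction \<open>p\<close> are joined to \<open>p\<close> by tree
  edges inside that direction, so an exchange elsewhere does not disturb this piece of the
  core.\<close>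

lemma core_piece:
  assumes T: "is_tree T" and h: "core T A" and t: "t \<in> A" and z: "z \<in> A" "dir T t p z"
    and keep: "\<And>f. f \<in> T \<Longrightarrow> f \<subseteq> {q. dir T t p q} \<Longrightarrow> f \<in> T'"
    and sub: "\<And>q. q \<in> A \<Longrightarrow> dir T t p q \<Longrightarrow> q \<in> A'"
  shows "p \<in> A'" "conn {e \<in> T'. e \<subseteq> A'} p z"
proof -
  note hd = core_dir[OF T h t z]
  show "p \<in> A'" using sub[OF hd(1) dir_self[OF dirD(1)[OF z(2)]]] .
  show "conn {e \<in> T'. e \<subseteq> A'} p z"
  proof (rule conn_mono[OF hd(2)])
    show "{e \<in> T. e \<subseteq> {z \<in> A. dir T t p z}} \<subseteq> {e \<in> T'. e \<subseteq> A'}"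
    proof
      fix f assume f: "f \<in> {e \<in> T. e \<subseteq> {z \<in> A. dir T t p z}}"
      have "f \<in> T'" by (rule keep) (use f in auto)
      moreover have "f \<subseteq> A'" using f sub by auto
      ultimately show "f \<in> {e \<in> T'. e \<subseteq> A'}" by simp
    qed
  qed
qed

end

context centre begin

lemma leaf_far_branch:
  assumes y: "y \<in> lf T" and d: "dir T t w y" and l: "\<not> leg T t w" and u: "u \<in> V" "\<not> dir T t w u"
  obtains j where "j \<in> br T" "j \<noteq> t" "btw T j y u"
proof -
  obtain j where j: "j \<in> br T" "j \<noteq> t" "btw T j t y" "dir T t w j" using leg_or_branch[OF y d l] .
  obtain a b where ab: "dir T j a t" "dir T j b y" "a \<noteq> b" using j(3) by (auto simp: btw_def)
  have "dir T j a u" using dir_far[OF tree_T j(4) ab(1) u] .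
  thus ?thesis using that[OF j(1,2)] ab unfolding btw_def by blast
qed

text \<open>No single exchange settles this case. Forbidden exchanges and the absence of claws first
  force the adjacencies \<open>y u\<close>, \<open>t e\<close> and \<open>e p\<close>. The tree
  \<open>T'\<close> from \<open>swap_arms\<close> ties with \<open>T\<close>; in it \<open>t\<close>
  has the neighbour \<open>e\<close> instead of \<open>w\<close>, the leg through \<open>x\<close>
  continues across \<open>v y\<close>, and every neighbour of \<open>t\<close> except
  \<open>x\<close> and \<open>k\<close> is adjacent to \<open>k\<close>. Then \<open>no_move\<close>
  refutes \<open>T'\<close>.\<close>

lemma leg_same:
  assumes y: "y \<in> lf T" and a: "adj t v" "adj y v" and d: "dir T v u t" "dir T v u y"
    and ut: "u \<noteq> t" and x: "dir T t x v" and lx: "leg T t x"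
  shows False
proof -
  have tx: "{t, x} \<in> T" using dirD(1)[OF x] .
  have yt: "y \<noteq> t" using lf_neq_t[OF y] .
  have yu: "u \<noteq> y" using leaf_toward_neq[OF tree_T y, of v t] d(1) yt by blast
  have nx: "\<not> dir T t x y"
  proof
    assume "dir T t x y"
    then obtain g where "g \<in> br T" "dir T t x g" using junction[OF x _ d y] by blast
    thus False using leg_no_branch[OF lx] by blast
  qed
  have ntu: "\<not> adj t u"
  proof
    assume tu: "adj t u"
    obtain w where w: "{t, w} \<in> T" "w \<noteq> x" "adj x w" using leg_top[OF lx] .
    show False
      using no_net[OF net_insert_near[OF tree_T tx w(1) w(2)[symmetric] x d(1) ut w(3) tu a(2) nx] y] .
  qed
  have vu: "adj v u" using tree_adj[OF tree_T dirD(1)[OF d(1)]] .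
  have yu': "adj y u"
    using claw[of v t y u] a vu leaf_nonadj[OF y] ntu ut yu yt adj_sym by blast
  \<comment> \<open>Cutting off the corner at such a \<open>w\<close> would otherwise allow
    \<open>t\<close> and \<open>y\<close> to be inserted between \<open>u\<close> and
    \<open>v\<close>.\<close>
  have uniq: "dir T t w y" if w: "{t, w} \<in> T" "w \<noteq> x" "adj x w" for w
  proof (rule ccontr)
    assume "\<not> dir T t w y"
    thus False using no_net[OF net_insert_far[OF tree_T tx w(1) w(2)[symmetric] x d(1) ut w(3) a(1) yu' nx] y] by blast
  qed
  obtain w where w: "{t, w} \<in> T" "w \<noteq> x" "adj x w" using leg_top[OF lx] .
  have wy: "dir T t w y" using uniq[OF w] .
  note A = arm[OF tree_T tx w(1) w(2)[symmetric] x d(1) ut]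
  have nadj: "\<not> adj x p" if "{t, p} \<in> T" "p \<noteq> x" "p \<noteq> w" for p
    using uniq[OF that(1,2)] dir_unique[OF tree_T wy] that(3) by blast
  have lw: "leg T t w"
  proof (rule ccontr)
    assume "\<not> leg T t w"
    moreover have "\<not> dir T t w u" using dir_unique[OF tree_T A(14)] w(2) by blast
    ultimately obtain j where "j \<in> br T" "j \<noteq> t" "btw T j y u" using leaf_far_branch[OF y wy _ A(5)] by blast
    thus False using no_jnet[OF jnet_same[OF tree_T d a(1) yu']] y by blast
  qed
  \<comment> \<open>Being adjacent to \<open>t\<close>, \<open>v\<close> is not a leaf, so the leg
    continues beyond \<open>v\<close>.\<close>
  have "v \<notin> lf T" using leaf_nonadj[of v] a(1) by blast
  hence v2: "2 \<le> deg T v" using A(4) by (simp add: lf_def)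
  obtain e where e: "{v, e} \<in> T" "e \<noteq> u" using other_nbr[OF v2 tree_T] by blast
  note B = arm_next[OF tree_T tx w(1) w(2)[symmetric] x d(1) ut e]
  have nye: "\<not> adj y e"
  proof
    assume "adj y e"
    thus False using no_net[OF net_next[OF tree_T tx w(1) w(2)[symmetric] x d(1) ut e w(3) a(1) _ wy] y] by blast
  qed
  have ye: "y \<noteq> e" using B(5) nx by blast
  have te: "adj t e"
    using claw[of v t y e] a tree_adj[OF tree_T e(1)] leaf_nonadj[OF y] nye yt ye B(3) adj_sym by blast
  have nxe: "\<not> adj x e"
  proof
    assume "adj x e"
    thus False using no_net[OF net_next_top[OF tree_T tx w(1) w(2)[symmetric] x d(1) ut e a(2) _ wy] y] by blast
  qed
  have xe: "x \<noteq> e" using dir_unique[OF tree_T A(24)] dir_self[OF e(1)] e(2) by blast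
  have ep: "adj e p" if p: "{t, p} \<in> T" "p \<noteq> x" "p \<noteq> w" for p
  proof -
    have "e \<noteq> p" using dir_unique[OF tree_T B(5)] dir_self[OF p(1)] p(2) by blast
    thus ?thesis using claw[of t x e p] tree_adj[OF tree_T tx] te tree_adj[OF tree_T p(1)] xe p(2) nxe nadj[OF p] by blast
  qed
  define T' where "T' = xch T [(v, e), (t, w)] [(t, e), (v, y)]"
  have T': "is_tree T'" "\<And>z. deg T' z + of_bool (z = w) = deg T z + of_bool (z = y)"
    unfolding T'_def using swap_arms[OF tree_T tx w(1) w(2)[symmetric] x d(1) ut e te a(2) wy] by auto
  have wd: "deg T w \<le> 2" using lw dir_self[OF w(1)] by (auto simp: leg_def)
  have yd: "deg T y \<le> 1" "1 \<le> deg T y"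
    using y deg_pos[OF tree_T lfV[OF y] tV yt] by (auto simp: lf_def)
  have brT': "br T' = br T"
  proof -
    have "z \<in> br T' \<longleftrightarrow> z \<in> br T" for z
      using T'(2)[of z] wd yd by (cases "z = w"; cases "z = y") (auto simp: br_def)
    thus ?thesis by blast
  qed
  have "lf T' \<subseteq> insert w (lf T - {y})"
  proof
    fix z assume "z \<in> lf T'"
    thus "z \<in> insert w (lf T - {y})"
      using T'(2)[of z] yd by (cases "z = w"; cases "z = y") (auto simp: lf_def)
  qed
  hence "card (lf T') \<le> card (insert w (lf T - {y}))" by (intro card_mono) auto
  also have "\<dots> \<le> card (lf T)" using y card_Suc_Diff1[OF finite_lf y] by (simp add: card_insert_if)
  finally have o': "opt T'" using opt_eq[OF opt_T T'(1)] brT' by simp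
  have keep: "f \<in> T'" if "f \<in> T" "f \<noteq> {v, e}" "f \<noteq> {t, w}" for f
    using that by (auto simp: T'_def xch_def)
  \<comment> \<open>Neither leg contains a branch vertex, so both can be trimmed from the core. What
    remains avoids every deleted edge, since \<open>v\<close> lies on the leg through
    \<open>x\<close>.\<close>
  define A0 where "A0 = {z \<in> A. \<not> dir T t x z \<and> \<not> dir T t w z}"
  have core': "core T' A0"
  proof (rule coreI[where r = t])
    show "A0 \<subseteq> V" using core_A by (auto simp: core_def A0_def)
    show "br T' \<subseteq> A0"
      using core_A leg_no_branch[OF lx] leg_no_branch[OF lw] brT' by (auto simp: core_def A0_def)
    fix z assume "z \<in> A0"
    hence z: "z \<in> A" "\<not> dir T t x z" "\<not> dir T t w z" by (auto simp: A0_def)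
    have tA0: "t \<in> A0" using tA dir_neq[OF tree_T] by (auto simp: A0_def)
    show "conn {e \<in> T'. e \<subseteq> A0} t z"
    proof (cases "z = t")
      case False
      obtain p where p: "dir T t p z" using dir_ex[OF tree_T tV _ False[symmetric]] z core_A by (auto simp: core_def)
      have pn: "p \<noteq> x" "p \<noteq> w" using p z by blast+
      have sub: "q \<in> A0" if "q \<in> A" "dir T t p q" for q
        using that dir_unique[OF tree_T that(2), of x] dir_unique[OF tree_T that(2), of w] pn by (auto simp: A0_def)
      have kp: "f \<in> T'" if f: "f \<in> T" "f \<subseteq> {q. dir T t p q}" for f
      proof -
        have "v \<notin> f" using f(2) dir_unique[OF tree_T x, of p] pn by blast
        moreover have "t \<notin> f" using f(2) dir_neq[OF tree_T, of t p t] by blast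
        ultimately show ?thesis using keep[OF f(1)] by blast
      qed
      note pc = core_piece[OF tree_T core_A tA z(1) p kp sub]
      have "{t, p} \<in> T'"
        using keep[OF dirD(1)[OF p]] pn A(8) B(3) by (auto simp: doubleton_eq_iff)
      hence "{t, p} \<in> {e \<in> T'. e \<subseteq> A0}" using tA0 pc(1) by simp
      thus ?thesis by (rule conn_trans[OF conn_edge pc(2)])
    qed simp
  qed
  have "card A0 \<le> card A" using core_A finite_subset[OF _ finV] by (intro card_mono) (auto simp: A0_def core_def)
  hence ho': "hopt T' A0" using ho o' core' unfolding hopt_def by (meson le_trans)
  obtain b where b: "b \<in> br T" "b \<noteq> t" using ex2 by blast
  obtain k where k: "dir T t k b" using dir_ex[OF tree_T tV brV[OF b(1)] b(2)[symmetric]] by blast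
  have kn: "k \<noteq> x" "k \<noteq> w" using k leg_no_branch[OF lx b(1)] leg_no_branch[OF lw b(1)] by blast+
  have tk: "{t, k} \<in> T" using dirD(1)[OF k] .
  have side': "side T v e z" if "dir T t p z" "p \<noteq> x" for p z
    using dir_far[OF tree_T x d(1) dir_V(3)[OF tree_T that(1)]] dir_unique[OF tree_T that(1), of x] that(2)
      dir_other_side[OF tree_T _ e(1), of u z] e(2) by blast
  have k': "dir T' t k b"
  proof -
    have 1: "side T v e k" "side T v e b" using side'[OF dir_self[OF tk] kn(1)] side'[OF k kn(1)] by auto
    have 2: "side T t w k" "side T t w b"
      using dir_other_side[OF tree_T dir_self[OF tk] w(1)] dir_other_side[OF tree_T k w(1)] kn(2) by blast+
    have "conn (T - eset [(v, e), (t, w), (k, t)]) k b"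
      by (rule conn_same_side[OF tree_T]) (use 1 2 dirD(2)[OF k] tree_edgeD[OF tree_T tk] brV[OF b(1)] in auto)
    hence "conn (T' - {{k, t}}) k b" by (rule conn_mono) (auto simp: T'_def xch_def)
    moreover have "{t, k} \<in> T'" using keep[OF tk] kn A(8) B(3) by (auto simp: doubleton_eq_iff)
    ultimately show ?thesis by (simp add: dir_def side_def)
  qed
  have tx': "{t, x} \<in> T'" using keep[OF tx] A(8) B(3) w(2) by (auto simp: doubleton_eq_iff)
  have leg': "leg T' t x"
    unfolding leg_def
  proof (intro conjI allI impI tx')
    fix z assume z: "dir T' t x z"
    show "deg T' z \<le> 2"
    proof (rule ccontr)
      assume "\<not> deg T' z \<le> 2"
      hence "z \<in> br T'" using dir_V(3)[OF T'(1) z] by (simp add: br_def)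
      hence zb: "z \<in> br T" using brT' by simp
      have zt: "z \<noteq> t" using dir_neq[OF T'(1) z] .
      obtain p where p: "dir T t p z" using dir_ex[OF tree_T tV brV[OF zb] zt[symmetric]] by blast
      have pn: "p \<noteq> x" "p \<noteq> w" using p leg_no_branch[OF lx zb] leg_no_branch[OF lw zb] by blast+
      have s: "side T v e z" "side T t w z" "side T t x z"
        using side'[OF p pn(1)] dir_other_side[OF tree_T p w(1)] dir_other_side[OF tree_T p tx] pn by blast+
      have "conn (T - eset [(v, e), (t, w), (t, x)]) t z"
        by (rule conn_same_side[OF tree_T]) (use s tV brV[OF zb] B(9) in auto)
      hence "conn (T' - {{t, x}}) t z" by (rule conn_mono) (auto simp: T'_def xch_def)
      moreover have "conn (T' - {{t, x}}) x z" using dirD(2)[OF z] by (simp add: side_def insert_commute)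
      ultimately show False using side_excl[OF T'(1) tx'] by blast
    qed
  qed
  \<comment> \<open>\<open>x\<close> is adjacent to none of the old neighbours still attached to
    \<open>t\<close>, so the absence of a claw on \<open>x\<close>, \<open>q\<close>,
    \<open>k\<close> gives \<open>q k\<close>; the new neighbour \<open>e\<close> is covered by
    \<open>ep\<close>.\<close>
  have other: "adj q k" if q: "{t, q} \<in> T'" "q \<noteq> x" "q \<noteq> k" for q
  proof -
    have "{t, q} = {t, e} \<or> {t, q} \<in> T \<and> {t, q} \<noteq> {t, w}"
      using q(1) A(8) yt by (auto simp: T'_def xch_def doubleton_eq_iff)
    thus ?thesis
    proof
      assume "{t, q} = {t, e}"
      hence "q = e" by (auto simp: doubleton_eq_iff)
      thus ?thesis using ep[OF tk kn] by blast
    next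
      assume q': "{t, q} \<in> T \<and> {t, q} \<noteq> {t, w}"
      hence qw: "q \<noteq> w" by auto
      show ?thesis using claw[of t x q k] tree_adj[OF tree_T] tx tk q' q(2,3) kn nadj[OF _ q(2) qw] nadj[OF tk kn] by blast
    qed
  qed
  show False using no_move[OF ho' _ _ k' leg' other] tb b brT' by blast
qed

end

section \<open>A leaf and the centre charged to the same edge: branch vertices along the arm\<close>

context claw_free_ugraph begin

text \<open>Rerouting takes two units from \<open>t\<close>. If \<open>v\<close> branches already, a
  branch vertex is saved. If \<open>t\<close> has degree four, it keeps degree two and the leaf
  \<open>y\<close> disappears. If it has degree three, \<open>t\<close> replaces \<open>y\<close> as
  a leaf and \<open>v\<close> can at most replace \<open>t\<close> as a branch vertex; only this tie
  is passed on to \<open>fin\<close>, to be decided by the core.\<close>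

lemma no_reroute:
  assumes o: "opt T" and t: "t \<in> br T" "deg T t \<le> 4"
    and e: "{t, x} \<in> T" "{t, w} \<in> T" "x \<noteq> w"
    and a: "adj x w" "adj y v" and y: "y \<in> lf T" "dir T t x y" and v: "\<not> dir T t x v" "\<not> dir T t w v" "v \<noteq> t"
    and fin: "\<And>T'. opt T' \<Longrightarrow> deg T t = 3 \<Longrightarrow> T' = xch T [(t, x), (t, w)] [(x, w), (y, v)] \<Longrightarrow> v \<notin> br T \<Longrightarrow>
      br T' \<subseteq> insert v (br T - {t}) \<Longrightarrow> False"
  shows False
proof -
  note T = opt_tree[OF o]
  define T' where "T' = xch T [(t, x), (t, w)] [(x, w), (y, v)]"
  have T': "is_tree T'" "\<And>z. deg T' z + 2 * of_bool (z = t) = deg T z + of_bool (z = y) + of_bool (z = v)"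
    unfolding T'_def using reroute_arms[OF T e a y(2) v(1,2)] by auto
  have V: "v \<in> V" "t \<in> V" "y \<in> V" using adj_V2[OF a(2)] t y(1) by (auto simp: br_def lf_def)
  have t3: "3 \<le> deg T t" using t by (simp add: br_def)
  have yt: "y \<noteq> t" using y(1) t3 by (auto simp: lf_def)
  have yv: "y \<noteq> v" using a(2) adj_irrefl by blast
  have yd: "deg T y \<le> 1" "1 \<le> deg T y" using y deg_pos[OF T V(3,2) yt] by (auto simp: lf_def)
  have v1: "1 \<le> deg T v" using deg_pos[OF T V(1,2) v(3)] .
  have dt: "deg T' t \<le> 2" "deg T' t + 2 = deg T t" using T'(2)[of t] yt v(3) t(2) by auto
  have tn: "t \<notin> br T'" using dt by (simp add: br_def)
  have brs: "br T' \<subseteq> insert v (br T - {t})"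
  proof
    fix z assume z: "z \<in> br T'"
    hence "z \<noteq> t" using tn by blast
    thus "z \<in> insert v (br T - {t})" using z T'(2)[of z] yd by (cases "z = y"; cases "z = v") (auto simp: br_def)
  qed
  show False
  proof (cases "v \<in> br T")
    case True
    thus False using opt_br[OF o T'(1) _ t(1) tn] brs by blast
  next
    case False
    have "card (br T') \<le> card (insert v (br T - {t}))" using brs by (intro card_mono) auto
    also have "\<dots> = card (br T)" using False card_Suc_Diff1[OF finite_br t(1)] by simp
    finally have c: "card (br T') \<le> card (br T)" .
    have l: "z \<in> lf T - {y} \<or> z = t \<and> deg T t = 3" if "z \<in> lf T'" for z
      using that T'(2)[of z] yd yv yt v1 dt t3 v(3) by (cases "z = y"; cases "z = v"; cases "z = t") (auto simp: lf_def)
    have cy: "Suc (card (lf T - {y})) = card (lf T)" using card_Suc_Diff1[OF finite_lf y(1)] .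
    show False
    proof (cases "deg T t = 3")
      case True
      have "card (lf T') \<le> card (insert t (lf T - {y}))" using l by (intro card_mono) auto
      also have "\<dots> \<le> card (lf T)" using cy by (simp add: card_insert_if)
      finally show False using fin[OF opt_eq[OF o T'(1) c] True T'_def False brs] by blast
    next
      case False
      have "card (lf T') \<le> card (lf T - {y})" using l False by (intro card_mono) auto
      thus False using opt_lf[OF o T'(1) c] cy by simp
    qed
  qed
qed

end

text \<open>The two shapes are those needed when there are fewer than seven leaves: an extreme
  branch vertex when all branch degrees are three, or a vertex of degree four among exactly three
  branch vertices. Each restricts where the other branch vertices can lie.\<close>

locale shaped_centre = centre +
  assumes shape: "deg T t = 3 \<and> (\<forall>b\<in>br T. \<forall>b'\<in>br T. \<forall>p p'. b \<noteq> t \<longrightarrow> b' \<noteq> t \<longrightarrow>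
      dir T t p b \<longrightarrow> dir T t p' b' \<longrightarrow> p = p') \<or> deg T t = 4 \<and> card (br T) = 3"
begin

lemma deg_t: "deg T t \<le> 4"
  using shape by auto

lemma one_dir:
  assumes "deg T t = 3" "b \<in> br T" "b \<noteq> t" "dir T t p b" "b' \<in> br T" "b' \<noteq> t" "dir T t p' b'"
  shows "p = p'"
proof -
  have "deg T t \<noteq> 4" using assms(1) by simp
  thus ?thesis using shape assms(2-) by blast
qed

text \<open>A branch vertex \<open>b\<close> in direction \<open>x\<close> that is not reached
  through \<open>v\<close> would yield a branch vertex strictly between \<open>t\<close> and
  \<open>v\<close>, namely \<open>b\<close> or a median. As \<open>u\<close> does not branch, it
  would lie between \<open>t\<close> and \<open>u\<close>.\<close>

lemma branch_beyond:
  assumes d: "dir T v u t" and x: "dir T t x v" and u2: "deg T u \<le> 2"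
    and nb: "\<And>j. j \<in> br T \<Longrightarrow> j \<noteq> t \<Longrightarrow> \<not> btw T j t u"
    and b: "b \<in> br T" "dir T t x b"
  shows "side T v u b" "b = v \<or> btw T v t b"
proof -
  have V: "v \<in> V" "b \<in> V" using dir_V[OF tree_T x] dir_V[OF tree_T b(2)] by auto
  have ne: "t \<noteq> v" "t \<noteq> b" using dir_neq[OF tree_T] x b by blast+
  have nj: "\<not> btw T j t v" if "j \<in> br T" "j \<noteq> t" for j
  proof
    assume j: "btw T j t v"
    have "u \<noteq> j" using that u2 by (auto simp: br_def)
    thus False using nb[OF that] btw_move[OF tree_T j d] by blast
  qed
  show c: "b = v \<or> btw T v t b"
  proof (rule ccontr)
    assume n: "\<not> ?thesis"
    hence vb: "v \<noteq> b" by auto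
    have "\<not> btw T t v b" using x b dir_unique[OF tree_T] unfolding btw_def by metis
    moreover have "\<not> btw T b t v" using nj[OF b(1)] ne by blast
    ultimately obtain g where g: "btw T g t v" "btw T g t b" "btw T g v b"
      using median[OF tree_T tV V ne vb] n by blast
    have "g \<in> br T" using btw3_deg[OF tree_T g] btw_V[OF tree_T g(1)] by (auto simp: br_def)
    thus False using nj[of g] g(1) btw_neq[OF tree_T g(1)] by blast
  qed
  show "side T v u b"
  proof (cases "b = v")
    case False
    then obtain p p' where p: "dir T v p t" "dir T v p' b" "p \<noteq> p'" using c by (auto simp: btw_def)
    have "p = u" using dir_unique[OF tree_T d p(1)] by simp
    thus ?thesis using dir_other_side[OF tree_T p(2) dirD(1)[OF d]] p(3) by blast
  qed simp
qed

text \<open>With no branch vertex between \<open>t\<close> and \<open>u\<close>, all branching in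
  direction \<open>x\<close> happens at \<open>v\<close> or beyond it, so \<open>v\<close> belongs
  to the core. In each remaining case some exchange lets \<open>v\<close> take over from a branch
  vertex, \<open>t\<close> or \<open>q\<close>: either a count improves, or the counts tie and the
  core gets by without that vertex.\<close>

lemma far_same:
  assumes y: "y \<in> lf T" and a: "adj t v" "adj y v" and d: "dir T v u t" "dir T v u y"
    and ut: "u \<noteq> t" and x: "dir T t x v" and nl: "\<not> leg T t x"
  shows False
proof -
  have tx: "{t, x} \<in> T" using dirD(1)[OF x] .
  have yt: "y \<noteq> t" using lf_neq_t[OF y] .
  have yV: "y \<in> V" using lfV[OF y] .
  have yu: "u \<noteq> y" using leaf_toward_neq[OF tree_T y, of v t] d(1) yt by blast
  have vu: "adj v u" using tree_adj[OF tree_T dirD(1)[OF d(1)]] .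
  have u2: "deg T u \<le> 2" using leaf_nbr_deg[OF opt_T y a(2) d(2)] .
  have vt: "t \<noteq> v" using dir_neq[OF tree_T d(1)] .
  have ux: "dir T t x u" using dir_step[OF tree_T x dirD(1)[OF d(1)] ut] .
  have cl: "adj t u \<or> adj y u" using claw[of v t y u] a vu leaf_nonadj[OF y] ut yu yt adj_sym by blast
  have ubr: "u \<noteq> j" if "j \<in> br T" for j using that u2 by (auto simp: br_def)
  \<comment> \<open>Such a vertex would permit \<open>jnet_same\<close>: directly if
    \<open>t u\<close> is an edge, and otherwise with \<open>y u\<close> and a branch vertex between
    \<open>y\<close> and \<open>u\<close>.\<close>
  have nb: "\<not> btw T j t u" if j: "j \<in> br T" "j \<noteq> t" for j
  proof
    assume b: "btw T j t u"
    have n1: "\<not> adj t u"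
    proof
      assume "adj t u"
      thus False using no_jnet[OF jnet_sym[OF jnet_same[OF tree_T d(2,1) a(2) _ b]] j y] by blast
    qed
    hence yu': "adj y u" using cl by blast
    have "\<exists>g\<in>br T. g \<noteq> t \<and> btw T g y u"
    proof (cases "dir T t x y")
      case True
      then obtain g where g: "g \<in> br T" "g \<noteq> t" "btw T g v y" using junction[OF x _ d y] by blast
      have "btw T g y u" using btw_move[OF tree_T btw_sym[OF g(3)] d(2) ubr[OF g(1)]] .
      thus ?thesis using g by blast
    next
      case False
      obtain p where p: "dir T t p y" using dir_ex[OF tree_T tV yV yt[symmetric]] by blast
      hence "btw T t u y" using ux False unfolding btw_def by blast
      hence "btw T j u y" using btw_trans[OF tree_T btw_sym[OF b]] by blast
      thus ?thesis using j btw_sym by blast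
    qed
    then obtain g where "g \<in> br T" "g \<noteq> t" "btw T g y u" by blast
    thus False using no_jnet[OF jnet_same[OF tree_T d a(1) yu']] y by blast
  qed
  have nxy: "\<not> dir T t x y"
  proof
    assume "dir T t x y"
    then obtain g where g: "g \<in> br T" "g \<noteq> t" "btw T g t v" using junction[OF x _ d y] by blast
    have "btw T g t u" using btw_move[OF tree_T g(3) d(1) ubr[OF g(1)]] .
    thus False using nb g by blast
  qed
  have beyond: "side T v u b" "b = v \<or> btw T v t b" if "b \<in> br T" "dir T t x b" for b
    using branch_beyond[OF d(1) x u2 _ that] nb by blast+
  obtain b where b: "b \<in> br T" "dir T t x b" "b \<noteq> t"
  proof -
    obtain z where z: "dir T t x z" "\<not> deg T z \<le> 2" using nl tx by (auto simp: leg_def)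
    thus ?thesis using that[of z] dir_V[OF tree_T z(1)] dir_neq[OF tree_T z(1)] by (auto simp: br_def)
  qed
  have vA: "v \<in> A"
    using beyond(2)[OF b(1,2)] core_btw[OF tree_T core_A tA, of b v] b(1) core_A by (auto simp: core_def)
  obtain p where p: "dir T t p y" using dir_ex[OF tree_T tV yV yt[symmetric]] by blast
  have px: "p \<noteq> x" using p nxy by blast
  have tp: "{t, p} \<in> T" using dirD(1)[OF p] .
  have nvp: "\<not> dir T t q v" if "q \<noteq> x" for q using dir_unique[OF tree_T x] that by blast
  \<comment> \<open>Beyond \<open>v\<close> nothing changes as long as only edges on the side of \<open>t\<close> are exchanged.\<close>
  have piece: "conn {e \<in> T'. e \<subseteq> A'} v z"
    if z: "z \<in> A" "side T v u z" and keep: "\<And>f. f \<in> T \<Longrightarrow> t \<notin> f \<Longrightarrow> f \<in> T'"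
      and sub: "\<And>q. q \<in> A \<Longrightarrow> side T v u q \<Longrightarrow> q \<in> A'" for z T' A'
  proof (cases "z = v")
    case False
    have zV: "z \<in> V" using z core_A by (auto simp: core_def)
    obtain r where r: "dir T v r z" using dir_ex[OF tree_T _ zV False[symmetric]] vA core_A by (auto simp: core_def)
    have ru: "r \<noteq> u"
      using side_excl[OF tree_T, of v u z] dirD[OF r] z(2) by (auto simp: side_def insert_commute)
    have s: "side T v u q" if "dir T v r q" for q
      using dir_other_side[OF tree_T that dirD(1)[OF d(1)]] ru by blast
    have kp: "f \<in> T'" if f: "f \<in> T" "f \<subseteq> {q. dir T v r q}" for f
    proof (rule keep[OF f(1)])
      show "t \<notin> f" using f(2) dir_unique[OF tree_T d(1)] ru by blast
    qed
    note pc = core_piece[OF tree_T core_A vA z(1) r kp sub[OF _ s]]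
    have "{v, r} \<in> T'"
    proof (rule keep[OF dirD(1)[OF r]])
      have "r \<noteq> t" using dir_unique[OF tree_T d(1)] dir_self[OF dirD(1)[OF r]] ru by blast
      thus "t \<notin> {v, r}" using vt by blast
    qed
    hence "{v, r} \<in> {e \<in> T'. e \<subseteq> A'}" using pc(1) sub[OF vA] by simp
    thus ?thesis by (rule conn_trans[OF conn_edge pc(2)])
  qed simp
  have tside: "\<not> side T v u t"
    using side_excl[OF tree_T, of v u t] dirD[OF d(1)] by (auto simp: side_def insert_commute)
  show False
  proof (cases "leg T t p")
    case lp: True
    show False
    proof (cases "\<exists>w. {t, w} \<in> T \<and> w \<noteq> p \<and> w \<noteq> x \<and> adj p w")
      case True
      then obtain w where w: "{t, w} \<in> T" "w \<noteq> p" "w \<noteq> x" "adj p w" by blast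
      show False
      proof (rule no_reroute[OF opt_T tb deg_t tp w(1) w(2)[symmetric] w(4) a(2) y p nvp[OF px] nvp[OF w(3)] vt[symmetric]])
        fix T' assume o': "opt T'" and d3: "deg T t = 3" and T': "T' = xch T [(t, p), (t, w)] [(p, w), (y, v)]"
          and brs: "br T' \<subseteq> insert v (br T - {t})"
        \<comment> \<open>At degree three all other branch vertices lie in direction
          \<open>x\<close>, hence on the far side of \<open>u v\<close>. The core vertices there
          suffice for \<open>T'\<close>, and \<open>t\<close> is not one of them.\<close>
        define A' where "A' = {z \<in> A. side T v u z}"
        have "core T' A'"
        proof (rule coreI[where r = v])
          show "A' \<subseteq> V" using core_A by (auto simp: core_def A'_def)
          show "br T' \<subseteq> A'"
          proof
            fix z assume "z \<in> br T'"
            hence "z = v \<or> z \<in> br T \<and> z \<noteq> t" using brs by blast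
            thus "z \<in> A'"
            proof
              assume z: "z \<in> br T \<and> z \<noteq> t"
              obtain q where q: "dir T t q z" using dir_ex[OF tree_T tV brV] z by metis
              hence "q = x" using one_dir[OF d3 _ _ q b(1,3,2)] z by blast
              thus ?thesis using beyond(1) z q core_A by (auto simp: core_def A'_def)
            qed (use vA in \<open>auto simp: A'_def\<close>)
          qed
          fix z assume "z \<in> A'"
          thus "conn {e \<in> T'. e \<subseteq> A'} v z"
            by (intro piece) (auto simp: A'_def T' xch_def)
        qed
        thus False using hopt_less[OF ho o' _ _ tA] tside by (auto simp: A'_def)
      qed
    next
      case False
      obtain w where w: "{t, w} \<in> T" "w \<noteq> p" "adj p w" using leg_top[OF lp] .
      have pax: "adj p x" using False w by blast
      have ntu: "\<not> adj t u"
      proof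
        assume "adj t u"
        thus False
          using no_net[OF net_insert_near[OF tree_T tx tp px[symmetric] x d(1) ut adj_sym[OF pax] _ a(2) nxy] y] by blast
      qed
      hence yu': "adj y u" using cl by blast
      have npv: "\<not> adj p v"
      proof
        assume "adj p v"
        thus False using no_net[OF net_two_arms[OF tree_T tx tp px[symmetric] x d(1) ut yu' _ p] y] by blast
      qed
      \<comment> \<open>At degree three the third arm \<open>q\<close> would be a leg too, since the
        other branch vertices share direction \<open>x\<close>; then \<open>leg_tops_adj\<close>
        gives the edge \<open>p q\<close> that this case excludes.\<close>
      have d4: "deg T t = 4"
      proof (rule ccontr)
        assume "deg T t \<noteq> 4"
        hence d3: "deg T t = 3" using t3 deg_t by simp
        have "\<not> {q. {t, q} \<in> T} \<subseteq> {p, x}"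
        proof
          assume "{q. {t, q} \<in> T} \<subseteq> {p, x}"
          hence "deg T t \<le> card {p, x}" unfolding deg_def by (intro card_mono) auto
          also have "\<dots> \<le> 2" by (simp add: card_insert_if)
          finally show False using d3 by simp
        qed
        then obtain q where q: "{t, q} \<in> T" "q \<noteq> p" "q \<noteq> x" by blast
        have "leg T t q"
        proof (rule ccontr)
          assume "\<not> leg T t q"
          then obtain z where z: "dir T t q z" "\<not> deg T z \<le> 2" using q(1) by (auto simp: leg_def)
          hence "z \<in> br T" "z \<noteq> t" using dir_V[OF tree_T z(1)] dir_neq[OF tree_T z(1)] by (auto simp: br_def)
          thus False using one_dir[OF d3 _ _ z(1) b(1,3,2)] q(3) by blast
        qed
        hence "adj p q" using leg_tops_adj[OF ho tb d3 b(1,3) lp _ q(2)[symmetric]] by blast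
        thus False using False q by blast
      qed
      have vo: "adj v q" if q: "{t, q} \<in> T" "q \<noteq> p" "q \<noteq> x" for q
      proof -
        have "p \<noteq> v" "v \<noteq> q" using nvp[OF px] nvp[OF q(3)] dir_self[OF tp] dir_self[OF q(1)] by blast+
        moreover have "\<not> adj p q" using False q by blast
        ultimately show ?thesis using claw[of t p v q] tree_adj[OF tree_T tp] a(1) tree_adj[OF tree_T q(1)] npv q(2) by blast
      qed
      have fN: "finite {q. {t, q} \<in> T}" using finite_nbrs[OF tree_finite[OF tree_T]] .
      obtain L where L: "set L = {q. {t, q} \<in> T} - {p, x}" "distinct L"
        using finite_distinct_list[of "{q. {t, q} \<in> T} - {p, x}"] fN by blast
      have "card ({q. {t, q} \<in> T} - {p, x}) = card {q. {t, q} \<in> T} - card {p, x}"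
        using tp tx by (intro card_Diff_subset) auto
      hence len: "length L = 2"
        using distinct_card[OF L(2)] L(1) d4 px by (simp add: deg_def)
      \<comment> \<open>\<open>v\<close> receives both arms of \<open>t\<close> other than those
        through \<open>p\<close> and \<open>x\<close>, which leaves \<open>t\<close> with degree
        two.\<close>
      define T' where "T' = xch T (map (\<lambda>a. (t, a)) L) (map (\<lambda>a. (v, a)) L)"
      have vV: "v \<in> V" using adj_V2[OF a(1)] .
      have La: "{t, q} \<in> T \<and> adj v q \<and> \<not> dir T t q v" if "q \<in> set L" for q
        using that L(1) vo nvp by auto
      have T': "is_tree T'" "\<And>z. deg T' z + length L * of_bool (z = t) = deg T z + length L * of_bool (z = v)"
        unfolding T'_def using move_arms[OF tree_T vV vt[symmetric] L(2) La] by auto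
      have dt: "deg T' t = 2" using T'(2)[of t] len d4 vt by simp
      have dv: "deg T' v = deg T v + 2" using T'(2)[of v] len vt by simp
      have dz: "deg T' z = deg T z" if "z \<noteq> t" "z \<noteq> v" for z using T'(2)[of z] that by simp
      have tn: "t \<notin> br T'" using dt by (simp add: br_def)
      have brs: "br T' \<subseteq> insert v (br T - {t})"
      proof
        fix z assume "z \<in> br T'"
        thus "z \<in> insert v (br T - {t})" using dz[of z] dt by (cases "z = t"; cases "z = v") (auto simp: br_def)
      qed
      show False
      proof (cases "v \<in> br T")
        case True
        thus False using opt_br[OF opt_T T'(1) _ tb tn] brs by blast
      next
        case vn: False
        have "card (br T') \<le> card (insert v (br T - {t}))" using brs by (intro card_mono) auto
        also have "\<dots> = card (br T)" using vn card_Suc_Diff1[OF finite_br tb] by simp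
        finally have c: "card (br T') \<le> card (br T)" .
        have "lf T' \<subseteq> lf T"
        proof
          fix z assume "z \<in> lf T'"
          thus "z \<in> lf T" using dz[of z] dt dv by (cases "z = t"; cases "z = v") (auto simp: lf_def)
        qed
        hence o': "opt T'" using opt_eq[OF opt_T T'(1) c] card_mono[OF finite_lf] by blast
        define A' where "A' = {z \<in> A. side T v u z \<or> (\<exists>q\<in>set L. dir T t q z)}"
        have "core T' A'"
        proof (rule coreI[where r = v])
          show "A' \<subseteq> V" using core_A by (auto simp: core_def A'_def)
          show "br T' \<subseteq> A'"
          proof
            fix z assume "z \<in> br T'"
            hence "z = v \<or> z \<in> br T \<and> z \<noteq> t" using brs by blast
            thus "z \<in> A'"
            proof
              assume z: "z \<in> br T \<and> z \<noteq> t"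
              obtain q where q: "dir T t q z" using dir_ex[OF tree_T tV brV] z by metis
              have "q \<noteq> p" using leg_no_branch[OF lp] z q by blast
              hence "q = x \<or> q \<in> set L" using dirD(1)[OF q] L(1) by blast
              thus ?thesis using beyond(1) z q core_A by (auto simp: core_def A'_def)
            qed (use vA in \<open>auto simp: A'_def\<close>)
          qed
          have keep: "f \<in> T'" if "f \<in> T" "t \<notin> f" for f
            using that by (auto simp: T'_def xch_def eset_def)
          fix z assume "z \<in> A'"
          hence zA: "z \<in> A" and "side T v u z \<or> (\<exists>q\<in>set L. dir T t q z)" by (auto simp: A'_def)
          thus "conn {e \<in> T'. e \<subseteq> A'} v z"
          proof (elim disjE bexE)
            assume "side T v u z"
            thus ?thesis by (intro piece[OF zA _ keep]) (auto simp: A'_def)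
          next
            fix q assume q: "q \<in> set L" "dir T t q z"
            have kp: "f \<in> T'" if f: "f \<in> T" "f \<subseteq> {z. dir T t q z}" for f
              using keep[OF f(1)] f(2) dir_neq[OF tree_T, of t q t] by blast
            have sub: "z \<in> A'" if "z \<in> A" "dir T t q z" for z using that q(1) by (auto simp: A'_def)
            note pc = core_piece[OF tree_T core_A tA zA q(2) kp sub]
            have "{v, q} \<in> T'" using q(1) by (auto simp: T'_def xch_def eset_def)
            hence "{v, q} \<in> {e \<in> T'. e \<subseteq> A'}" using pc(1) vA by (simp add: A'_def)
            thus ?thesis by (rule conn_trans[OF conn_edge pc(2)])
          qed
        qed
        moreover have "t \<notin> A'" using tside dir_neq[OF tree_T, of t _ t] by (auto simp: A'_def)
        ultimately show False using hopt_less[OF ho o' _ _ tA] by (auto simp: A'_def)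
      qed
    qed
  next
    case False
    \<comment> \<open>Branch vertices in two directions force the shape of degree four, so
      \<open>t\<close>, \<open>b\<close> and \<open>q\<close> are all there are. Both arms of
      \<open>q\<close> away from \<open>t\<close> are then legs with adjacent tops, and rerouting
      the one with \<open>y\<close> to \<open>v\<close> removes \<open>q\<close> from the
      core.\<close>
    obtain q where q: "q \<in> br T" "q \<noteq> t" "btw T q t y" "dir T t p q" using leg_or_branch[OF y p False] .
    have "deg T t \<noteq> 3"
    proof
      assume "deg T t = 3"
      thus False using one_dir[OF _ q(1,2,4) b(1,3,2)] px by blast
    qed
    hence c3: "card (br T) = 3" using shape by blast
    have bq: "b \<noteq> q" using dir_unique[OF tree_T b(2)] q(4) px by blast
    have br3: "br T = {t, b, q}"
    proof (rule card_subset_eq[symmetric])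
      show "card {t, b, q} = card (br T)" using c3 b(3) q(2) bq by simp
    qed (use tb b q in auto)
    have q3: "deg T q = 3" using deg3[OF q(1,2)] .
    obtain m r where m: "dir T q m t" "dir T q r y" "m \<noteq> r" using q(3) by (auto simp: btw_def)
    have bm: "dir T q m b" using dir_far[OF tree_T q(4) m(1) brV[OF b(1)]] dir_unique[OF tree_T b(2), of p] px by blast
    have vm: "dir T q m v" using dir_far[OF tree_T q(4) m(1) adj_V2[OF a(1)] nvp[OF px]] .
    have "\<not> {s. {q, s} \<in> T} \<subseteq> {m, r}"
    proof
      assume "{s. {q, s} \<in> T} \<subseteq> {m, r}"
      hence "deg T q \<le> card {m, r}" unfolding deg_def by (intro card_mono) auto
      also have "\<dots> \<le> 2" by (simp add: card_insert_if)
      finally show False using q3 by simp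
    qed
    then obtain s where s: "{q, s} \<in> T" "s \<noteq> m" "s \<noteq> r" by blast
    have lg: "leg T q s'" if "{q, s'} \<in> T" "s' \<noteq> m" for s'
      unfolding leg_def
    proof (intro conjI allI impI that(1))
      fix z assume z: "dir T q s' z"
      show "deg T z \<le> 2"
      proof (rule ccontr)
        assume "\<not> ?thesis"
        hence "z \<in> br T" using dir_V[OF tree_T z] by (auto simp: br_def)
        hence "z = t \<or> z = b \<or> z = q" using br3 by blast
        thus False using dir_unique[OF tree_T z, of m] dir_neq[OF tree_T z] m(1) bm that(2) by blast
      qed
    qed
    have qr: "{q, r} \<in> T" using dirD(1)[OF m(2)] .
    have ad: "adj r s" using leg_tops_adj[OF ho q(1) q3 tb q(2)[symmetric] lg[OF qr m(3)[symmetric]] lg[OF s(1,2)] s(3)[symmetric]] .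
    have vq: "v \<noteq> q" using dir_neq[OF tree_T vm] .
    have nv: "\<not> dir T q r v" "\<not> dir T q s v" using dir_unique[OF tree_T vm] m(3) s(2) by blast+
    show False
    proof (rule no_reroute[OF opt_T q(1) _ qr s(1) s(3)[symmetric] ad a(2) y m(2) nv vq])
      show "deg T q \<le> 4" using q3 by simp
      fix T' assume o': "opt T'" and T': "T' = xch T [(q, r), (q, s)] [(r, s), (y, v)]"
        and brs: "br T' \<subseteq> insert v (br T - {q})"
      define A' where "A' = {z \<in> A. \<not> dir T t p z}"
      have "core T' A'"
      proof (rule coreI[where r = t])
        show "A' \<subseteq> V" using core_A by (auto simp: core_def A'_def)
        show "br T' \<subseteq> A'"
        proof
          fix z assume "z \<in> br T'"
          hence "z = v \<or> z = t \<or> z = b" using brs br3 by blast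
          moreover have "\<not> dir T t p t" "\<not> dir T t p b" "\<not> dir T t p v"
            using dir_neq[OF tree_T, of t p t] dir_unique[OF tree_T b(2), of p] px nvp[OF px] by blast+
          ultimately show "z \<in> A'" using vA tA b(1) core_A by (auto simp: A'_def core_def)
        qed
        have keep: "f \<in> T'" if "f \<in> T" "q \<notin> f" for f
          using that by (auto simp: T' xch_def)
        fix z assume "z \<in> A'"
        hence z: "z \<in> A" "\<not> dir T t p z" by (auto simp: A'_def)
        show "conn {e \<in> T'. e \<subseteq> A'} t z"
        proof (cases "z = t")
          case False
          obtain c where c: "dir T t c z" using dir_ex[OF tree_T tV _ False[symmetric]] z core_A by (auto simp: core_def)
          have cp: "c \<noteq> p" using c z by blast
          have qn: "\<not> dir T t c q" using dir_unique[OF tree_T q(4)] cp by blast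
          have kp: "f \<in> T'" if f: "f \<in> T" "f \<subseteq> {z. dir T t c z}" for f
            using keep[OF f(1)] f(2) qn by blast
          have sub: "z \<in> A'" if "z \<in> A" "dir T t c z" for z
            using that dir_unique[OF tree_T that(2), of p] cp by (auto simp: A'_def)
          note pc = core_piece[OF tree_T core_A tA z(1) c kp sub]
          have "c \<noteq> q" using qn dir_self[OF dirD(1)[OF c]] by blast
          hence "{t, c} \<in> T'" using keep[OF dirD(1)[OF c]] q(2) by blast
          moreover have "t \<in> A'" using tA dir_neq[OF tree_T, of t p t] by (auto simp: A'_def)
          ultimately have "{t, c} \<in> {e \<in> T'. e \<subseteq> A'}" using pc(1) by simp
          thus ?thesis by (rule conn_trans[OF conn_edge pc(2)])
        qed simp
      qed
      moreover have "q \<in> A" using q(1) core_A by (auto simp: core_def)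
      ultimately show False using hopt_less[OF ho o', of A' q] q(4) by (auto simp: A'_def)
    qed
  qed
qed

lemma leaf_same:
  assumes y: "y \<in> lf T" and a: "adj t v" "adj y v" and d: "dir T v u t" "dir T v u y"
  shows False
proof -
  have ut: "u \<noteq> t" using leaf_nbr_deg[OF opt_T y a(2) d(2)] t3 by auto
  obtain x where x: "dir T t x v" using dir_ex[OF tree_T tV _ dir_neq[OF tree_T d(1)]] adj_V2[OF a(1)] by blast
  show False using leg_same[OF assms ut x] far_same[OF assms ut x] by blast
qed

end

context ugraph begin

section \<open>Existence of optimal trees and the degree sum\<close>

text \<open>A partial tree \<open>(W, F)\<close> with the most vertices spans: a walk leaving
  \<open>W\<close> would supply an edge to extend it.\<close>

lemma spanning_tree_exists:
  assumes r: "r \<in> V" and con: "\<And>x y. x \<in> V \<Longrightarrow> y \<in> V \<Longrightarrow> conn {{u, v} | u v. adj u v} x y"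
  obtains T where "is_tree T"
proof -
  let ?E = "{{u, v} | u v. adj u v}"
  define P where "P = (\<lambda>(W, F). W \<subseteq> V \<and> r \<in> W \<and> F \<subseteq> ?E \<and> (\<forall>x\<in>W. conn F r x) \<and> \<Union>F \<subseteq> W \<and> Suc (card F) = card W)"
  have P0: "P ({r}, {})" using r by (simp add: P_def)
  have Pb: "\<forall>WF. P WF \<longrightarrow> card (fst WF) < Suc (card V)"
  proof (intro allI impI)
    fix WF assume "P WF"
    hence "fst WF \<subseteq> V" by (cases WF) (simp add: P_def)
    hence "card (fst WF) \<le> card V" by (rule card_mono[OF finV])
    thus "card (fst WF) < Suc (card V)" by simp
  qed
  obtain WF where WF: "P WF" "\<And>WF'. P WF' \<Longrightarrow> card (fst WF') \<le> card (fst WF)"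
    using ex_has_greatest_nat[OF P0 Pb] by blast
  obtain W F where wf: "WF = (W, F)" by fastforce
  have W: "W \<subseteq> V" "r \<in> W" "F \<subseteq> ?E" "\<And>x. x \<in> W \<Longrightarrow> conn F r x" "\<Union>F \<subseteq> W" "Suc (card F) = card W"
    using WF(1) wf by (auto simp: P_def)
  have fW: "finite W" using W(1) finV finite_subset by blast
  have fF: "finite F" using finite_edges[OF W(3)] .
  have "W = V"
  proof (rule ccontr)
    assume "W \<noteq> V"
    then obtain z where z: "z \<in> V" "z \<notin> W" using W(1) by blast
    have "conn ?E r z" using con r z by blast
    hence "z \<in> W \<or> (\<exists>a b. a \<in> W \<and> b \<notin> W \<and> {a, b} \<in> ?E)"
    proof (induct rule: conn_induct)
      case (step y z)
      thus ?case by blast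
    qed (use W in simp)
    then obtain a b where ab: "a \<in> W" "b \<notin> W" "{a, b} \<in> ?E" using z by blast
    have aab: "adj a b" using edges_adj[OF order_refl ab(3)] .
    have new: "{a, b} \<notin> F" using W(5) ab(2) by blast
    have "P (insert b W, insert {a, b} F)"
      unfolding P_def prod.case
    proof (intro conjI ballI)
      show "insert b W \<subseteq> V" using W(1) adj_V2[OF aab] by blast
      show "insert {a, b} F \<subseteq> ?E" using W(3) ab(3) by blast
      show "\<Union> (insert {a, b} F) \<subseteq> insert b W" using W(5) ab(1) by blast
      show "Suc (card (insert {a, b} F)) = card (insert b W)"
        using W(6) new ab(2) fW fF by simp
      fix x assume x: "x \<in> insert b W"
      have m: "conn (insert {a, b} F) r y" if "y \<in> W" for y
        by (rule conn_mono[OF W(4)[OF that]]) blast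
      show "conn (insert {a, b} F) r x"
      proof (cases "x = b")
        case True
        show ?thesis unfolding True by (rule conn_step[OF m[OF ab(1)]]) simp
      qed (use m x in blast)
    qed (use W(2) in simp)
    hence "card (insert b W) \<le> card W" using WF(2) wf by fastforce
    thus False using ab(2) fW by simp
  qed
  have "is_tree F" unfolding is_tree_def
  proof (intro conjI ballI)
    fix x y assume xy: "x \<in> V" "y \<in> V"
    show "conn F x y" using conn_trans[OF conn_sym[OF W(4)] W(4)] xy \<open>W = V\<close> by blast
  qed (use W \<open>W = V\<close> r in auto)
  thus ?thesis using that by blast
qed

lemma sum_deg:
  assumes "F \<subseteq> {{u, v} | u v. adj u v}"
  shows "(\<Sum>z\<in>V. deg F z) = 2 * card F"
  using finite_edges[OF assms] assms
proof (induct F rule: finite_induct)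
  case empty
  thus ?case by (simp add: deg_def)
next
  case (insert e F)
  then obtain a b where ab: "e = {a, b}" "adj a b" by blast
  have V: "a \<in> V" "b \<in> V" "a \<noteq> b" using adj_V[OF ab(2)] adj_V2[OF ab(2)] adj_neq[OF ab(2)] by auto
  have "(\<Sum>z\<in>V. deg (insert e F) z) = (\<Sum>z\<in>V. deg F z + (of_bool (z = a) + of_bool (z = b)))"
    using deg_insert[OF insert(1), of a b] insert(2) ab V by simp
  also have "\<dots> = 2 * card F + ((\<Sum>z\<in>V. of_bool (z = a)) + (\<Sum>z\<in>V. of_bool (z = b)))"
    using insert by (simp add: sum.distrib)
  also have "(\<Sum>z\<in>V. of_bool (z = a)) = (1 :: nat)" using V finV by (simp add: of_bool_def)
  also have "(\<Sum>z\<in>V. of_bool (z = b)) = (1 :: nat)" using V finV by (simp add: of_bool_def)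
  finally show ?case using insert by simp
qed

text \<open>Besides non-adjacency, this excludes the two ways in which adjacencies of
  \<open>s\<close> and \<open>s'\<close> could be charged to one tree edge: both from the same end
  \<open>v\<close>, or from opposite ends.\<close>

definition apart :: "'a set set \<Rightarrow> 'a \<Rightarrow> 'a \<Rightarrow> bool" where
  "apart T s s' \<longleftrightarrow> \<not> adj s s' \<and>
    (\<forall>u v. \<not> (adj s v \<and> adj s' v \<and> dir T v u s \<and> dir T v u s')) \<and>
    (\<forall>u v. \<not> (adj s v \<and> adj s' u \<and> dir T v u s \<and> dir T u v s'))"

lemma apart_sym: "apart T s s' \<Longrightarrow> apart T s' s"
  unfolding apart_def using adj_sym by blast

end

context claw_free_ugraph begin

text \<open>A rearranged handshake identity: the leaves exceed two by the sum of degree minus two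
  over the branch vertices. The bound on \<open>card V\<close> excludes the one-vertex tree, whose
  leaf has degree zero.\<close>

lemma lf_count:
  assumes T: "is_tree T" and c: "2 \<le> card V"
  shows "card (lf T) + 2 * card (br T) = 2 + (\<Sum>z\<in>br T. deg T z)"
proof -
  have d1: "1 \<le> deg T z" if z: "z \<in> V" for z
  proof -
    have "\<not> V \<subseteq> {z}"
    proof
      assume "V \<subseteq> {z}"
      hence "card V \<le> card {z}" by (intro card_mono) auto
      thus False using c by simp
    qed
    then obtain z' where "z' \<in> V" "z \<noteq> z'" by blast
    thus ?thesis using deg_pos[OF T z] by blast
  qed
  have sub: "lf T \<subseteq> V" "br T \<subseteq> V" by (auto simp: lf_def br_def)
  have "(\<Sum>z\<in>V. deg T z) + (\<Sum>z\<in>V. of_bool (z \<in> lf T)) + (\<Sum>z\<in>V. of_bool (z \<in> br T) * 2) =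
      (\<Sum>z\<in>V. 2) + (\<Sum>z\<in>V. of_bool (z \<in> br T) * deg T z)"
    unfolding sum.distrib[symmetric]
  proof (rule sum.cong[OF refl])
    fix z assume z: "z \<in> V"
    consider "deg T z = 1" | "deg T z = 2" | "3 \<le> deg T z" using d1[OF z] by linarith
    thus "deg T z + of_bool (z \<in> lf T) + of_bool (z \<in> br T) * 2 = 2 + of_bool (z \<in> br T) * deg T z"
      using z by cases (auto simp: lf_def br_def)
  qed
  moreover have "(\<Sum>z\<in>V. of_bool (z \<in> lf T)) = card (lf T)"
    using sub finV by (simp add: of_bool_def sum.If_cases Int_absorb1)
  moreover have "(\<Sum>z\<in>V. of_bool (z \<in> br T) * 2) = 2 * card (br T)"
    using sub finV by (simp add: of_bool_def sum.If_cases Int_absorb1 if_distrib[of "\<lambda>x. x * 2"])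
  moreover have "(\<Sum>z\<in>V. of_bool (z \<in> br T) * deg T z) = (\<Sum>z\<in>br T. deg T z)"
    using sub finV by (intro sum.mono_neutral_cong_right) auto
  moreover have "(\<Sum>z\<in>V. deg T z) + 2 = 2 * card V"
    using sum_deg[of T] T by (simp add: is_tree_def)
  ultimately show ?thesis by simp
qed

lemma hopt_exists:
  assumes "is_tree T0"
  obtains T A where "hopt T A"
proof -
  obtain T1 where T1: "is_tree T1" "\<And>T. is_tree T \<Longrightarrow> card (br T1) \<le> card (br T)"
    using ex_has_least_nat[of is_tree T0 "\<lambda>T. card (br T)"] assms by blast
  obtain T2 where T2: "is_tree T2" "card (br T2) = card (br T1)"
    "\<And>T. is_tree T \<Longrightarrow> card (br T) = card (br T1) \<Longrightarrow> card (lf T2) \<le> card (lf T)"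
    using ex_has_least_nat[of "\<lambda>T. is_tree T \<and> card (br T) = card (br T1)" T1 "\<lambda>T. card (lf T)"] T1(1) by blast
  have o: "opt T2" unfolding opt_def using T1 T2 by simp
  \<comment> \<open>All of \<open>V\<close> is a core, so there is something to minimise
    over.\<close>
  have "core T2 V"
  proof -
    have "{e \<in> T2. e \<subseteq> V} = T2"
    proof -
      have "e \<subseteq> V" if eT: "e \<in> T2" for e
      proof -
        obtain u v where "e = {u, v}" "adj u v" using T2(1) eT unfolding is_tree_def by blast
        thus ?thesis using adj_V adj_V2 by auto
      qed
      thus ?thesis by blast
    qed
    thus ?thesis using T2(1) by (auto simp: core_def br_def is_tree_def)
  qed
  hence "opt (fst (T2, V)) \<and> core (fst (T2, V)) (snd (T2, V))" using o by simp
  then obtain TA where TA: "opt (fst TA) \<and> core (fst TA) (snd TA)"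
    "\<And>TA'. opt (fst TA') \<and> core (fst TA') (snd TA') \<Longrightarrow> card (snd TA) \<le> card (snd TA')"
    using ex_has_least_nat[of "\<lambda>TA. opt (fst TA) \<and> core (fst TA) (snd TA)" "(T2, V)" "\<lambda>TA. card (snd TA)"] by blast
  have "hopt (fst TA) (snd TA)" unfolding hopt_def
  proof (intro conjI allI impI)
    fix T' A' assume "opt T'" "core T' A'"
    thus "card (snd TA) \<le> card A'" using TA(2)[of "(T', A')"] by simp
  qed (use TA(1) in auto)
  thus ?thesis using that by blast
qed

text \<open>Each adjacency \<open>s v\<close> with \<open>s \<in> S\<close> is charged to the tree edge that leaves \<open>v\<close> towards \<open>s\<close>.
  No tree edge is charged twice, and at \<open>c\<close> at most one edge is charged.\<close>

lemma degree_sum_bound: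
  assumes T: "is_tree T" and S: "S \<subseteq> V" and ap: "\<And>s s'. s \<in> S \<Longrightarrow> s' \<in> S \<Longrightarrow> s \<noteq> s' \<Longrightarrow> apart T s s'"
    and c: "c \<in> V" "c \<notin> S" "3 \<le> deg T c"
    and E: "\<And>s p. s \<in> S \<Longrightarrow> {c, p} \<in> T \<Longrightarrow> \<not> dir T c p s \<Longrightarrow> \<not> adj s p"
  shows "(\<Sum>s\<in>S. card {v. adj s v}) + 3 \<le> card V"
proof -
  define nx where "nx v s = (SOME p. dir T v p s)" for v s
  have nx: "dir T v (nx v s) s" if sv: "adj s v" for s v
  proof -
    obtain p where "dir T v p s"
      using dir_ex[OF T adj_V2[OF sv] adj_V[OF sv]] adj_neq[OF sv] by metis
    thus ?thesis unfolding nx_def by (rule someI)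
  qed
  define P where "P = (SIGMA s:S. {v. adj s v})"
  define f where "f = (\<lambda>(s, v). {v, nx v s})"
  have fS: "finite S" using S finV finite_subset by blast
  have fN: "finite {v. adj s v}" for s using adj_V2 by (intro finite_subset[OF _ finV]) auto
  have fT: "finite T" using tree_finite[OF T] .
  have PT: "f ` P \<subseteq> T" using dirD(1)[OF nx] by (auto simp: f_def P_def)
  have inj: "inj_on f P"
  proof (rule inj_onI)
    fix a b assume ab: "a \<in> P" "b \<in> P" "f a = f b"
    obtain s v s' v' where sv: "a = (s, v)" "b = (s', v')" by (cases a; cases b)
    have s: "s \<in> S" "s' \<in> S" "adj s v" "adj s' v'" using ab(1,2) sv by (auto simp: P_def)
    note d = nx[OF s(3)] nx[OF s(4)]
    have "v = v' \<and> nx v s = nx v' s' \<or> v = nx v' s' \<and> nx v s = v'"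
      using ab(3) sv by (auto simp: f_def doubleton_eq_iff)
    thus "a = b"
    proof (elim disjE conjE)
      assume e: "v = v'" "nx v s = nx v' s'"
      have "s = s'"
      proof (rule ccontr)
        assume "s \<noteq> s'"
        thus False using ap[OF s(1,2)] s(3,4) d e unfolding apart_def by metis
      qed
      thus ?thesis using e sv by simp
    next
      assume e: "v = nx v' s'" "nx v s = v'"
      have d': "dir T v v' s" "dir T v' v s'" using d e by auto
      show ?thesis
      proof (cases "s = s'")
        case True
        thus ?thesis using d' dirD[OF d'(1)] dirD[OF d'(2)] side_excl[OF T, of v v' s]
          by (auto simp: side_def insert_commute)
      next
        case False
        thus ?thesis using ap[OF s(1,2)] s(3,4) d' unfolding apart_def by blast
      qed
    qed
  qed
  define Ec where "Ec = (\<lambda>p. {c, p}) ` {p. {c, p} \<in> T}"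
  have "inj (\<lambda>p. {c, p})" by (auto simp: inj_def doubleton_eq_iff)
  hence cE: "card Ec = deg T c" unfolding Ec_def deg_def by (intro card_image) (auto simp: inj_on_def inj_def)
  have ET: "Ec \<subseteq> T" by (auto simp: Ec_def)
  \<comment> \<open>An edge \<open>c p\<close> could be charged from either end. \<open>E\<close>
    rules out the end \<open>p\<close>, so its charge comes from a vertex adjacent to
    \<open>c\<close> itself.\<close>
  have use: "\<exists>s\<in>S. adj s c \<and> dir T c p s" if p: "{c, p} \<in> T" "{c, p} \<in> f ` P" for p
  proof -
    obtain s v where s: "s \<in> S" "adj s v" "{c, p} = {v, nx v s}" using p(2) by (auto simp: f_def P_def)
    note d = nx[OF s(2)]
    have "v = c \<and> nx v s = p \<or> v = p \<and> nx v s = c" using s(3) by (auto simp: doubleton_eq_iff)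
    thus ?thesis
    proof
      assume "v = p \<and> nx v s = c"
      hence "dir T p c s" "adj s p" using d s by auto
      moreover have "\<not> dir T c p s"
        using side_excl[OF T p(1), of s] dirD(2)[OF calculation(1)] by (auto simp: dir_def side_def insert_commute)
      ultimately show ?thesis using E[OF s(1) p(1)] by blast
    qed (use d s in auto)
  qed
  \<comment> \<open>Two charged edges at \<open>c\<close> would come from two neighbours
    \<open>s\<close>, \<open>s'\<close> of \<open>c\<close> in \<open>S\<close>. As \<open>c\<close>
    has a third tree neighbour \<open>q\<close>, which by \<open>E\<close> is adjacent to neither,
    these three would form a claw.\<close>
  have one: "card (f ` P \<inter> Ec) \<le> 1"
  proof (rule ccontr)
    assume "\<not> ?thesis"
    then obtain e e' where e: "e \<in> f ` P \<inter> Ec" "e' \<in> f ` P \<inter> Ec" "e \<noteq> e'"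
      using card_le_Suc0_iff_eq[of "f ` P \<inter> Ec"] finite_subset[OF ET fT] by auto
    then obtain p p' where p: "e = {c, p}" "e' = {c, p'}" "{c, p} \<in> T" "{c, p'} \<in> T" by (auto simp: Ec_def)
    have pp: "p \<noteq> p'" using e(3) p by auto
    obtain s where s: "s \<in> S" "adj s c" "dir T c p s" using use[OF p(3)] e(1) p(1) by blast
    obtain s' where s': "s' \<in> S" "adj s' c" "dir T c p' s'" using use[OF p(4)] e(2) p(2) by blast
    have "\<not> {q. {c, q} \<in> T} \<subseteq> {p, p'}"
    proof
      assume "{q. {c, q} \<in> T} \<subseteq> {p, p'}"
      hence "deg T c \<le> card {p, p'}" unfolding deg_def by (intro card_mono) auto
      also have "\<dots> \<le> 2" by (simp add: card_insert_if)
      finally show False using c(3) by simp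
    qed
    then obtain q where q: "{c, q} \<in> T" "q \<noteq> p" "q \<noteq> p'" by blast
    have n: "\<not> dir T c q s" "\<not> dir T c q s'" using dir_unique[OF T s(3)] dir_unique[OF T s'(3)] q by blast+
    have ss: "s \<noteq> s'" using dir_unique[OF T s(3)] s'(3) pp by blast
    have "s \<noteq> q" "s' \<noteq> q" using n dir_self[OF q(1)] by blast+
    moreover have "\<not> adj s s'" using ap[OF s(1) s'(1) ss] by (simp add: apart_def)
    ultimately show False
      using claw[of c s s' q] adj_sym[OF s(2)] adj_sym[OF s'(2)] tree_adj[OF T q(1)] ss
        E[OF s(1) q(1) n(1)] E[OF s'(1) q(1) n(2)] by blast
  qed
  have "f ` P \<subseteq> (T - Ec) \<union> (f ` P \<inter> Ec)" using PT by blast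
  hence "card (f ` P) \<le> card ((T - Ec) \<union> (f ` P \<inter> Ec))"
    using fT finite_subset[OF ET fT] by (intro card_mono) auto
  also have "\<dots> \<le> card (T - Ec) + card (f ` P \<inter> Ec)" by (rule card_Un_le)
  also have "card (T - Ec) = card T - deg T c" using ET cE finite_subset[OF ET fT] by (simp add: card_Diff_subset)
  finally have "card (f ` P) \<le> card T - deg T c + 1" using one by linarith
  moreover have "deg T c \<le> card T" using card_mono[OF fT ET] cE by simp
  ultimately have "card P + 3 \<le> Suc (card T)" using card_image[OF inj] c(3) by linarith
  moreover have "card P = (\<Sum>s\<in>S. card {v. adj s v})" unfolding P_def using fS fN by simp
  ultimately show ?thesis using T by (simp add: is_tree_def)
qed

section \<open>Extreme branch vertices and the choice of the independent set\<close>

lemma leaves_apart: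
  assumes o: "opt T" and c: "c \<in> br T" and y: "y \<in> lf T" "y' \<in> lf T" "y \<noteq> y'"
  shows "apart T y y'"
  unfolding apart_def using leaves_nonadj[OF assms] leaves_same[OF assms] leaves_opp[OF assms] by blast

lemma leaf_away:
  assumes o: "opt T" and c: "c \<in> br T" and y: "y \<in> lf T" and p: "{c, p} \<in> T" "\<not> dir T c p y"
  shows "\<not> adj y p"
proof
  assume a: "adj y p"
  have T: "is_tree T" using opt_tree[OF o] .
  have "side T c p y" using not_dir_side[OF T p(1) _ p(2)] y by (simp add: lf_def)
  hence "dir T p c y" using p(1) by (simp add: dir_def insert_commute)
  thus False using leaf_nbr_deg[OF o y a, of c] c by (simp add: br_def)
qed

text \<open>The degree of \<open>c\<close> matters: a rotation would move a unit from
  \<open>c\<close> to \<open>t\<close>, and \<open>c\<close> would stop branching while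
  \<open>t\<close> branches anyway.\<close>

lemma branch_away:
  assumes o: "opt T" and c: "c \<in> br T" "deg T c = 3" and t: "t \<in> br T" "t \<noteq> c"
    and p: "{c, p} \<in> T" "\<not> dir T c p t"
  shows "\<not> adj t p"
proof
  assume a: "adj t p"
  have T: "is_tree T" using opt_tree[OF o] .
  have "side T c p t" using not_dir_side[OF T p(1) _ p(2)] t by (simp add: br_def)
  hence "dir T p c t" using p(1) by (simp add: dir_def insert_commute)
  hence "net T c t" using net_rotate[OF T _ a] by blast
  thus False using net_br[OF o _ c(2) t(1)] t c by (auto simp: br_def)
qed

text \<open>\<open>b\<close> is chosen with the fewest vertices outside its direction towards
  \<open>b0\<close>; a branch vertex \<open>z\<close> among those would have still fewer. Keeping
  \<open>b\<close> different from a prescribed \<open>b0\<close> allows a second call to produce a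
  second extreme vertex.\<close>

lemma extreme_branch:
  assumes T: "is_tree T" and b0: "b0 \<in> br T" "b1 \<in> br T" "b1 \<noteq> b0"
  obtains b m where "b \<in> br T" "b \<noteq> b0" "\<And>z. z \<in> br T \<Longrightarrow> z \<noteq> b \<Longrightarrow> dir T b m z"
proof -
  define P where "P = (\<lambda>(b, m). b \<in> br T \<and> b \<noteq> b0 \<and> dir T b m b0)"
  have V: "b \<in> V" if "b \<in> br T" for b using that by (simp add: br_def)
  obtain m1 where "dir T b1 m1 b0" using dir_ex[OF T V[OF b0(2)] V[OF b0(1)] b0(3)] .
  hence "P (b1, m1)" using b0 by (simp add: P_def)
  then obtain bm where bm: "P bm" "\<And>bm'. P bm' \<Longrightarrow>
      card {w \<in> V. \<not> dir T (fst bm) (snd bm) w} \<le> card {w \<in> V. \<not> dir T (fst bm') (snd bm') w}"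
    using ex_has_least_nat[of P "(b1, m1)" "\<lambda>bm. card {w \<in> V. \<not> dir T (fst bm) (snd bm) w}"] by blast
  obtain b m where e: "bm = (b, m)" by fastforce
  have b: "b \<in> br T" "b \<noteq> b0" "dir T b m b0" using bm(1) e by (auto simp: P_def)
  have "dir T b m z" if z: "z \<in> br T" "z \<noteq> b" for z
  proof (rule ccontr)
    assume n: "\<not> dir T b m z"
    have zb0: "z \<noteq> b0" using n b(3) by blast
    obtain k where k: "dir T z k b0" using dir_ex[OF T V[OF z(1)] V[OF b0(1)] zb0] .
    obtain a where a: "dir T b a z" using dir_ex[OF T V[OF b(1)] V[OF z(1)] z(2)[symmetric]] .
    have am: "a \<noteq> m" using a n by blast
    obtain k' where k': "dir T z k' b" using dir_ex[OF T V[OF z(1)] V[OF b(1)] z(2)] .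
    have "btw T b z b0" using a b(3) am unfolding btw_def by blast
    hence "dir T z k' b0" using btw_dir[OF T _ k'] by blast
    hence kb: "dir T z k b" using dir_unique[OF T k] k' by blast
    have "P (z, k)" using z zb0 k by (simp add: P_def)
    hence le: "card {w \<in> V. \<not> dir T b m w} \<le> card {w \<in> V. \<not> dir T z k w}" using bm(2) e by fastforce
    have "\<not> dir T b m w" if w: "w \<in> V" "\<not> dir T z k w" for w
    proof
      assume d: "dir T b m w"
      have "\<not> dir T b a w" using dir_unique[OF T d] am by blast
      thus False using dir_far[OF T a kb w(1)] w(2) by blast
    qed
    moreover have "\<not> dir T b m b" using dir_neq[OF T, of b m b] by blast
    ultimately have "{w \<in> V. \<not> dir T z k w} \<subset> {w \<in> V. \<not> dir T b m w}" using V[OF b(1)] kb by blast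
    hence "card {w \<in> V. \<not> dir T z k w} < card {w \<in> V. \<not> dir T b m w}"
      using finV by (intro psubset_card_mono) auto
    thus False using le by simp
  qed
  thus ?thesis using that b by blast
qed

end

context shaped_centre begin

lemma centre_apart: "y \<in> lf T \<Longrightarrow> apart T t y"
  unfolding apart_def using leaf_nonadj leaf_same leaf_opp by blast

end

context claw_free_ugraph begin

lemma branch_leg_dir:
  assumes T: "is_tree T" and all: "\<And>z. z \<in> br T \<Longrightarrow> z \<noteq> b \<Longrightarrow> dir T b m z" and x: "{b, x} \<in> T" "x \<noteq> m"
  shows "leg T b x"
  unfolding leg_def
proof (intro conjI allI impI x(1))
  fix z assume z: "dir T b x z"
  show "deg T z \<le> 2"
  proof (rule ccontr)
    assume "\<not> ?thesis"
    hence "z \<in> br T" using dir_V(3)[OF T z] by (simp add: br_def)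
    thus False using all[of z] dir_neq[OF T z] dir_unique[OF T z] x(2) by blast
  qed
qed

text \<open>Both arms of \<open>b\<close> away from \<open>m\<close> are legs with adjacent tops, so
  the arm exchanges apply with the branch vertex \<open>q\<close> in place of a leaf. A unit moved
  from \<open>b\<close> to \<open>q\<close> saves a branch vertex; hence \<open>u\<close> is
  adjacent to neither, which leaves a claw at \<open>v\<close>.\<close>

lemma extreme_same:
  assumes ho: "hopt T A" and b: "b \<in> br T" "deg T b = 3" and q: "q \<in> br T" "q \<noteq> b"
    and all: "\<And>z. z \<in> br T \<Longrightarrow> z \<noteq> b \<Longrightarrow> dir T b m z"
    and a: "adj b v" "adj q v" "\<not> adj b q" and d: "dir T v u b" "dir T v u q"
    and u: "u \<noteq> b" "u \<noteq> q" and x: "dir T b x v" "x \<noteq> m"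
  shows False
proof -
  have o: "opt T" using ho by (simp add: hopt_def)
  note T = opt_tree[OF o]
  have bV: "b \<in> V" using b by (simp add: br_def)
  have bx: "{b, x} \<in> T" using dirD(1)[OF x(1)] .
  have qm: "dir T b m q" using all q by blast
  have "\<not> {w. {b, w} \<in> T} \<subseteq> {m, x}"
  proof
    assume "{w. {b, w} \<in> T} \<subseteq> {m, x}"
    hence "deg T b \<le> card {m, x}" unfolding deg_def by (intro card_mono) auto
    also have "\<dots> \<le> 2" by (simp add: card_insert_if)
    finally show False using b(2) by simp
  qed
  then obtain w where w: "{b, w} \<in> T" "w \<noteq> m" "w \<noteq> x" by blast
  have lx: "leg T b x" using branch_leg_dir[OF T all bx x(2)] .
  have lw: "leg T b w" using branch_leg_dir[OF T all w(1,2)] .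
  have xw: "adj x w" using leg_tops_adj[OF ho b q lx lw w(3)[symmetric]] .
  have nq: "\<not> dir T b x q" "\<not> dir T b w q" using dir_unique[OF T qm] x(2) w(2) by blast+
  have "\<not> adj b u"
  proof
    assume "adj b u"
    thus False
      using net_br[OF o net_insert_near[OF T bx w(1) w(3)[symmetric] x(1) d(1) u(1) xw _ a(2) nq(1)] b(2) q(1) q(2)[symmetric] bV] by blast
  qed
  moreover have "\<not> adj q u"
  proof
    assume "adj q u"
    thus False
      using net_br[OF o net_insert_far[OF T bx w(1) w(3)[symmetric] x(1) d(1) u(1) xw a(1) _ nq] b(2) q(1) q(2)[symmetric] bV] by blast
  qed
  moreover have "adj v u" using tree_adj[OF T dirD(1)[OF d(1)]] .
  ultimately show False using claw[of v b q u] adj_sym[OF a(1)] adj_sym[OF a(2)] a(3) q(2) u by blast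
qed

text \<open>The third branch vertex \<open>c\<close> lies between \<open>b\<close> and
  \<open>q\<close> and has degree three, so any \<open>jnet\<close> at \<open>c\<close> would remove
  it. This settles adjacency and charges from opposite ends. For charges from one end
  \<open>v\<close>, \<open>c\<close> turns out to lie between \<open>b\<close> and \<open>u\<close>
  and between \<open>q\<close> and \<open>u\<close>; so neither is adjacent to \<open>u\<close>, and
  there is a claw at \<open>v\<close>.\<close>

lemma extremes_apart:
  assumes ho: "hopt T A" and br3: "br T = {b, c, q}" "b \<noteq> c" "b \<noteq> q" "c \<noteq> q"
    and dg: "\<And>z. z \<in> br T \<Longrightarrow> deg T z = 3"
    and bm: "\<And>z. z \<in> br T \<Longrightarrow> z \<noteq> b \<Longrightarrow> dir T b m z"
    and qm: "\<And>z. z \<in> br T \<Longrightarrow> z \<noteq> q \<Longrightarrow> dir T q m' z"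
  shows "apart T b q"
proof -
  have o: "opt T" using ho by (simp add: hopt_def)
  note T = opt_tree[OF o]
  have B: "b \<in> br T" "c \<in> br T" "q \<in> br T" using br3 by auto
  have V: "b \<in> V" "c \<in> V" "q \<in> V" using B by (auto simp: br_def)
  note D = dg[OF B(1)] dg[OF B(2)] dg[OF B(3)]
  have nb: "\<not> btw T b z z'" if "z \<in> br T" "z' \<in> br T" "z \<noteq> b" "z' \<noteq> b" for z z'
    using bm[OF that(1,3)] bm[OF that(2,4)] dir_unique[OF T] unfolding btw_def by metis
  have nq: "\<not> btw T q z z'" if "z \<in> br T" "z' \<in> br T" "z \<noteq> q" "z' \<noteq> q" for z z'
    using qm[OF that(1,3)] qm[OF that(2,4)] dir_unique[OF T] unfolding btw_def by metis
  have cb: "btw T c b q"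
  proof (rule ccontr)
    assume n: "\<not> btw T c b q"
    obtain g where g: "btw T g b c" "btw T g b q" "btw T g c q"
      using median[OF T V br3(2,3,4)] n nb[OF B(2,3)] nq[OF B(1,2)] br3 by auto
    have "g \<in> br T" using btw3_deg[OF T g] btw_V[OF T g(1)] by (auto simp: br_def)
    hence "g = b \<or> g = c \<or> g = q" using br3(1) by simp
    thus False using btw_neq[OF T g(1)] btw_neq[OF T g(2)] by blast
  qed
  have J: False if "jnet T c b q" 
    using jnet_opt[OF o that D(2) br3(2)[symmetric] br3(4) V(2) B(1) _ br3(3)] B(3) by blast
  have nadj: "\<not> adj b q" using jnet_direct[OF T cb] J by blast
  have opp: False if "adj b v" "adj q u" "dir T v u b" "dir T u v q" for u v
    using jnet_cross[OF T that(3,4,1,2) cb] J by blast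
  have same: False if a: "adj b v" "adj q v" and d: "dir T v u b" "dir T v u q" for u v
  proof -
    have ub: "u \<noteq> b"
    proof
      assume "u = b"
      thus False using net_br[OF o net_rotate[OF T d(2) a(2)] _ B(3) _] D(1) br3(3) V(1) by blast
    qed
    have uq: "u \<noteq> q"
    proof
      assume "u = q"
      thus False using net_br[OF o net_rotate[OF T d(1) a(1)] _ B(1) _] D(3) br3(3) V(3) by blast
    qed
    have uc: "u \<noteq> c"
    proof
      assume "u = c"
      thus False using net_br[OF o net_rotate[OF T d(1) a(1)] _ B(1) _] D(2) br3(2) V(2) by blast
    qed
    have vV: "v \<in> V" using adj_V2[OF a(1)] .
    have vb: "v \<noteq> b" and vq: "v \<noteq> q" using dir_neq[OF T] d by blast+
    obtain x where x: "dir T b x v" using dir_ex[OF T V(1) vV vb[symmetric]] .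
    obtain y where y: "dir T q y v" using dir_ex[OF T V(3) vV vq[symmetric]] .
    have xm: "x = m"
      using extreme_same[OF ho B(1) D(1) B(3) br3(3)[symmetric] bm a nadj d ub uq x] by blast
    have ym: "y = m'"
      using extreme_same[OF ho B(3) D(3) B(1) br3(3) qm a(2,1) _ d(2,1) uq ub y] nadj adj_sym by blast
    have same: "\<not> btw T v b q" using d dir_unique[OF T] unfolding btw_def by metis
    have vc: "v \<noteq> c" using same cb by blast
    \<comment> \<open>If \<open>c\<close> is not between \<open>e\<close> and \<open>v\<close>, the
      median of \<open>e\<close>, \<open>c\<close> and \<open>v\<close> is a new vertex that
      branches. The only branch vertex left is \<open>e'\<close>, which is not between
      \<open>e\<close> and \<open>c\<close>.\<close>
    have far: "btw T c e v"
      if e: "e \<in> br T" "e \<noteq> c" "dir T e k v" "dir T e k c" "e \<noteq> v"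
        and ce: "btw T c e e'" and nve: "\<not> btw T v e e'" and ee: "br T = {e, c, e'}"
        and ne': "\<not> btw T e' e c" for e e' k
    proof (rule ccontr)
      assume n: "\<not> btw T c e v"
      have eV: "e \<in> V" using e(1) by (simp add: br_def)
      have "\<not> btw T e c v" using e(3,4) dir_unique[OF T] unfolding btw_def by metis
      moreover have "\<not> btw T v e c"
      proof
        assume "btw T v e c"
        thus False using btw_trans[OF T _ ce] nve by blast
      qed
      ultimately obtain g where g: "btw T g e c" "btw T g e v" "btw T g c v"
        using median[OF T eV V(2) vV e(2,5) vc[symmetric]] n by blast
      have "g \<in> br T" using btw3_deg[OF T g] btw_V[OF T g(1)] by (auto simp: br_def)
      hence "g = e \<or> g = c \<or> g = e'" using ee by simp
      thus False using btw_neq[OF T g(1)] g(1) ne' by blast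
    qed
    have c1: "btw T c b v"
      using far[OF B(1) br3(2) _ bm[OF B(2) br3(2)[symmetric]] vb[symmetric] cb same br3(1)]
        nq[OF B(1,2) br3(3,4)] x xm by blast
    have c2: "btw T c q v"
      using far[OF B(3) br3(4)[symmetric] _ qm[OF B(2) br3(4)] vq[symmetric] btw_sym[OF cb]]
        nb[OF B(3,2)] br3 y ym same btw_sym by (metis insert_commute)
    have c1': "btw T c b u" using btw_move[OF T c1 d(1) uc] .
    have c2': "btw T c q u" using btw_move[OF T c2 d(2) uc] .
    have "\<not> adj b u"
    proof
      assume "adj b u"
      thus False using jnet_sym[OF jnet_same[OF T d(2,1) a(2) _ c1']] J by blast
    qed
    moreover have "\<not> adj q u"
    proof
      assume "adj q u"
      thus False using jnet_same[OF T d a(1) _ c2'] J by blast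
    qed
    moreover have "adj v u" using tree_adj[OF T dirD(1)[OF d(1)]] .
    ultimately show False using claw[of v b q u] adj_sym[OF a(1)] adj_sym[OF a(2)] nadj br3(3) ub uq by blast
  qed
  show ?thesis unfolding apart_def using nadj same opp by blast
qed

lemma independent_subset:
  assumes o: "opt T" and S: "S \<subseteq> V" "7 \<le> card S"
    and ap: "\<And>s s'. s \<in> S \<Longrightarrow> s' \<in> S \<Longrightarrow> s \<noteq> s' \<Longrightarrow> apart T s s'"
    and c: "c \<in> br T" "c \<notin> S"
    and E: "\<And>s. s \<in> S \<Longrightarrow> s \<in> lf T \<or> s \<in> br T \<and> deg T c = 3"
  shows "\<exists>S'. S' \<subseteq> V \<and> card S' = 7 \<and> (\<forall>s\<in>S'. \<forall>s'\<in>S'. \<not> adj s s') \<and>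
    (\<Sum>s\<in>S'. card {v. adj s v}) + 3 \<le> card V"
proof -
  obtain S' where S': "S' \<subseteq> S" "card S' = 7" using obtain_subset_with_card_n[OF S(2)] by metis
  have ne: "s \<noteq> c" if "s \<in> S" for s using that c(2) by blast
  have "(\<Sum>s\<in>S'. card {v. adj s v}) + 3 \<le> card V"
  proof (rule degree_sum_bound[OF opt_tree[OF o], where c = c])
    show "S' \<subseteq> V" using S' S by blast
    show "apart T s s'" if "s \<in> S'" "s' \<in> S'" "s \<noteq> s'" for s s' using ap that S' by blast
    show "c \<in> V" "c \<notin> S'" "3 \<le> deg T c" using c S' by (auto simp: br_def)
    fix s p assume s: "s \<in> S'" and p: "{c, p} \<in> T" "\<not> dir T c p s"
    have sS: "s \<in> S" using s S' by blast
    show "\<not> adj s p"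
      using E[OF sS] leaf_away[OF o c(1) _ p] branch_away[OF o c(1) _ _ ne[OF sS] p] by blast
  qed
  moreover have "\<not> adj s s'" if "s \<in> S'" "s' \<in> S'" for s s'
    using ap[of s s'] S'(1) that adj_irrefl by (cases "s = s'") (auto simp: apart_def)
  ultimately show ?thesis using S' S by blast
qed

theorem two_branches_or_independent_set:
  assumes r: "r \<in> V" and con: "\<And>x y. x \<in> V \<Longrightarrow> y \<in> V \<Longrightarrow> conn {{u, v} | u v. adj u v} x y"
  shows "(\<exists>T. is_tree T \<and> card (br T) \<le> 2) \<or>
    (\<exists>S. S \<subseteq> V \<and> card S = 7 \<and> (\<forall>s\<in>S. \<forall>s'\<in>S. \<not> adj s s') \<and>
      (\<Sum>s\<in>S. card {v. adj s v}) + 3 \<le> card V)"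
proof -
  obtain T0 where "is_tree T0" using spanning_tree_exists[OF r con] .
  then obtain T A where ho: "hopt T A" using hopt_exists by blast
  have o: "opt T" using ho by (simp add: hopt_def)
  note T = opt_tree[OF o]
  show ?thesis
  proof (cases "card (br T) \<le> 2")
    case True
    thus ?thesis using T by blast
  next
    case False
    hence b3: "3 \<le> card (br T)" by simp
    have brV: "br T \<subseteq> V" and lfV: "lf T \<subseteq> V" by (auto simp: br_def lf_def)
    have disj: "z \<notin> lf T" if "z \<in> br T" for z using that by (auto simp: br_def lf_def)
    have other: "\<exists>c\<in>br T. c \<notin> X" if "finite X" "card X < card (br T)" for X
      using that card_mono[of X "br T"] by (meson leD subsetI)
    have "3 \<le> card V" using card_mono[OF finV brV] b3 by simp
    hence cnt: "card (lf T) + 2 * card (br T) = 2 + (\<Sum>z\<in>br T. deg T z)" by (intro lf_count[OF T]) simp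
    have lap: "apart T y y'" if "y \<in> lf T" "y' \<in> lf T" "y \<noteq> y'" for y y'
    proof -
      obtain c where "c \<in> br T" using b3 by fastforce
      thus ?thesis using leaves_apart[OF o _ that] by blast
    qed
    have shaped: "shaped_centre V adj T A t"
      if t: "t \<in> br T" and d3: "\<And>z. z \<in> br T \<Longrightarrow> z \<noteq> t \<Longrightarrow> deg T z = 3"
        and sh: "deg T t = 3 \<and> (\<forall>b\<in>br T. \<forall>b'\<in>br T. \<forall>p p'. b \<noteq> t \<longrightarrow> b' \<noteq> t \<longrightarrow>
          dir T t p b \<longrightarrow> dir T t p' b' \<longrightarrow> p = p') \<or> deg T t = 4 \<and> card (br T) = 3" for t
    proof unfold_locales
      show "hopt T A" "t \<in> br T" using ho t by auto
      show "deg T z = 3" if "z \<in> br T" "z \<noteq> t" for z using d3 that .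
      show "\<exists>b\<in>br T. b \<noteq> t" using other[of "{t}"] b3 by auto
      show "deg T t = 3 \<and> (\<forall>b\<in>br T. \<forall>b'\<in>br T. \<forall>p p'. b \<noteq> t \<longrightarrow> b' \<noteq> t \<longrightarrow>
          dir T t p b \<longrightarrow> dir T t p' b' \<longrightarrow> p = p') \<or> deg T t = 4 \<and> card (br T) = 3" using sh .
    qed
    have extreme: "shaped_centre V adj T A t"
      if t: "t \<in> br T" and d3: "\<And>z. z \<in> br T \<Longrightarrow> deg T z = 3"
        and m: "\<And>z. z \<in> br T \<Longrightarrow> z \<noteq> t \<Longrightarrow> dir T t m z" for t m
    proof (rule shaped[OF t d3], blast, rule disjI1, intro conjI d3[OF t] ballI allI impI)
      fix b b' p p' assume "b \<in> br T" "b' \<in> br T" "b \<noteq> t" "b' \<noteq> t" "dir T t p b" "dir T t p' b'"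
      thus "p = p'" using m dir_unique[OF T] by metis
    qed
    have goal: ?thesis if "S \<subseteq> V" "7 \<le> card S" "\<And>s s'. s \<in> S \<Longrightarrow> s' \<in> S \<Longrightarrow> s \<noteq> s' \<Longrightarrow> apart T s s'"
        "c \<in> br T" "c \<notin> S" "\<And>s. s \<in> S \<Longrightarrow> s \<in> lf T \<or> s \<in> br T \<and> deg T c = 3" for S c
      using independent_subset[OF o that] by blast
    have goal1: ?thesis if sc: "shaped_centre V adj T A t" and l: "6 \<le> card (lf T)"
        and c: "c \<in> br T" "c \<noteq> t" for t c
    proof (rule goal[of "insert t (lf T)" c])
      interpret shaped_centre V adj T A t using sc .
      show "insert t (lf T) \<subseteq> V" using tV lfV by blast
      show "7 \<le> card (insert t (lf T))" using l disj[OF tb] by simp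
      show "apart T s s'" if "s \<in> insert t (lf T)" "s' \<in> insert t (lf T)" "s \<noteq> s'" for s s'
        using that centre_apart apart_sym lap by blast
      show "c \<in> br T" "c \<notin> insert t (lf T)" using c disj by auto
      show "s \<in> lf T \<or> s \<in> br T \<and> deg T c = 3" if "s \<in> insert t (lf T)" for s
        using that tb deg3[OF c] by blast
    qed
    show ?thesis
    proof (cases "7 \<le> card (lf T)")
      case True
      obtain c where c: "c \<in> br T" using b3 by fastforce
      show ?thesis by (rule goal[of "lf T" c]) (use lfV True lap c disj in auto)
    next
      case l6: False
      have dg3: "3 \<le> deg T z" if "z \<in> br T" for z using that by (simp add: br_def)
      show ?thesis
      proof (cases "\<exists>t\<in>br T. deg T t \<noteq> 3")
        case True
        then obtain t where "t \<in> br T" "deg T t \<noteq> 3" by blast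
        hence t: "t \<in> br T" "4 \<le> deg T t" using dg3[of t] by simp_all
        have ct: "Suc (card (br T - {t})) = card (br T)" using card_Suc_Diff1[OF finite_br t(1)] .
        have s1: "(\<Sum>z\<in>br T. deg T z) = deg T t + (\<Sum>z\<in>br T - {t}. deg T z)"
          using t(1) by (simp add: sum.remove)
        have lower: "(\<Sum>z\<in>br T - {t}. deg T z) \<ge> 3 * card (br T - {t})"
          using sum_bounded_below[of "br T - {t}" 3 "deg T"] dg3 by (simp add: mult.commute)
        \<comment> \<open>At least three branch vertices, one of degree four or more, give at least
          six leaves; fewer than seven leaves make all these bounds tight.\<close>
        have c2: "card (br T) = 3" and d4: "deg T t = 4" and l: "card (lf T) = 6"
          using cnt s1 lower ct t(2) b3 l6 by linarith+
        have d3: "deg T z = 3" if z: "z \<in> br T" "z \<noteq> t" for z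
        proof -
          have zz: "z \<in> br T - {t}" using z by blast
          have "(\<Sum>z\<in>br T - {t}. deg T z) = deg T z + (\<Sum>z\<in>br T - {t} - {z}. deg T z)"
            using sum.remove[OF _ zz, of "deg T"] by simp
          moreover have "(\<Sum>z\<in>br T - {t} - {z}. deg T z) \<ge> 3 * card (br T - {t} - {z})"
            using sum_bounded_below[of "br T - {t} - {z}" 3 "deg T"] dg3 by (simp add: mult.commute)
          moreover have "card (br T - {t} - {z}) = 1" using zz ct c2 by simp
          ultimately show ?thesis using cnt s1 c2 d4 l dg3[OF z(1)] by linarith
        qed
        have sc: "shaped_centre V adj T A t" using shaped[OF t(1) d3] d4 c2 by blast
        obtain c where "c \<in> br T" "c \<noteq> t" using other[of "{t}"] b3 by auto
        thus ?thesis using goal1[OF sc] l by simp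
      next
        case False
        hence d3: "deg T z = 3" if "z \<in> br T" for z using that by blast
        have "(\<Sum>z\<in>br T. deg T z) = 3 * card (br T)" using d3 by simp
        hence l: "card (lf T) = 2 + card (br T)" using cnt by simp
        obtain b0 where b0: "b0 \<in> br T" using b3 by fastforce
        obtain b1 where b1: "b1 \<in> br T" "b1 \<noteq> b0" using other[of "{b0}"] b3 by auto
        obtain b m where b: "b \<in> br T" "b \<noteq> b0" "\<And>z. z \<in> br T \<Longrightarrow> z \<noteq> b \<Longrightarrow> dir T b m z"
          using extreme_branch[OF T b0 b1] by metis
        note sb = extreme[OF b(1) d3 b(3)]
        show ?thesis
        proof (cases "card (br T) = 3")
          case False
          \<comment> \<open>Four or more branch vertices give at least six leaves, so one extreme
            branch vertex completes the seven.\<close>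
          obtain c where "c \<in> br T" "c \<noteq> b" using other[of "{b}"] b3 by auto
          thus ?thesis using goal1[OF sb] l b3 False by simp
        next
          case c3: True
          \<comment> \<open>Three branch vertices of degree three give five leaves only; both
            extreme ones have to join, and the third remains as \<open>c\<close>.\<close>
          obtain q m' where q: "q \<in> br T" "q \<noteq> b" "\<And>z. z \<in> br T \<Longrightarrow> z \<noteq> q \<Longrightarrow> dir T q m' z"
            using extreme_branch[OF T b(1) b0 b(2)[symmetric]] by metis
          note sq = extreme[OF q(1) d3 q(3)]
          obtain c where c: "c \<in> br T" "c \<noteq> b" "c \<noteq> q"
            using other[of "{b, q}"] c3 q(2) by auto
          have br3: "br T = {b, c, q}"
          proof (rule card_subset_eq[symmetric])
            show "card {b, c, q} = card (br T)" using c3 c q(2) by simp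
          qed (use b c q in auto)
          have bq: "apart T b q"
            using extremes_apart[OF ho br3 c(2)[symmetric] q(2)[symmetric] c(3) d3 b(3) q(3)] .
          have by': "apart T b y" "apart T q y" if "y \<in> lf T" for y
            using shaped_centre.centre_apart[OF sb that] shaped_centre.centre_apart[OF sq that] by auto
          show ?thesis
          proof (rule goal[of "insert b (insert q (lf T))" c])
            show "insert b (insert q (lf T)) \<subseteq> V" using lfV brV b(1) q(1) by blast
            show "7 \<le> card (insert b (insert q (lf T)))"
              using l c3 disj[OF b(1)] disj[OF q(1)] q(2) by simp
            show "apart T s s'" if "s \<in> insert b (insert q (lf T))" "s' \<in> insert b (insert q (lf T))" "s \<noteq> s'" for s s'
              using that bq by' apart_sym lap by blast
            show "c \<in> br T" "c \<notin> insert b (insert q (lf T))" using c disj by auto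
            show "s \<in> lf T \<or> s \<in> br T \<and> deg T c = 3" if "s \<in> insert b (insert q (lf T))" for s
              using that b(1) q(1) d3[OF c(1)] by blast
          qed
        qed
      qed
    qed
  qed
qed

end

section \<open>From vertex pairs to symmetric digraphs\<close>

context graph begin

definition madj :: "'a \<Rightarrow> 'a \<Rightarrow> bool" where
  "madj u v \<longleftrightarrow> (u, v) \<in> arcs_ends G"

lemma ugraph_madj: "ugraph (verts G) madj"
proof
  show "finite (verts G)" by simp
  show "madj v u" if "madj u v" for u v
    using that arcs_ends_symmetric[OF sym_arcs] by (simp add: madj_def)
  show "\<not> madj u u" for u using adj_not_same by (auto simp: madj_def)
  show "u \<in> verts G" if "madj u v" for u v using that adj_in_verts by (simp add: madj_def)
qed

lemma claw_free_madj:
  assumes "claw_free G"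
  shows "claw_free_ugraph (verts G) madj"
proof -
  interpret U: ugraph "verts G" madj by (rule ugraph_madj)
  show ?thesis
  proof
    fix c x y z assume a: "madj c x" "madj c y" "madj c z" and ne: "x \<noteq> y" "x \<noteq> z" "y \<noteq> z"
    show "madj x y \<or> madj x z \<or> madj y z"
    proof (rule ccontr)
      assume n: "\<not> ?thesis"
      let ?W = "{c, x, y, z}" let ?H = "G \<restriction> ?W"
      have W: "?W \<subseteq> verts G" using U.adj_V[OF a(1)] U.adj_V2 a by blast
      have i: "induced_subgraph ?H G" using W by (rule induced_induce)
      interpret H: digraph ?H using digraphI_induced[OF i] .
      have gH: "graph ?H"
        using H.graphI[OF induced_graph_imp_symmetric[OF sym_arcs i]] .
      have cn: "c \<noteq> x" "c \<noteq> y" "c \<noteq> z" using a U.adj_neq by blast+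
      have ends: "arcs_ends ?H = {(u, v). madj u v \<and> u \<in> ?W \<and> v \<in> ?W}"
        by (auto simp: madj_def arcs_ends_conv)
      have sy: "madj x c" "madj y c" "madj z c" using a U.adj_sym by blast+
      have na: "\<not> madj x y" "\<not> madj y x" "\<not> madj x z" "\<not> madj z x" "\<not> madj y z" "\<not> madj z y"
        using n U.adj_sym by blast+
      have bip: "arcs_ends ?H = {c} \<times> {x, y, z} \<union> {x, y, z} \<times> {c}"
      proof -
        have "madj u v \<longleftrightarrow> (u = c) \<noteq> (v = c)" if "u \<in> ?W" "v \<in> ?W" for u v
          using that cn a sy na U.adj_irrefl by (elim insertE emptyE) simp_all
        thus ?thesis unfolding ends using cn by blast
      qed
      have dj: "{c} \<inter> {x, y, z} = {}" using cn by simp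
      have c3: "card {x, y, z} = 3" using ne by simp
      have v: "verts ?H = {c} \<union> {x, y, z}" by auto
      have "complete_bipartite_digraph 1 3 ?H"
        unfolding complete_bipartite_digraph_def
        by (rule conjI[OF gH], rule exI[of _ "{c}"], rule exI[of _ "{x, y, z}"],
          intro conjI v dj c3 bip) simp
      with i have "\<exists>H. induced_subgraph H G \<and> complete_bipartite_digraph 1 3 H"
        by (intro exI conjI)
      with assms show False unfolding claw_free_def by (rule notE)
    qed
  qed
qed

lemma out_degree_madj: "out_degree G x = card {v. madj x v}"
proof -
  have "inj_on (head G) (out_arcs G x)"
    by (rule inj_onI, rule no_multi_arcs) (auto simp: arc_to_ends_def)
  moreover have "head G ` out_arcs G x = {v. madj x v}"
    by (force simp: madj_def arcs_ends_conv)
  ultimately show ?thesis unfolding out_degree_def by (metis card_image)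
qed

lemma connected_madj:
  assumes "connected G" "u \<in> verts G" "v \<in> verts G"
  shows "conn {{u, v} | u v. madj u v} u v"
proof -
  have "strongly_connected G" using symmetric_connected_imp_strongly_connected[OF sym_arcs assms(1)] .
  hence "u \<rightarrow>\<^sup>* v" using assms by (auto simp: strongly_connected_def)
  hence "(u, v) \<in> (arcs_ends G)\<^sup>*" by (rule reachable_rtranclI)
  thus ?thesis
  proof (induct rule: rtrancl_induct)
    case (step y z)
    have "{y, z} \<in> {{u, v} | u v. madj u v}" using step(2) by (auto simp: madj_def)
    thus ?case using step(3) by (rule conn_step[rotated])
  qed simp
qed

section \<open>An edge set as a spanning subdigraph, and its lack of cycles\<close>

definition tree_digraph :: "'a set set \<Rightarrow> ('a, 'b) pre_digraph" where
  "tree_digraph F = G \<lparr> arcs := {e \<in> arcs G. {tail G e, head G e} \<in> F} \<rparr>"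

lemma tree_digraph_simps [simp]:
  "verts (tree_digraph F) = verts G"
  "arcs (tree_digraph F) = {e \<in> arcs G. {tail G e, head G e} \<in> F}"
  "tail (tree_digraph F) = tail G" "head (tree_digraph F) = head G"
  by (simp_all add: tree_digraph_def)

lemma spanning_tree_digraph: "spanning (tree_digraph F) G"
  unfolding spanning_def subgraph_def compatible_def
  by (auto intro!: wf_digraph.intro simp: wf_digraph)

lemma graph_tree_digraph: "graph (tree_digraph F)"
proof -
  have "subgraph (tree_digraph F) G" using spanning_tree_digraph by (simp add: spanning_def)
  then interpret H: digraph "tree_digraph F" by (rule digraph_subgraph)
  show ?thesis
  proof (rule H.graphI)
    show "symmetric (tree_digraph F)"
      unfolding symmetric_conv
    proof
      fix e assume "e \<in> arcs (tree_digraph F)"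
      hence e: "e \<in> arcs G" "{tail G e, head G e} \<in> F" by auto
      obtain e' where e': "e' \<in> arcs G" "tail G e = head G e'" "head G e = tail G e'"
        using sym_arcs e(1) unfolding symmetric_conv by blast
      hence "e' \<in> arcs (tree_digraph F)" using e(2) by (simp add: insert_commute)
      thus "\<exists>e2\<in>arcs (tree_digraph F). tail (tree_digraph F) e = head (tree_digraph F) e2 \<and>
          head (tree_digraph F) e = tail (tree_digraph F) e2" using e' by auto
    qed
  qed
qed

context
  fixes F
  assumes F: "ugraph.is_tree (verts G) madj F"
begin

interpretation U: ugraph "verts G" madj by (rule ugraph_madj)

lemma tree_arcs: "(a, b) \<in> arcs_ends (tree_digraph F) \<longleftrightarrow> {a, b} \<in> F"
proof
  assume "{a, b} \<in> F"
  hence "(a, b) \<in> arcs_ends G" using U.tree_adj[OF F] by (simp add: madj_def)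
  then obtain e where "e \<in> arcs G" "tail G e = a" "head G e = b" by (auto simp: arcs_ends_conv)
  thus "(a, b) \<in> arcs_ends (tree_digraph F)" using \<open>{a, b} \<in> F\<close> by (force simp: arcs_ends_conv)
qed (auto simp: arcs_ends_conv)

lemma connected_tree_digraph: "connected (tree_digraph F)"
proof -
  interpret H: graph "tree_digraph F" by (rule graph_tree_digraph)
  show ?thesis
  proof (rule H.connectedI)
    show "verts (tree_digraph F) \<noteq> {}" using F by (simp add: U.is_tree_def)
    fix u v assume "u \<in> verts (tree_digraph F)" "v \<in> verts (tree_digraph F)"
    hence "conn F u v" "u \<in> verts G" using F by (auto simp: U.is_tree_def)
    hence "u \<rightarrow>\<^sup>*\<^bsub>tree_digraph F\<^esub> v"
    proof (induct rule: conn_induct)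
      case (step y z)
      thus ?case using H.reachable_adj_trans tree_arcs by blast
    qed simp
    thus "u \<rightarrow>\<^sup>*\<^bsub>mk_symmetric (tree_digraph F)\<^esub> v" by (rule H.reachable_mk_symmetricI)
  qed
qed

lemma out_degree_tree_digraph: "out_degree (tree_digraph F) x = deg F x"
proof -
  interpret H: graph "tree_digraph F" by (rule graph_tree_digraph)
  have "out_degree (tree_digraph F) x = card {v. (x, v) \<in> arcs_ends (tree_digraph F)}"
    using H.out_degree_madj by (simp add: H.madj_def)
  thus ?thesis by (simp add: tree_arcs deg_def)
qed

text \<open>A walk that never visits \<open>v\<close> cannot use an edge at \<open>v\<close>. It is
  applied to the part of a cycle that follows its first two arcs.\<close>

lemma walk_conn:
  assumes "pre_digraph.cas (tree_digraph F) w es u" "set es \<subseteq> arcs (tree_digraph F)"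
    "v \<notin> set (pre_digraph.awalk_verts (tree_digraph F) w es)"
  shows "conn (F - {{u', v}}) w u"
  using assms
proof (induct es arbitrary: w)
  case Nil
  thus ?case by (simp add: pre_digraph.cas.simps)
next
  case (Cons e es)
  have e: "tail G e = w" "{tail G e, head G e} \<in> F" "v \<noteq> w"
    and c: "pre_digraph.cas (tree_digraph F) (head G e) es u"
    and n: "v \<notin> set (pre_digraph.awalk_verts (tree_digraph F) (head G e) es)"
    using Cons(2-4) by (auto simp: pre_digraph.cas.simps pre_digraph.awalk_verts.simps)
  have "head G e \<in> set (pre_digraph.awalk_verts (tree_digraph F) (head G e) es)"
    by (cases es) (use c in \<open>auto simp: pre_digraph.cas.simps pre_digraph.awalk_verts.simps\<close>)
  hence "v \<noteq> head G e" using n by blast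
  hence "{w, head G e} \<in> F - {{u', v}}" using e by (auto simp: doubleton_eq_iff)
  moreover have "conn (F - {{u', v}}) (head G e) u" using Cons c n by auto
  ultimately show ?case using conn_trans conn_edge by metis
qed

text \<open>The other arcs of the cycle reconnect the ends of its first edge, which contradicts
  \<open>bridge\<close>. Length at least three ensures that the second arc is not the reversal of
  the first.\<close>

lemma acyclic_tree_digraph:
  assumes c: "pre_digraph.cycle (tree_digraph F) p" and l: "3 \<le> length p"
  shows False
proof -
  let ?H = "tree_digraph F"
  obtain u where u: "pre_digraph.awalk ?H u p u" "distinct (tl (pre_digraph.awalk_verts ?H u p))"
    using c by (auto simp: pre_digraph.cycle_def)
  obtain a b es where p: "p = a # b # es" "es \<noteq> []"
    using l by (cases p; cases "tl p"; cases "tl (tl p)") auto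
  let ?v = "head G a" and ?w = "head G b"
  have A: "set p \<subseteq> arcs ?H" "tail G a = u" "tail G b = ?v" "pre_digraph.cas ?H ?w es u"
    using u(1) p by (auto simp: pre_digraph.awalk_def pre_digraph.cas.simps)
  have d: "distinct (?v # pre_digraph.awalk_verts ?H ?w es)"
    using u(2) p A by (simp add: pre_digraph.awalk_verts.simps)
  \<comment> \<open>\<open>u\<close> is the end of the nonempty remainder \<open>es\<close>, which
    starts at \<open>?w\<close>, and the vertices along it are distinct.\<close>
  have wu: "?w \<noteq> u"
  proof -
    obtain e es' where e: "es = e # es'" using p(2) by (cases es) auto
    have last: "u \<in> set (pre_digraph.awalk_verts ?H x xs)" if "pre_digraph.cas ?H x xs u" for x xs
      using that by (induct xs arbitrary: x) (auto simp: pre_digraph.cas.simps pre_digraph.awalk_verts.simps)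
    have "u \<in> set (pre_digraph.awalk_verts ?H (head G e) es')"
      using A(4) e by (intro last) (simp add: pre_digraph.cas.simps)
    moreover have "tail G e = ?w" using A(4) e by (simp add: pre_digraph.cas.simps)
    ultimately show ?thesis using d e by (auto simp: pre_digraph.awalk_verts.simps)
  qed
  have uv: "{u, ?v} \<in> F" and vw: "{?v, ?w} \<in> F" using A p by auto
  have "{?v, ?w} \<noteq> {u, ?v}" using wu U.tree_neq[OF F vw] by (auto simp: doubleton_eq_iff)
  hence "conn (F - {{u, ?v}}) ?v ?w" using vw by (intro conn_edge) auto
  moreover have "conn (F - {{u, ?v}}) ?w u"
    using A p d by (intro walk_conn) auto
  ultimately have "conn (F - {{u, ?v}}) u ?v" using conn_sym[OF conn_trans] by metis
  thus False using U.bridge[OF F uv] by blast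
qed

lemma undirected_spanning_tree_digraph: "undirected_spanning_tree (tree_digraph F) G"
  unfolding undirected_spanning_tree_def undirected_tree_def
  using graph_tree_digraph connected_tree_digraph spanning_tree_digraph acyclic_tree_digraph by blast

lemma branch_vertices_tree_digraph: "branch_vertices (tree_digraph F) = {z \<in> verts G. 3 \<le> deg F z}"
  by (simp add: branch_vertices_def out_degree_tree_digraph)

end

end

theorem theorem1p4:
  fixes G :: "('a,'b) pre_digraph" and n :: nat
  assumes "graph G" and "connected G" and "claw_free G"
    and "card (verts G) = n"
    and "sigma 7 G \<ge> enat (n - 2)"
  shows "\<exists>T. undirected_spanning_tree T G \<and> card (branch_vertices T) \<le> 2"
proof -
  interpret graph G by fact
  interpret U: claw_free_ugraph "verts G" madj by (rule claw_free_madj[OF assms(3)])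
  have "verts G \<noteq> {}" using assms(2) by (auto simp: connected_def strongly_connected_def)
  then obtain r where r: "r \<in> verts G" by blast
  have "\<not> (\<exists>S. S \<subseteq> verts G \<and> card S = 7 \<and> (\<forall>s\<in>S. \<forall>s'\<in>S. \<not> madj s s') \<and>
      (\<Sum>s\<in>S. card {v. madj s v}) + 3 \<le> card (verts G))"
  proof
    assume "\<exists>S. S \<subseteq> verts G \<and> card S = 7 \<and> (\<forall>s\<in>S. \<forall>s'\<in>S. \<not> madj s s') \<and>
      (\<Sum>s\<in>S. card {v. madj s v}) + 3 \<le> card (verts G)"
    then obtain S where S: "S \<subseteq> verts G" "card S = 7" "\<forall>s\<in>S. \<forall>s'\<in>S. \<not> madj s s'"
      "(\<Sum>s\<in>S. out_degree G s) + 3 \<le> n"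
      unfolding out_degree_madj assms(4) by blast
    have "independent_set G S" using S by (simp add: independent_set_def madj_def)
    hence "sigma 7 G \<le> enat (\<Sum>s\<in>S. out_degree G s)"
      unfolding sigma_def using S(2) by (intro INF_lower) simp
    hence "enat (n - 2) \<le> enat (\<Sum>s\<in>S. out_degree G s)" using assms(5) by (rule order_trans[rotated])
    \<comment> \<open>The truncated difference \<open>n - 2\<close> does no harm, because
      \<open>S(4)\<close> implies that \<open>n\<close> is at least three.\<close>
    thus False using S(4) by simp
  qed
  then obtain F where F: "U.is_tree F" "card (U.br F) \<le> 2"
    using U.two_branches_or_independent_set[OF r connected_madj[OF assms(2)]] by blast
  have "card (branch_vertices (tree_digraph F)) \<le> 2"
    using F(2) branch_vertices_tree_digraph[OF F(1)] by (simp add: U.br_def)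
  thus ?thesis using undirected_spanning_tree_digraph[OF F(1)] by blast
qed

end
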